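(* Let $\Lambda$ be a finite-dimensional algebra over a field $k$ with $E=\Lambda/\operatorname{rad}\Lambda$ separable over $k$, and suppose $\Lambda$ is selfinjective and not semisimple. Then $\Lambda^{\mathrm e}$ is selfinjective, $\operatorname{Ext}^n_{\Lambda^{\mathrm e}}(\Lambda,\Lambda^{\mathrm e})=0$ for all $n\ge1$, and $$\tau_n\Lambda=B_n=\operatorname{im}\nu(d_{n+1})\qquad\text{for all } n\ge1 .$$ Thus, for every $n\ge1$, $\operatorname{Tor}_n^\Lambda(\mathsf{D}\Lambda,\mathsf{D}\Lambda)=0$ and $\tau_n\Lambda$ consists entirely of the boundary subbimodule $B_n$.
   Context: $\mathsf{D}=\operatorname{Hom}_k(-,k)$; $\Lambda^{\mathrm e}=\Lambda\otimes_k\Lambda^{\mathrm{op}}$; $\Lambda$-bimodules are identified with left $\Lambda^{\mathrm e}$-modules, all finite-dimensional. $\nu=\mathsf{D}\operatorname{Hom}_{\Lambda^{\mathrm e}}(-,\Lambda^{\mathrm e})$ is the Nakayama functor of $\operatorname{mod}\Lambda^{\mathrm e}$. $P_\bullet\to\Lambda$, with differentials $d_n\colon P_n\to P_{n-1}$, is the minimal projective resolution of the regular bimodule over $\Lambda^{\mathrm e}$ (Happel's resolution). $B_n=\operatorname{im}\nu(d_{n+1})\subseteq\nu(P_n)$. With $\tau=\mathsf{D}\operatorname{Tr}$ the Auslander--Reiten translate of $\operatorname{mod}\Lambda^{\mathrm e}$ and $\Omega$ the minimal syzygy, $\tau_n=\tau\Omega^{n-1}$ for $n\ge1$; $\tau_n\Lambda$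 is realised as $\ker\nu(d_n)\subseteq\nu(P_n)$ via the minimal presentation $P_n\to P_{n-1}\to\Omega^{n-1}\Lambda\to0$. *)

theory Defs
  imports "HOL-Algebra.Free_Abelian_Groups" "HOL-Algebra.Module" "HOL-Algebra.QuotRing"
begin

text \<open>
  A \<open>k\<close>-algebra is a record of type \<open>('k, 'a) module\<close> (scalars from \<open>k\<close>, multiplication in the
  fields of the ring), a left module over a ring \<open>A\<close> is a record of type \<open>('a, 'm) module\<close> whose fields
  \<open>mult\<close> and \<open>one\<close> are not used.  The locale \<open>module\<close> of the library is confined to commutative rings.
  Right modules are left modules over the opposite ring.  Maps between carriers are taken to be
  extensional, so that Hom-sets and dual spaces are sets of functions with the expected equality.
\<close>


section \<open>Algebras and modules\<close>

definition k_algebra :: "'k ring \<Rightarrow> ('k, 'a) module \<Rightarrow> bool" where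
  "k_algebra K A \<longleftrightarrow> field K \<and> ring A \<and> module K A \<and>
     (\<forall>c\<in>carrier K. \<forall>x\<in>carrier A. \<forall>y\<in>carrier A.
        (c \<odot>\<^bsub>A\<^esub> x) \<otimes>\<^bsub>A\<^esub> y = c \<odot>\<^bsub>A\<^esub> (x \<otimes>\<^bsub>A\<^esub> y) \<and>
        x \<otimes>\<^bsub>A\<^esub> (c \<odot>\<^bsub>A\<^esub> y) = c \<odot>\<^bsub>A\<^esub> (x \<otimes>\<^bsub>A\<^esub> y))"

definition fin_dim :: "'k ring \<Rightarrow> ('k, 'v) module \<Rightarrow> bool" where
  "fin_dim K V \<longleftrightarrow> (\<exists>B. finite B \<and> B \<subseteq> carrier V \<and>
     (\<forall>v\<in>carrier V. \<exists>c\<in>B \<rightarrow> carrier K. v = (\<Oplus>\<^bsub>V\<^esub>b\<in>B. c b \<odot>\<^bsub>V\<^esub> b)))"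

definition fd_algebra :: "'k ring \<Rightarrow> ('k, 'a) module \<Rightarrow> bool" where
  "fd_algebra K A \<longleftrightarrow> k_algebra K A \<and> fin_dim K A"

definition opposite :: "('a, 'z) monoid_scheme \<Rightarrow> ('a, 'z) monoid_scheme" where
  "opposite A = A\<lparr>monoid.mult := (\<lambda>x y. y \<otimes>\<^bsub>A\<^esub> x)\<rparr>"

locale left_module = R?: ring R + M?: abelian_group M
  for R :: "('a, 'z) ring_scheme" (structure) and M :: "('a, 'm) module" (structure) +
  assumes smult_closed:
      "\<lbrakk>a \<in> carrier R; x \<in> carrier M\<rbrakk> \<Longrightarrow> a \<odot>\<^bsub>M\<^esub> x \<in> carrier M"
    and smult_l_distr:
      "\<lbrakk>a \<in> carrier R; b \<in> carrier R; x \<in> carrier M\<rbrakk> \<Longrightarrow>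
        (a \<oplus> b) \<odot>\<^bsub>M\<^esub> x = a \<odot>\<^bsub>M\<^esub> x \<oplus>\<^bsub>M\<^esub> b \<odot>\<^bsub>M\<^esub> x"
    and smult_r_distr:
      "\<lbrakk>a \<in> carrier R; x \<in> carrier M; y \<in> carrier M\<rbrakk> \<Longrightarrow>
        a \<odot>\<^bsub>M\<^esub> (x \<oplus>\<^bsub>M\<^esub> y) = a \<odot>\<^bsub>M\<^esub> x \<oplus>\<^bsub>M\<^esub> a \<odot>\<^bsub>M\<^esub> y"
    and smult_assoc1:
      "\<lbrakk>a \<in> carrier R; b \<in> carrier R; x \<in> carrier M\<rbrakk> \<Longrightarrow>
        (a \<otimes> b) \<odot>\<^bsub>M\<^esub> x = a \<odot>\<^bsub>M\<^esub> (b \<odot>\<^bsub>M\<^esub> x)"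
    and smult_one: "x \<in> carrier M \<Longrightarrow> \<one> \<odot>\<^bsub>M\<^esub> x = x"

definition regular_module :: "('a, 'z) ring_scheme \<Rightarrow> ('a, 'a) module" where
  "regular_module A =
     \<lparr>carrier = carrier A, monoid.mult = monoid.mult A, one = one A, zero = zero A, add = add A, smult = monoid.mult A\<rparr>"

text \<open>The vector space underlying a module over an algebra: \<open>c\<close> acts as \<open>c \<cdot> 1\<^sub>A\<close>.\<close>

definition underlying_space :: "('k, 'a) module \<Rightarrow> ('a, 'm) module \<Rightarrow> ('k, 'm) module" where
  "underlying_space A M =
     \<lparr>carrier = carrier M, monoid.mult = monoid.mult M, one = one M, zero = zero M, add = add M,
      smult = (\<lambda>c x. (c \<odot>\<^bsub>A\<^esub> \<one>\<^bsub>A\<^esub>) \<odot>\<^bsub>M\<^esub> x)\<rparr>"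

definition fd_module :: "'k ring \<Rightarrow> ('k, 'a) module \<Rightarrow> ('a, 'm) module \<Rightarrow> bool" where
  "fd_module K A M \<longleftrightarrow> left_module A M \<and> fin_dim K (underlying_space A M)"

definition mod_hom ::
    "('a, 'z) ring_scheme \<Rightarrow> ('a, 'm) module \<Rightarrow> ('a, 'n) module \<Rightarrow> ('m \<Rightarrow> 'n) set" where
  "mod_hom A M N = {f \<in> carrier M \<rightarrow>\<^sub>E carrier N.
     (\<forall>x\<in>carrier M. \<forall>y\<in>carrier M. f (x \<oplus>\<^bsub>M\<^esub> y) = f x \<oplus>\<^bsub>N\<^esub> f y) \<and>
     (\<forall>a\<in>carrier A. \<forall>x\<in>carrier M. f (a \<odot>\<^bsub>M\<^esub> x) = a \<odot>\<^bsub>N\<^esub> f x)}"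

text \<open>Quotient of a module by a submodule, or of an algebra by a two-sided ideal.\<close>

definition quotient_module :: "('r, 'm) module \<Rightarrow> 'm set \<Rightarrow> ('r, 'm set) module" where
  "quotient_module M I =
     \<lparr>carrier = a_rcosets\<^bsub>M\<^esub> I, monoid.mult = rcoset_mult M I, one = I +>\<^bsub>M\<^esub> \<one>\<^bsub>M\<^esub>,
      zero = I, add = set_add M, smult = (\<lambda>a X. \<Union>x\<in>X. I +>\<^bsub>M\<^esub> (a \<odot>\<^bsub>M\<^esub> x))\<rparr>"


section \<open>Projective, injective and semisimple modules\<close>

text \<open>
  The test modules range over \<open>mod A\<close>, the finite-dimensional left modules.  Each of these is
  isomorphic to a module whose carrier consists of coordinate vectors (functions
  \<open>nat \<Rightarrow> 'k\<close>), so it is enough to let the quantifiers range over modules on this type.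
\<close>

definition projective_module :: "'k ring \<Rightarrow> ('k, 'a) module \<Rightarrow> ('a, 'm) module \<Rightarrow> bool" where
  "projective_module K A P \<longleftrightarrow>
     (\<forall>(M :: ('a, nat \<Rightarrow> 'k) module) (N :: ('a, nat \<Rightarrow> 'k) module). fd_module K A M \<longrightarrow> fd_module K A N \<longrightarrow>
       (\<forall>g\<in>mod_hom A M N. \<forall>f\<in>mod_hom A P N. g ` carrier M = carrier N \<longrightarrow>
          (\<exists>h\<in>mod_hom A P M. compose (carrier P) g h = f)))"

definition injective_module :: "'k ring \<Rightarrow> ('k, 'a) module \<Rightarrow> ('a, 'm) module \<Rightarrow> bool" where
  "injective_module K A I \<longleftrightarrow>
     (\<forall>(M :: ('a, nat \<Rightarrow> 'k) module) (N :: ('a, nat \<Rightarrow> 'k) module). fd_module K A M \<longrightarrow> fd_module K A N \<longrightarrow>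
       (\<forall>g\<in>mod_hom A M N. \<forall>f\<in>mod_hom A M I. inj_on g (carrier M) \<longrightarrow>
          (\<exists>h\<in>mod_hom A N I. compose (carrier M) h g = f)))"

definition selfinjective :: "'k ring \<Rightarrow> ('k, 'a) module \<Rightarrow> bool" where
  "selfinjective K A \<longleftrightarrow> injective_module K A (regular_module A)"

definition semisimple_module :: "('a, 'z) ring_scheme \<Rightarrow> ('a, 'm) module \<Rightarrow> bool" where
  "semisimple_module A M \<longleftrightarrow> (\<forall>N. submodule N A M \<longrightarrow>
     (\<exists>N'. submodule N' A M \<and> N \<inter> N' = {\<zero>\<^bsub>M\<^esub>} \<and> N <+>\<^bsub>M\<^esub> N' = carrier M))"

definition semisimple_ring :: "('a, 'z) ring_scheme \<Rightarrow> bool" where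
  "semisimple_ring A \<longleftrightarrow> semisimple_module A (regular_module A)"

definition maximal_left_ideal :: "'a set \<Rightarrow> ('a, 'z) ring_scheme \<Rightarrow> bool" where
  "maximal_left_ideal I A \<longleftrightarrow> submodule I A (regular_module A) \<and> I \<noteq> carrier A \<and>
     (\<forall>J. submodule J A (regular_module A) \<longrightarrow> I \<subseteq> J \<longrightarrow> J = I \<or> J = carrier A)"

definition radical :: "('a, 'z) ring_scheme \<Rightarrow> 'a set" where
  "radical A = {x \<in> carrier A. \<forall>I. maximal_left_ideal I A \<longrightarrow> x \<in> I}"


section \<open>Tensor products\<close>

text \<open>
  \<open>X \<otimes>\<^sub>A Y\<close> for a right module \<open>X\<close>, given as a left module over the opposite ring (so that
  \<open>a \<odot>\<^bsub>X\<^esub> x\<close> stands for \<open>x a\<close>), and a left module \<open>Y\<close>: the free abelian group on the pairs modulo the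
  usual relations.
\<close>

definition tensor_relations ::
    "('a, 'z) ring_scheme \<Rightarrow> ('a, 'm) module \<Rightarrow> ('a, 'n) module \<Rightarrow> ('m \<times> 'n \<Rightarrow>\<^sub>0 int) set" where
  "tensor_relations A X Y = generate (free_Abelian_group (carrier X \<times> carrier Y))
     ({frag_of (x \<oplus>\<^bsub>X\<^esub> x', y) - frag_of (x, y) - frag_of (x', y) | x x' y.
         x \<in> carrier X \<and> x' \<in> carrier X \<and> y \<in> carrier Y} \<union>
      {frag_of (x, y \<oplus>\<^bsub>Y\<^esub> y') - frag_of (x, y) - frag_of (x, y') | x y y'.
         x \<in> carrier X \<and> y \<in> carrier Y \<and> y' \<in> carrier Y} \<union>
      {frag_of (a \<odot>\<^bsub>X\<^esub> x, y) - frag_of (x, a \<odot>\<^bsub>Y\<^esub> y) | a x y.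
         a \<in> carrier A \<and> x \<in> carrier X \<and> y \<in> carrier Y})"

definition tensor_group ::
    "('a, 'z) ring_scheme \<Rightarrow> ('a, 'm) module \<Rightarrow> ('a, 'n) module \<Rightarrow> ('m \<times> 'n \<Rightarrow>\<^sub>0 int) set monoid" where
  "tensor_group A X Y =
     free_Abelian_group (carrier X \<times> carrier Y) Mod tensor_relations A X Y"

definition tensor_class ::
    "('a, 'z) ring_scheme \<Rightarrow> ('a, 'm) module \<Rightarrow> ('a, 'n) module \<Rightarrow>
     ('m \<times> 'n \<Rightarrow>\<^sub>0 int) \<Rightarrow> ('m \<times> 'n \<Rightarrow>\<^sub>0 int) set" where
  "tensor_class A X Y u =
     tensor_relations A X Y #>\<^bsub>free_Abelian_group (carrier X \<times> carrier Y)\<^esub> u"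

text \<open>\<open>f \<otimes> Y\<close> for \<open>f : X \<rightarrow> X'\<close>.  The union runs over the representatives of one class, all of
  which have the same image.\<close>

definition tensor_map ::
    "('a, 'z) ring_scheme \<Rightarrow> ('a, 'm) module \<Rightarrow> ('a, 'm') module \<Rightarrow> ('a, 'n) module \<Rightarrow> ('m \<Rightarrow> 'm') \<Rightarrow>
     ('m \<times> 'n \<Rightarrow>\<^sub>0 int) set \<Rightarrow> ('m' \<times> 'n \<Rightarrow>\<^sub>0 int) set" where
  "tensor_map A X X' Y f = (\<lambda>U\<in>carrier (tensor_group A X Y).
     \<Union>u\<in>U. tensor_class A X' Y (frag_extend (\<lambda>(x, y). frag_of (f x, y)) u))"

text \<open>The algebra \<open>A \<otimes>\<^sub>K B\<close> with \<open>(a \<otimes> b) (a' \<otimes> b') = a a' \<otimes> b b'\<close>.\<close>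

definition tensor_algebra ::
    "'k ring \<Rightarrow> ('k, 'a) module \<Rightarrow> ('k, 'b) module \<Rightarrow> ('k, ('a \<times> 'b \<Rightarrow>\<^sub>0 int) set) module" where
  "tensor_algebra K A B =
     \<lparr>carrier = carrier (tensor_group K A B),
      monoid.mult = (\<lambda>U V. \<Union>u\<in>U. \<Union>v\<in>V. tensor_class K A B
        (frag_extend (\<lambda>(a, b). frag_extend (\<lambda>(a', b'). frag_of (a \<otimes>\<^bsub>A\<^esub> a', b \<otimes>\<^bsub>B\<^esub> b')) v) u)),
      one = tensor_class K A B (frag_of (\<one>\<^bsub>A\<^esub>, \<one>\<^bsub>B\<^esub>)),
      zero = one (tensor_group K A B),
      add = monoid.mult (tensor_group K A B),
      smult = (\<lambda>c U. \<Union>u\<in>U. tensor_class K A B (frag_extend (\<lambda>(a, b). frag_of (c \<odot>\<^bsub>A\<^esub> a, b)) u))\<rparr>"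

definition enveloping ::
    "'k ring \<Rightarrow> ('k, 'a) module \<Rightarrow> ('k, ('a \<times> 'a \<Rightarrow>\<^sub>0 int) set) module" where
  "enveloping K A = tensor_algebra K A (opposite A)"

text \<open>\<open>A\<close> as a left module over its enveloping algebra: \<open>(\<Sum> n\<^sub>i (a\<^sub>i \<otimes> b\<^sub>i)) x = \<Sum> n\<^sub>i a\<^sub>i x b\<^sub>i\<close>, independently of
  the representative.\<close>

definition regular_bimodule ::
    "('k, 'a) module \<Rightarrow> (('a \<times> 'a \<Rightarrow>\<^sub>0 int) set, 'a) module" where
  "regular_bimodule A =
     \<lparr>carrier = carrier A, monoid.mult = monoid.mult A, one = one A, zero = zero A, add = add A,
      smult = (\<lambda>U x. the_elem ((\<lambda>u. \<Oplus>\<^bsub>A\<^esub>p\<in>Poly_Mapping.keys u.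
        [Poly_Mapping.lookup u p] \<cdot>\<^bsub>A\<^esub> (fst p \<otimes>\<^bsub>A\<^esub> x \<otimes>\<^bsub>A\<^esub> snd p)) ` U))\<rparr>"

definition separable :: "'k ring \<Rightarrow> ('k, 'a) module \<Rightarrow> bool" where
  "separable K A \<longleftrightarrow> projective_module K (enveloping K A) (regular_bimodule A)"


section \<open>Duality and the Nakayama functor\<close>

text \<open>\<open>D M = Hom\<^sub>K(M, K)\<close>, a left module over the opposite algebra by \<open>(a \<phi>)(x) = \<phi>(a x)\<close>.\<close>

definition dual :: "'k ring \<Rightarrow> ('k, 'a) module \<Rightarrow> ('a, 'm) module \<Rightarrow> ('a, 'm \<Rightarrow> 'k) module" where
  "dual K A M =
     \<lparr>carrier = mod_hom K (underlying_space A M) (regular_module K),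
      monoid.mult = undefined, one = undefined,
      zero = (\<lambda>x\<in>carrier M. \<zero>\<^bsub>K\<^esub>),
      add = (\<lambda>\<phi> \<psi>. \<lambda>x\<in>carrier M. \<phi> x \<oplus>\<^bsub>K\<^esub> \<psi> x),
      smult = (\<lambda>a \<phi>. \<lambda>x\<in>carrier M. \<phi> (a \<odot>\<^bsub>M\<^esub> x))\<rparr>"

definition dual_map ::
    "'k ring \<Rightarrow> ('k, 'a) module \<Rightarrow> ('a, 'm) module \<Rightarrow> ('a, 'n) module \<Rightarrow> ('m \<Rightarrow> 'n) \<Rightarrow>
     ('n \<Rightarrow> 'k) \<Rightarrow> 'm \<Rightarrow> 'k" where
  "dual_map K A M N f = (\<lambda>\<phi>\<in>carrier (dual K A N). compose (carrier M) \<phi> f)"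

text \<open>\<open>M\<^sup>* = Hom\<^sub>A(M, A)\<close>, a left module over the opposite algebra by \<open>(a g)(x) = g(x) a\<close>.\<close>

definition star :: "('k, 'a) module \<Rightarrow> ('a, 'm) module \<Rightarrow> ('a, 'm \<Rightarrow> 'a) module" where
  "star A M =
     \<lparr>carrier = mod_hom A M (regular_module A),
      monoid.mult = undefined, one = undefined,
      zero = (\<lambda>x\<in>carrier M. \<zero>\<^bsub>A\<^esub>),
      add = (\<lambda>g h. \<lambda>x\<in>carrier M. g x \<oplus>\<^bsub>A\<^esub> h x),
      smult = (\<lambda>a g. \<lambda>x\<in>carrier M. g x \<otimes>\<^bsub>A\<^esub> a)\<rparr>"

definition star_map ::
    "('k, 'a) module \<Rightarrow> ('a, 'm) module \<Rightarrow> ('a, 'n) module \<Rightarrow> ('m \<Rightarrow> 'n) \<Rightarrow> ('n \<Rightarrow> 'a) \<Rightarrow> 'm \<Rightarrow> 'a" where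
  "star_map A M N f = (\<lambda>g\<in>carrier (star A N). compose (carrier M) g f)"

definition nakayama :: "'k ring \<Rightarrow> ('k, 'a) module \<Rightarrow> ('a, 'm) module \<Rightarrow> ('a, ('m \<Rightarrow> 'a) \<Rightarrow> 'k) module" where
  "nakayama K A M = dual K (opposite A) (star A M)"

definition nakayama_map ::
    "'k ring \<Rightarrow> ('k, 'a) module \<Rightarrow> ('a, 'm) module \<Rightarrow> ('a, 'n) module \<Rightarrow> ('m \<Rightarrow> 'n) \<Rightarrow>
     (('m \<Rightarrow> 'a) \<Rightarrow> 'k) \<Rightarrow> ('n \<Rightarrow> 'a) \<Rightarrow> 'k" where
  "nakayama_map K A M N f = dual_map K (opposite A) (star A N) (star A M) (star_map A M N f)"


section \<open>Projective resolutions\<close>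

text \<open>In a resolution \<open>\<dots> \<rightarrow> P 1 \<rightarrow> P 0 \<rightarrow> M \<rightarrow> 0\<close> the differential \<open>d n\<close>, \<open>n \<ge> 1\<close>, goes from \<open>P n\<close> to
  \<open>P (n - 1)\<close>, and \<open>e\<close> is the augmentation; \<open>d 0\<close> is not used.\<close>

definition projective_resolution ::
    "'k ring \<Rightarrow> ('k, 'a) module \<Rightarrow> ('a, 'm) module \<Rightarrow>
     (nat \<Rightarrow> ('a, 'p) module) \<Rightarrow> (nat \<Rightarrow> 'p \<Rightarrow> 'p) \<Rightarrow> ('p \<Rightarrow> 'm) \<Rightarrow> bool" where
  "projective_resolution K A M P d e \<longleftrightarrow>
     (\<forall>n. fd_module K A (P n) \<and> projective_module K A (P n)) \<and>
     e \<in> mod_hom A (P 0) M \<and> e ` carrier (P 0) = carrier M \<and>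
     (\<forall>n. d (Suc n) \<in> mod_hom A (P (Suc n)) (P n)) \<and>
     d 1 ` carrier (P 1) = a_kernel (P 0) M e \<and>
     (\<forall>n\<ge>1. d (Suc n) ` carrier (P (Suc n)) = a_kernel (P n) (P (n - 1)) (d n))"

definition superfluous :: "'m set \<Rightarrow> ('a, 'z) ring_scheme \<Rightarrow> ('a, 'm) module \<Rightarrow> bool" where
  "superfluous N A M \<longleftrightarrow> submodule N A M \<and>
     (\<forall>L. submodule L A M \<longrightarrow> N <+>\<^bsub>M\<^esub> L = carrier M \<longrightarrow> L = carrier M)"

definition projective_cover ::
    "'k ring \<Rightarrow> ('k, 'a) module \<Rightarrow> ('a, 'p) module \<Rightarrow> ('a, 'm) module \<Rightarrow> ('p \<Rightarrow> 'm) \<Rightarrow> bool" where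
  "projective_cover K A P M f \<longleftrightarrow>
     fd_module K A P \<and> projective_module K A P \<and> f \<in> mod_hom A P M \<and>
     f ` carrier P = carrier M \<and> superfluous (a_kernel P M f) A P"

text \<open>
  The minimal syzygies of \<open>M\<close> in such a resolution are \<open>\<Omega>\<^sup>0 M = M\<close>, \<open>\<Omega>\<^sup>1 M = ker e\<close> and
  \<open>\<Omega>\<^sup>n\<^sup>+\<^sup>1 M = ker (d n)\<close> for \<open>n \<ge> 1\<close>, each covered by the next projective.  In particular
  \<open>P n \<rightarrow> P (n - 1) \<rightarrow> \<Omega>\<^sup>n\<^sup>-\<^sup>1 M \<rightarrow> 0\<close> is a minimal projective presentation for every \<open>n \<ge> 1\<close>.
\<close>

definition minimal_projective_resolution ::
    "'k ring \<Rightarrow> ('k, 'a) module \<Rightarrow> ('a, 'm) module \<Rightarrow>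
     (nat \<Rightarrow> ('a, 'p) module) \<Rightarrow> (nat \<Rightarrow> 'p \<Rightarrow> 'p) \<Rightarrow> ('p \<Rightarrow> 'm) \<Rightarrow> bool" where
  "minimal_projective_resolution K A M P d e \<longleftrightarrow>
     projective_cover K A (P 0) M e \<and>
     projective_cover K A (P 1) ((P 0)\<lparr>carrier := a_kernel (P 0) M e\<rparr>) (d 1) \<and>
     (\<forall>n\<ge>1. projective_cover K A (P (Suc n))
        ((P n)\<lparr>carrier := a_kernel (P n) (P (n - 1)) (d n)\<rparr>) (d (Suc n)))"


section \<open>The Auslander--Reiten translate\<close>

text \<open>\<open>Tr\<close> and \<open>\<tau> = D Tr\<close> of the module presented by \<open>f : P1 \<rightarrow> P0\<close>.\<close>

definition transpose ::
    "('k, 'a) module \<Rightarrow> ('a, 'p) module \<Rightarrow> ('a, 'p) module \<Rightarrow> ('p \<Rightarrow> 'p) \<Rightarrow>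
     ('a, ('p \<Rightarrow> 'a) set) module" where
  "transpose A P1 P0 f = quotient_module (star A P1) (star_map A P1 P0 f ` carrier (star A P0))"

definition AR_translate ::
    "'k ring \<Rightarrow> ('k, 'a) module \<Rightarrow> ('a, 'p) module \<Rightarrow> ('a, 'p) module \<Rightarrow> ('p \<Rightarrow> 'p) \<Rightarrow>
     ('a, ('p \<Rightarrow> 'a) set \<Rightarrow> 'k) module" where
  "AR_translate K A P1 P0 f = dual K (opposite A) (transpose A P1 P0 f)"

text \<open>The embedding of \<open>D Tr\<close> into \<open>\<nu>(P1)\<close> dual to the projection of \<open>P1\<^sup>*\<close> onto \<open>Tr\<close>.  Its image is
  the kernel of \<open>\<nu>(f)\<close>, see \<open>AR_translate_realised\<close> below.\<close>

definition AR_translate_embedding ::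
    "'k ring \<Rightarrow> ('k, 'a) module \<Rightarrow> ('a, 'p) module \<Rightarrow> ('a, 'p) module \<Rightarrow> ('p \<Rightarrow> 'p) \<Rightarrow>
     (('p \<Rightarrow> 'a) set \<Rightarrow> 'k) \<Rightarrow> ('p \<Rightarrow> 'a) \<Rightarrow> 'k" where
  "AR_translate_embedding K A P1 P0 f =
     dual_map K (opposite A) (star A P1) (transpose A P1 P0 f)
       (\<lambda>g\<in>carrier (star A P1). (star_map A P1 P0 f ` carrier (star A P0)) +>\<^bsub>star A P1\<^esub> g)"

text \<open>\<open>\<tau>\<^sub>n M = \<tau> \<Omega>\<^sup>n\<^sup>-\<^sup>1 M\<close> for \<open>n \<ge> 1\<close>, taken with the minimal presentation
  \<open>P n \<rightarrow> P (n - 1)\<close> of \<open>\<Omega>\<^sup>n\<^sup>-\<^sup>1 M\<close> and realised as a subset of \<open>\<nu>(P n)\<close>.\<close>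

definition tau ::
    "'k ring \<Rightarrow> ('k, 'a) module \<Rightarrow> (nat \<Rightarrow> ('a, 'p) module) \<Rightarrow> (nat \<Rightarrow> 'p \<Rightarrow> 'p) \<Rightarrow> nat \<Rightarrow>
     (('p \<Rightarrow> 'a) \<Rightarrow> 'k) set" where
  "tau K A P d n = AR_translate_embedding K A (P n) (P (n - 1)) (d n) `
     carrier (AR_translate K A (P n) (P (n - 1)) (d n))"

definition boundaries ::
    "'k ring \<Rightarrow> ('k, 'a) module \<Rightarrow> (nat \<Rightarrow> ('a, 'p) module) \<Rightarrow> (nat \<Rightarrow> 'p \<Rightarrow> 'p) \<Rightarrow> nat \<Rightarrow>
     (('p \<Rightarrow> 'a) \<Rightarrow> 'k) set" where
  "boundaries K A P d n = nakayama_map K A (P (Suc n)) (P n) (d (Suc n)) `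
     carrier (nakayama K A (P (Suc n)))"


section \<open>Ext and Tor, computed from a projective resolution\<close>

definition hom_group ::
    "('a, 'z) ring_scheme \<Rightarrow> ('a, 'm) module \<Rightarrow> ('a, 'n) module \<Rightarrow> ('m \<Rightarrow> 'n) monoid" where
  "hom_group A M N =
     \<lparr>carrier = mod_hom A M N,
      monoid.mult = (\<lambda>f g. \<lambda>x\<in>carrier M. f x \<oplus>\<^bsub>N\<^esub> g x),
      one = (\<lambda>x\<in>carrier M. \<zero>\<^bsub>N\<^esub>)\<rparr>"

definition hom_cocycles ::
    "('a, 'z) ring_scheme \<Rightarrow> (nat \<Rightarrow> ('a, 'p) module) \<Rightarrow> (nat \<Rightarrow> 'p \<Rightarrow> 'p) \<Rightarrow> ('a, 'n) module \<Rightarrow> nat \<Rightarrow>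
     ('p \<Rightarrow> 'n) set" where
  "hom_cocycles A P d N n = kernel (hom_group A (P n) N) (hom_group A (P (Suc n)) N)
     (\<lambda>f. compose (carrier (P (Suc n))) f (d (Suc n)))"

definition hom_coboundaries ::
    "('a, 'z) ring_scheme \<Rightarrow> (nat \<Rightarrow> ('a, 'p) module) \<Rightarrow> (nat \<Rightarrow> 'p \<Rightarrow> 'p) \<Rightarrow> ('a, 'n) module \<Rightarrow> nat \<Rightarrow>
     ('p \<Rightarrow> 'n) set" where
  "hom_coboundaries A P d N n =
     (if n = 0 then {one (hom_group A (P 0) N)}
      else (\<lambda>f. compose (carrier (P n)) f (d n)) ` mod_hom A (P (n - 1)) N)"

definition Ext ::
    "('a, 'z) ring_scheme \<Rightarrow> (nat \<Rightarrow> ('a, 'p) module) \<Rightarrow> (nat \<Rightarrow> 'p \<Rightarrow> 'p) \<Rightarrow> ('a, 'n) module \<Rightarrow> nat \<Rightarrow>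
     ('p \<Rightarrow> 'n) set monoid" where
  "Ext A P d N n = (hom_group A (P n) N)\<lparr>carrier := hom_cocycles A P d N n\<rparr>
     Mod hom_coboundaries A P d N n"

definition tensor_cycles ::
    "('a, 'z) ring_scheme \<Rightarrow> (nat \<Rightarrow> ('a, 'p) module) \<Rightarrow> (nat \<Rightarrow> 'p \<Rightarrow> 'p) \<Rightarrow> ('a, 'n) module \<Rightarrow> nat \<Rightarrow>
     ('p \<times> 'n \<Rightarrow>\<^sub>0 int) set set" where
  "tensor_cycles A P d Y n =
     (if n = 0 then carrier (tensor_group A (P 0) Y)
      else kernel (tensor_group A (P n) Y) (tensor_group A (P (n - 1)) Y)
        (tensor_map A (P n) (P (n - 1)) Y (d n)))"

definition tensor_boundaries ::
    "('a, 'z) ring_scheme \<Rightarrow> (nat \<Rightarrow> ('a, 'p) module) \<Rightarrow> (nat \<Rightarrow> 'p \<Rightarrow> 'p) \<Rightarrow> ('a, 'n) module \<Rightarrow> nat \<Rightarrow>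
     ('p \<times> 'n \<Rightarrow>\<^sub>0 int) set set" where
  "tensor_boundaries A P d Y n =
     tensor_map A (P (Suc n)) (P n) Y (d (Suc n)) ` carrier (tensor_group A (P (Suc n)) Y)"

definition Tor ::
    "('a, 'z) ring_scheme \<Rightarrow> (nat \<Rightarrow> ('a, 'p) module) \<Rightarrow> (nat \<Rightarrow> 'p \<Rightarrow> 'p) \<Rightarrow> ('a, 'n) module \<Rightarrow> nat \<Rightarrow>
     ('p \<times> 'n \<Rightarrow>\<^sub>0 int) set set monoid" where
  "Tor A P d Y n = (tensor_group A (P n) Y)\<lparr>carrier := tensor_cycles A P d Y n\<rparr>
     Mod tensor_boundaries A P d Y n"


section \<open>The translate as a kernel\<close>

lemma star_iff:
  "g \<in> carrier (star A M) \<longleftrightarrow> (\<forall>x\<in>carrier M. g x \<in> carrier A) \<and> (\<forall>x. x \<notin> carrier M \<longrightarrow> g x = undefined) \<and>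
     (\<forall>x\<in>carrier M. \<forall>y\<in>carrier M. g (x \<oplus>\<^bsub>M\<^esub> y) = g x \<oplus>\<^bsub>A\<^esub> g y) \<and>
     (\<forall>a\<in>carrier A. \<forall>x\<in>carrier M. g (a \<odot>\<^bsub>M\<^esub> x) = a \<otimes>\<^bsub>A\<^esub> g x)"
  by (auto simp: star_def mod_hom_def regular_module_def PiE_iff extensional_def)

lemma star_sel:
  "\<zero>\<^bsub>star A M\<^esub> = (\<lambda>x\<in>carrier M. \<zero>\<^bsub>A\<^esub>)" "g \<oplus>\<^bsub>star A M\<^esub> h = (\<lambda>x\<in>carrier M. g x \<oplus>\<^bsub>A\<^esub> h x)"
  "a \<odot>\<^bsub>star A M\<^esub> g = (\<lambda>x\<in>carrier M. g x \<otimes>\<^bsub>A\<^esub> a)"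
  by (simp_all add: star_def)

lemma star_abelian_group:
  assumes A: "ring A" and M: "left_module A M"
  shows "abelian_group (star A M)"
proof -
  interpret A: ring A by (rule A)
  interpret M: left_module A M by (rule M)
  have add_closed: "(\<lambda>x\<in>carrier M. g x \<oplus>\<^bsub>A\<^esub> h x) \<in> carrier (star A M)"
    if "g \<in> carrier (star A M)" "h \<in> carrier (star A M)" for g h
    using that
    by (auto simp: star_iff star_sel M.smult_closed A.r_distr
        A.a_ac)
  have minus_closed: "(\<lambda>x\<in>carrier M. \<ominus>\<^bsub>A\<^esub> g x) \<in> carrier (star A M)"
    if "g \<in> carrier (star A M)" for g
    using that
    by (auto simp: star_iff star_sel M.smult_closed
        A.minus_add A.r_minus)
  show ?thesis
  proof (rule abelian_groupI)
    show "\<zero>\<^bsub>star A M\<^esub> \<in> carrier (star A M)"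
      by (auto simp: star_iff star_sel M.smult_closed)
  next
    fix g h assume "g \<in> carrier (star A M)" "h \<in> carrier (star A M)"
    then show "g \<oplus>\<^bsub>star A M\<^esub> h \<in> carrier (star A M)"
      using add_closed by (simp add: star_sel)
  next
    fix f g h
    assume "f \<in> carrier (star A M)" "g \<in> carrier (star A M)" "h \<in> carrier (star A M)"
    then show "f \<oplus>\<^bsub>star A M\<^esub> g \<oplus>\<^bsub>star A M\<^esub> h = f \<oplus>\<^bsub>star A M\<^esub> (g \<oplus>\<^bsub>star A M\<^esub> h)"
      by (auto simp: star_iff star_sel fun_eq_iff restrict_def A.a_assoc)
  next
    fix g h assume "g \<in> carrier (star A M)" "h \<in> carrier (star A M)"
    then show "g \<oplus>\<^bsub>star A M\<^esub> h = h \<oplus>\<^bsub>star A M\<^esub> g"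
      by (auto simp: star_iff star_sel fun_eq_iff restrict_def A.a_comm)
  next
    fix g assume g: "g \<in> carrier (star A M)"
    then have "\<And>x. x \<notin> carrier M \<Longrightarrow> g x = undefined" "\<And>x. x \<in> carrier M \<Longrightarrow> g x \<in> carrier A"
      by (auto simp: star_iff star_sel)
    then show "\<zero>\<^bsub>star A M\<^esub> \<oplus>\<^bsub>star A M\<^esub> g = g"
      by (auto simp: star_def restrict_def fun_eq_iff)
  next
    fix g assume g: "g \<in> carrier (star A M)"
    then have "(\<lambda>x\<in>carrier M. \<ominus>\<^bsub>A\<^esub> g x) \<oplus>\<^bsub>star A M\<^esub> g = \<zero>\<^bsub>star A M\<^esub>"
      by (auto simp: star_iff star_sel fun_eq_iff restrict_def A.l_neg)
    with minus_closed[OF g] show "\<exists>h\<in>carrier (star A M). h \<oplus>\<^bsub>star A M\<^esub> g = \<zero>\<^bsub>star A M\<^esub>"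
      by blast
  qed
qed

lemma star_smult_closed:
  assumes A: "ring A" and M: "left_module A M" and a: "a \<in> carrier A" and g: "g \<in> carrier (star A M)"
  shows "a \<odot>\<^bsub>star A M\<^esub> g \<in> carrier (star A M)"
proof -
  interpret A: ring A by (rule A)
  interpret M: left_module A M by (rule M)
  show ?thesis
    using a g
    by (auto simp: star_iff star_sel M.smult_closed A.l_distr A.m_assoc)
qed

lemma star_smult_add:
  assumes A: "ring A" and M: "left_module A M" and a: "a \<in> carrier A"
    and g: "g \<in> carrier (star A M)" and h: "h \<in> carrier (star A M)"
  shows "a \<odot>\<^bsub>star A M\<^esub> (g \<oplus>\<^bsub>star A M\<^esub> h) = a \<odot>\<^bsub>star A M\<^esub> g \<oplus>\<^bsub>star A M\<^esub> a \<odot>\<^bsub>star A M\<^esub> h"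
proof -
  interpret A: ring A by (rule A)
  show ?thesis
    using a g h
    by (auto simp: star_iff star_sel restrict_def A.l_distr fun_eq_iff)
qed

lemma star_map_closed:
  assumes A: "ring A" and M: "left_module A M" and N: "left_module A N"
    and f: "f \<in> mod_hom A M N" and g: "g \<in> carrier (star A N)"
  shows "star_map A M N f g \<in> carrier (star A M)"
proof -
  interpret M: left_module A M by (rule M)
  interpret N: left_module A N by (rule N)
  show ?thesis
    using f g
    by (auto simp: star_map_def star_iff star_sel compose_def mod_hom_def PiE_iff
        M.smult_closed)
qed

lemma star_map_add:
  assumes "left_module A M" "left_module A N" "f \<in> mod_hom A M N"
    and "g \<in> carrier (star A N)" "h \<in> carrier (star A N)" "ring A"
  shows "star_map A M N f (g \<oplus>\<^bsub>star A N\<^esub> h) =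
    star_map A M N f g \<oplus>\<^bsub>star A M\<^esub> star_map A M N f h"
proof -
  interpret N: abelian_group "star A N" using assms by (intro star_abelian_group)
  have "g \<oplus>\<^bsub>star A N\<^esub> h \<in> carrier (star A N)" using assms by (intro N.a_closed)
  moreover have "f x \<in> carrier N" if "x \<in> carrier M" for x
    using that assms by (auto simp: mod_hom_def)
  ultimately show ?thesis
    using assms(4,5) by (auto simp: star_map_def compose_def restrict_def fun_eq_iff)
      (auto simp: star_def)
qed

lemma star_map_smult:
  assumes "left_module A M" "left_module A N" "f \<in> mod_hom A M N"
    and "g \<in> carrier (star A N)" "ring A" "a \<in> carrier A"
  shows "star_map A M N f (a \<odot>\<^bsub>star A N\<^esub> g) = a \<odot>\<^bsub>star A M\<^esub> star_map A M N f g"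
proof -
  have "a \<odot>\<^bsub>star A N\<^esub> g \<in> carrier (star A N)" using assms by (intro star_smult_closed)
  moreover have "f x \<in> carrier N" if "x \<in> carrier M" for x
    using that assms by (auto simp: mod_hom_def)
  ultimately show ?thesis
    using assms(4) by (auto simp: star_map_def compose_def restrict_def fun_eq_iff)
      (auto simp: star_def)
qed

lemma AR_translate_realised:
  assumes KA: "k_algebra K A" and P1: "left_module A P1" and P0: "left_module A P0"
    and f: "f \<in> mod_hom A P1 P0"
  shows "AR_translate_embedding K A P1 P0 f ` carrier (AR_translate K A P1 P0 f) =
    a_kernel (nakayama K A P1) (nakayama K A P0) (nakayama_map K A P1 P0 f)"
proof -
  have A: "ring A" and K: "field K" and modA: "module K A" using KA by (auto simp: k_algebra_def)
  interpret A: ring A by (rule A)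
  interpret K: field K by (rule K)
  define X where "X = star A P1"
  define I where "I = star_map A P1 P0 f ` carrier (star A P0)"
  interpret X: abelian_group X unfolding X_def by (rule star_abelian_group[OF A P1])
  interpret Y: abelian_group "star A P0" by (rule star_abelian_group[OF A P0])
  have scal: "c \<odot>\<^bsub>A\<^esub> \<one>\<^bsub>A\<^esub> \<in> carrier A" if "c \<in> carrier K" for c
    using modA that by (simp add: module.smult_closed)
  have hom: "star_map A P1 P0 f \<in> hom (add_monoid (star A P0)) (add_monoid X)"
    unfolding X_def using star_map_closed[OF A P1 P0 f] star_map_add[OF P1 P0 f _ _ A]
    by (auto simp: hom_def)
  have gh: "group_hom (add_monoid (star A P0)) (add_monoid X) (star_map A P1 P0 f)"
    using hom by (simp add: group_hom_def group_hom_axioms_def X.add.is_group Y.add.is_group)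
  have subI: "subgroup I (add_monoid X)"
    unfolding I_def using group_hom.img_is_subgroup[OF gh] by simp
  interpret I: abelian_subgroup I X
    by (rule abelian_subgroupI3) (auto intro: additive_subgroup.intro subI X.abelian_group_axioms)
  have I_sub: "i \<in> carrier X" if "i \<in> I" for i using that I.a_subset by auto
  have smX: "a \<odot>\<^bsub>X\<^esub> g \<in> carrier X" if "a \<in> carrier A" "g \<in> carrier X" for a g
    unfolding X_def using star_smult_closed[OF A P1] that by (simp add: X_def)
  have smI: "a \<odot>\<^bsub>X\<^esub> i \<in> I" if a: "a \<in> carrier A" and i: "i \<in> I" for a i
  proof -
    obtain g where g: "g \<in> carrier (star A P0)" "i = star_map A P1 P0 f g" using i by (auto simp: I_def)
    have "a \<odot>\<^bsub>X\<^esub> i = star_map A P1 P0 f (a \<odot>\<^bsub>star A P0\<^esub> g)"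
      using star_map_smult[OF P1 P0 f g(1) A a] g(2) by (simp add: X_def)
    then show ?thesis using star_smult_closed[OF A P0 a g(1)] by (auto simp: I_def)
  qed
  have coset_smult: "(\<Union>x\<in>I +>\<^bsub>X\<^esub> g. I +>\<^bsub>X\<^esub> (a \<odot>\<^bsub>X\<^esub> x)) = I +>\<^bsub>X\<^esub> (a \<odot>\<^bsub>X\<^esub> g)"
    if a: "a \<in> carrier A" and g: "g \<in> carrier X" for a g
  proof -
    have "I +>\<^bsub>X\<^esub> (a \<odot>\<^bsub>X\<^esub> x) = I +>\<^bsub>X\<^esub> (a \<odot>\<^bsub>X\<^esub> g)" if x: "x \<in> I +>\<^bsub>X\<^esub> g" for x
    proof -
      obtain i where i: "i \<in> I" "x = i \<oplus>\<^bsub>X\<^esub> g" using x by (auto simp: a_r_coset_def')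
      have "a \<odot>\<^bsub>X\<^esub> x = a \<odot>\<^bsub>X\<^esub> i \<oplus>\<^bsub>X\<^esub> a \<odot>\<^bsub>X\<^esub> g"
        using star_smult_add[OF A P1 a, of i g] i g I_sub by (simp add: X_def)
      then have "a \<odot>\<^bsub>X\<^esub> x \<in> I +>\<^bsub>X\<^esub> (a \<odot>\<^bsub>X\<^esub> g)" using smI[OF a i(1)] by (auto simp: a_r_coset_def')
      then show ?thesis using I.a_repr_independence' smX[OF a g] by metis
    qed
    moreover have "g \<in> I +>\<^bsub>X\<^esub> g" using g by (rule I.a_rcos_self)
    ultimately show ?thesis by blast
  qed
  let ?T = "transpose A P1 P0 f"
  let ?B = "opposite A"
  have T: "carrier ?T = (\<lambda>g. I +>\<^bsub>X\<^esub> g) ` carrier X" "\<zero>\<^bsub>?T\<^esub> = I"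
    "\<And>g h. g \<in> carrier X \<Longrightarrow> h \<in> carrier X \<Longrightarrow> (I +>\<^bsub>X\<^esub> g) \<oplus>\<^bsub>?T\<^esub> (I +>\<^bsub>X\<^esub> h) = I +>\<^bsub>X\<^esub> (g \<oplus>\<^bsub>X\<^esub> h)"
    "\<And>a g. a \<in> carrier A \<Longrightarrow> g \<in> carrier X \<Longrightarrow> a \<odot>\<^bsub>?T\<^esub> (I +>\<^bsub>X\<^esub> g) = I +>\<^bsub>X\<^esub> (a \<odot>\<^bsub>X\<^esub> g)"
    unfolding transpose_def quotient_module_def X_def[symmetric] I_def[symmetric]
    using I.a_rcos_sum coset_smult by (auto simp: A_RCOSETS_def')
  have B: "smult ?B = smult A" "\<one>\<^bsub>?B\<^esub> = \<one>\<^bsub>A\<^esub>" "carrier ?B = carrier A"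
    by (simp_all add: opposite_def)
  have dualX: "\<phi> \<in> carrier (dual K ?B X) \<longleftrightarrow> \<phi> \<in> carrier X \<rightarrow>\<^sub>E carrier K \<and>
      (\<forall>g\<in>carrier X. \<forall>h\<in>carrier X. \<phi> (g \<oplus>\<^bsub>X\<^esub> h) = \<phi> g \<oplus>\<^bsub>K\<^esub> \<phi> h) \<and>
      (\<forall>c\<in>carrier K. \<forall>g\<in>carrier X. \<phi> ((c \<odot>\<^bsub>A\<^esub> \<one>\<^bsub>A\<^esub>) \<odot>\<^bsub>X\<^esub> g) = c \<otimes>\<^bsub>K\<^esub> \<phi> g)" for \<phi>
    by (simp add: dual_def mod_hom_def underlying_space_def regular_module_def B)
  have dualT: "\<psi> \<in> carrier (dual K ?B ?T) \<longleftrightarrow> \<psi> \<in> carrier ?T \<rightarrow>\<^sub>E carrier K \<and>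
      (\<forall>g\<in>carrier X. \<forall>h\<in>carrier X. \<psi> (I +>\<^bsub>X\<^esub> (g \<oplus>\<^bsub>X\<^esub> h)) = \<psi> (I +>\<^bsub>X\<^esub> g) \<oplus>\<^bsub>K\<^esub> \<psi> (I +>\<^bsub>X\<^esub> h)) \<and>
      (\<forall>c\<in>carrier K. \<forall>g\<in>carrier X. \<psi> (I +>\<^bsub>X\<^esub> ((c \<odot>\<^bsub>A\<^esub> \<one>\<^bsub>A\<^esub>) \<odot>\<^bsub>X\<^esub> g)) = c \<otimes>\<^bsub>K\<^esub> \<psi> (I +>\<^bsub>X\<^esub> g))" for \<psi>
    using scal by (auto simp: dual_def mod_hom_def underlying_space_def regular_module_def B T)
  have ker: "a_kernel (nakayama K A P1) (nakayama K A P0) (nakayama_map K A P1 P0 f) =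
      {\<phi> \<in> carrier (dual K ?B X). \<forall>i\<in>I. \<phi> i = \<zero>\<^bsub>K\<^esub>}"
    unfolding a_kernel_def' nakayama_def nakayama_map_def dual_map_def X_def[symmetric] I_def
    by (auto simp: dual_def compose_def fun_eq_iff restrict_def X_def)
  have emb: "AR_translate_embedding K A P1 P0 f \<psi> = (\<lambda>g\<in>carrier X. \<psi> (I +>\<^bsub>X\<^esub> g))"
    if "\<psi> \<in> carrier (dual K ?B ?T)" for \<psi>
    using that
    by (auto simp: AR_translate_embedding_def dual_map_def compose_def X_def I_def fun_eq_iff)
  show ?thesis
  proof (intro equalityI subsetI)
    fix \<phi> assume "\<phi> \<in> AR_translate_embedding K A P1 P0 f ` carrier (AR_translate K A P1 P0 f)"
    then obtain \<psi> where \<psi>: "\<psi> \<in> carrier (dual K ?B ?T)" and \<phi>: "\<phi> = (\<lambda>g\<in>carrier X. \<psi> (I +>\<^bsub>X\<^esub> g))"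
      using emb by (auto simp: AR_translate_def)
    have cl: "\<psi> (I +>\<^bsub>X\<^esub> g) \<in> carrier K" if "g \<in> carrier X" for g
      using \<psi> that unfolding dualT T(1) by auto
    have "\<phi> \<in> carrier (dual K ?B X)"
      unfolding dualX using \<psi> cl scal smX by (auto simp: \<phi> dualT)
    moreover have "\<phi> i = \<zero>\<^bsub>K\<^esub>" if i: "i \<in> I" for i
    proof -
      have "\<psi> (I +>\<^bsub>X\<^esub> (\<zero>\<^bsub>X\<^esub> \<oplus>\<^bsub>X\<^esub> \<zero>\<^bsub>X\<^esub>)) = \<psi> (I +>\<^bsub>X\<^esub> \<zero>\<^bsub>X\<^esub>) \<oplus>\<^bsub>K\<^esub> \<psi> (I +>\<^bsub>X\<^esub> \<zero>\<^bsub>X\<^esub>)"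
        using \<psi> X.zero_closed unfolding dualT by blast
      then have "\<psi> I \<oplus>\<^bsub>K\<^esub> \<psi> I = \<psi> I"
        unfolding X.r_zero[OF X.zero_closed] I.a_rcos_const[OF I.zero_closed] by (rule sym)
      moreover have "\<psi> I \<in> carrier K"
        using cl[OF X.zero_closed] unfolding I.a_rcos_const[OF I.zero_closed] .
      ultimately have "\<psi> I = \<zero>\<^bsub>K\<^esub>" using K.add.r_cancel_one[of "\<psi> I" "\<psi> I"] by simp
      then show ?thesis using i I_sub by (simp add: \<phi> I.a_rcos_const)
    qed
    ultimately show "\<phi> \<in> a_kernel (nakayama K A P1) (nakayama K A P0) (nakayama_map K A P1 P0 f)"
      by (simp add: ker)
  next
    fix \<phi> assume "\<phi> \<in> a_kernel (nakayama K A P1) (nakayama K A P0) (nakayama_map K A P1 P0 f)"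
    then have \<phi>: "\<phi> \<in> carrier (dual K ?B X)" and van: "\<And>i. i \<in> I \<Longrightarrow> \<phi> i = \<zero>\<^bsub>K\<^esub>" by (auto simp: ker)
    define \<psi> where "\<psi> = (\<lambda>U\<in>carrier ?T. the_elem (\<phi> ` U))"
    have val: "\<psi> (I +>\<^bsub>X\<^esub> g) = \<phi> g" if g: "g \<in> carrier X" for g
    proof -
      have "\<phi> x = \<phi> g" if x: "x \<in> I +>\<^bsub>X\<^esub> g" for x
      proof -
        obtain i where i: "i \<in> I" "x = i \<oplus>\<^bsub>X\<^esub> g" using x by (auto simp: a_r_coset_def')
        have "\<phi> g \<in> carrier K" using \<phi> g unfolding dualX by auto
        then show ?thesis using \<phi> i g I_sub van unfolding dualX by auto
      qed
      moreover have "g \<in> I +>\<^bsub>X\<^esub> g" using g by (rule I.a_rcos_self)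
      ultimately have "\<phi> ` (I +>\<^bsub>X\<^esub> g) = {\<phi> g}" by blast
      then show ?thesis using g by (auto simp: \<psi>_def T(1))
    qed
    have "\<psi> \<in> carrier ?T \<rightarrow>\<^sub>E carrier K"
      using \<phi> val by (auto simp: T(1) dualX) (auto simp: \<psi>_def T(1))
    then have \<psi>: "\<psi> \<in> carrier (dual K ?B ?T)"
      unfolding dualT using \<phi> scal smX by (auto simp: dualX val)
    have "AR_translate_embedding K A P1 P0 f \<psi> = \<phi>"
      unfolding emb[OF \<psi>] using \<phi> val unfolding dualX by (auto simp: fun_eq_iff)
    with \<psi> show "\<phi> \<in> AR_translate_embedding K A P1 P0 f ` carrier (AR_translate K A P1 P0 f)"
      by (auto simp: AR_translate_def)
  qed
qed

end

theory Submission
  imports Defs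
begin

text \<open>
  Let \<open>D A\<close> be the dual of the right regular module of a finite-dimensional algebra \<open>A\<close>, and \<open>Tr A\<close> the
  additive span of the values \<open>G(\<phi>)\<close> of the left linear maps \<open>G : D A \<rightarrow> A\<close>.  Everything rests on the
  condition \<open>1 \<in> Tr A\<close>, which says that \<open>A\<close> is a direct summand of a power of \<open>D A\<close>.

  If \<open>A\<close> is selfinjective, the embedding of \<open>A\<close> into \<open>Hom\<^sub>K(A, A)\<close>, a power of \<open>D A\<close>, by right
  multiplications splits, whence \<open>1 \<in> Tr A\<close>.  Conversely, let \<open>f : M \<rightarrow> A\<close> vanish on the kernel of
  \<open>g : M \<rightarrow> N\<close>.  Since linear forms extend, \<open>x \<mapsto> f(x) c\<close> factors through \<open>g\<close> for every \<open>c \<in> Tr A\<close>.  So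
  \<open>1 \<in> Tr A\<close> makes \<open>Hom\<^sub>A(-, A)\<close> exact; this yields the vanishing of \<open>Ext\<close> and, after dualising,
  \<open>ker \<nu>(d\<^sub>n) = im \<nu>(d\<^sub>n\<^sub>+\<^sub>1)\<close>.

  The condition is inherited by the opposite algebra.  A map \<open>G\<close> has an adjoint \<open>H\<close> with
  \<open>\<psi>(H(\<phi>)) = \<phi>(G(\<psi>))\<close>, which is left linear over the opposite algebra, and
  \<open>G'(\<psi>(c -)) = G(\<psi>) b G'(\<phi>)\<close> for \<open>c = H(b \<phi>)\<close>.  If \<open>1 \<in> Tr A\<close>, the operator sending an ideal \<open>J\<close> to the
  span of the \<open>H(b \<phi>)\<close> with \<open>b \<in> J\<close> therefore reflects inclusions.  Its iterates on \<open>A\<close> descend, so they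
  stabilise, so they are constant, and the first of them lies in the trace of the opposite algebra.

  It is also inherited by tensor products, hence by the enveloping algebra.  Finally, \<open>1\<close> in the
  trace of the opposite algebra means that the identity of \<open>D A\<close> factors through a power of \<open>A\<close>, so
  that tensoring with \<open>D A\<close> is exact.
\<close>

section \<open>Vector spaces and linear forms\<close>

text \<open>The link between the trace and direct summands: if
  \<open>1 = G1 \<phi>1 + ... + Gn \<phi>n\<close>, then
  \<open>a = G1 (a \<phi>1) + ... + Gn (a \<phi>n)\<close> for every \<open>a\<close>. So the
  \<open>Gi\<close> together map the n-th power of \<open>D A\<close> onto \<open>A\<close>, and
  \<open>a \<mapsto> (a \<phi>i)\<close> splits this map. The proof works only with membership of
  \<open>1\<close> in an additive span; it forms neither direct sums nor decompositions into
  indecomposables.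

  The obstacle is that selfinjectivity is a condition on left modules, whereas the enveloping
  algebra needs it on both sides. The usual proof of left-right symmetry compares indecomposable
  projectives with indecomposable injectives. Here a descending chain of two-sided ideals takes its
  place. The map \<open>H\<close> is the dual \<open>D G\<close>, read through the identification of
  the bidual of \<open>A\<close> with \<open>A\<close>; the formula for
  \<open>G'(\<psi>(c -))\<close> then allows an ideal to be recovered from its image under the
  operator, because \<open>b = 1 b 1\<close> and both units are sums of values.\<close>

definition mod_lin ::
    "('a, 'z) ring_scheme \<Rightarrow> ('a, 'm) module \<Rightarrow> ('a, 'n) module \<Rightarrow> ('m \<Rightarrow> 'n) \<Rightarrow> bool" where
  "mod_lin A M N f \<longleftrightarrow> f \<in> carrier M \<rightarrow> carrier N \<and>
     (\<forall>x\<in>carrier M. \<forall>y\<in>carrier M. f (x \<oplus>\<^bsub>M\<^esub> y) = f x \<oplus>\<^bsub>N\<^esub> f y) \<and>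
     (\<forall>a\<in>carrier A. \<forall>x\<in>carrier M. f (a \<odot>\<^bsub>M\<^esub> x) = a \<odot>\<^bsub>N\<^esub> f x)"

abbreviation form :: "'k ring \<Rightarrow> ('k, 'v) module \<Rightarrow> ('v \<Rightarrow> 'k) \<Rightarrow> bool" where
  "form K V \<equiv> mod_lin K V (regular_module K)"

text \<open>\<open>mod_lin\<close> leaves out extensionality: composites and plain lambda terms
  satisfy it as they stand, and restriction to the carrier is postponed to the places where a
  Hom-set is met.\<close>

lemma mod_hom_iff: "f \<in> mod_hom A M N \<longleftrightarrow> mod_lin A M N f \<and> f \<in> extensional (carrier M)"
  by (auto simp: mod_hom_def mod_lin_def PiE_iff)

lemma mod_linI:
  assumes "\<And>x. x \<in> carrier M \<Longrightarrow> f x \<in> carrier N"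
    and "\<And>x y. x \<in> carrier M \<Longrightarrow> y \<in> carrier M \<Longrightarrow> f (x \<oplus>\<^bsub>M\<^esub> y) = f x \<oplus>\<^bsub>N\<^esub> f y"
    and "\<And>a x. a \<in> carrier A \<Longrightarrow> x \<in> carrier M \<Longrightarrow> f (a \<odot>\<^bsub>M\<^esub> x) = a \<odot>\<^bsub>N\<^esub> f x"
  shows "mod_lin A M N f"
  using assms by (auto simp: mod_lin_def)

lemma mod_lin_closed: "mod_lin A M N f \<Longrightarrow> x \<in> carrier M \<Longrightarrow> f x \<in> carrier N"
  by (auto simp: mod_lin_def)

lemma mod_lin_add:
  "mod_lin A M N f \<Longrightarrow> x \<in> carrier M \<Longrightarrow> y \<in> carrier M \<Longrightarrow> f (x \<oplus>\<^bsub>M\<^esub> y) = f x \<oplus>\<^bsub>N\<^esub> f y"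
  by (auto simp: mod_lin_def)

lemma mod_lin_smult:
  "mod_lin A M N f \<Longrightarrow> a \<in> carrier A \<Longrightarrow> x \<in> carrier M \<Longrightarrow> f (a \<odot>\<^bsub>M\<^esub> x) = a \<odot>\<^bsub>N\<^esub> f x"
  by (auto simp: mod_lin_def)

lemma regular_module_sel [simp]:
  "carrier (regular_module A) = carrier A" "add (regular_module A) = add A"
  "zero (regular_module A) = zero A" "smult (regular_module A) = monoid.mult A"
  by (simp_all add: regular_module_def)

lemma form_closed: "form K V \<phi> \<Longrightarrow> x \<in> carrier V \<Longrightarrow> \<phi> x \<in> carrier K"
  using mod_lin_closed by fastforce

lemma form_add:
  "form K V \<phi> \<Longrightarrow> x \<in> carrier V \<Longrightarrow> y \<in> carrier V \<Longrightarrow> \<phi> (x \<oplus>\<^bsub>V\<^esub> y) = \<phi> x \<oplus>\<^bsub>K\<^esub> \<phi> y"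
  by (simp add: mod_lin_add)

lemma form_smult:
  "form K V \<phi> \<Longrightarrow> c \<in> carrier K \<Longrightarrow> x \<in> carrier V \<Longrightarrow> \<phi> (c \<odot>\<^bsub>V\<^esub> x) = c \<otimes>\<^bsub>K\<^esub> \<phi> x"
  by (simp add: mod_lin_smult)

text \<open>Stated for additive functions because it is applied not only to linear maps but also to
  scalar multiplication in one argument and, together with \<open>additive_finsum\<close>, to
  evaluation at a point and to \<open>pure\<close> in one argument.\<close>

lemma additive_zero:
  assumes "abelian_group V" "abelian_group W"
    and cl: "\<And>x. x \<in> carrier V \<Longrightarrow> f x \<in> carrier W"
    and add: "\<And>x y. x \<in> carrier V \<Longrightarrow> y \<in> carrier V \<Longrightarrow> f (x \<oplus>\<^bsub>V\<^esub> y) = f x \<oplus>\<^bsub>W\<^esub> f y"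
  shows "f \<zero>\<^bsub>V\<^esub> = \<zero>\<^bsub>W\<^esub>"
proof -
  interpret V: abelian_group V by fact
  interpret W: abelian_group W by fact
  have "f \<zero>\<^bsub>V\<^esub> \<oplus>\<^bsub>W\<^esub> f \<zero>\<^bsub>V\<^esub> = f \<zero>\<^bsub>V\<^esub>" using add[of "\<zero>\<^bsub>V\<^esub>" "\<zero>\<^bsub>V\<^esub>"] by simp
  then show ?thesis using cl[of "\<zero>\<^bsub>V\<^esub>"] by (metis V.zero_closed W.add.l_cancel_one)
qed

lemma additive_finsum:
  assumes V: "abelian_group V" and W: "abelian_group W"
    and cl: "\<And>x. x \<in> carrier V \<Longrightarrow> f x \<in> carrier W"
    and add: "\<And>x y. x \<in> carrier V \<Longrightarrow> y \<in> carrier V \<Longrightarrow> f (x \<oplus>\<^bsub>V\<^esub> y) = f x \<oplus>\<^bsub>W\<^esub> f y"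
    and g: "g \<in> I \<rightarrow> carrier V"
  shows "f (\<Oplus>\<^bsub>V\<^esub>i\<in>I. g i) = (\<Oplus>\<^bsub>W\<^esub>i\<in>I. f (g i))"
proof -
  interpret V: abelian_group V by fact
  interpret W: abelian_group W by fact
  have z: "f \<zero>\<^bsub>V\<^esub> = \<zero>\<^bsub>W\<^esub>" by (rule additive_zero[OF V W cl add])
  show ?thesis using g
  proof (induction I rule: infinite_finite_induct)
    case (insert i I)
    then have "(\<Oplus>\<^bsub>V\<^esub>i\<in>I. g i) \<in> carrier V" "(\<lambda>i. f (g i)) \<in> I \<rightarrow> carrier W" using cl by auto
    with insert show ?case by (simp add: cl add Pi_iff)
  qed (use z in auto)
qed

locale vspace = K: field K + V: left_module K V
  for K :: "'k ring" and V :: "('k, 'v) module" (structure)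
begin

lemma smult_l_null: "x \<in> carrier V \<Longrightarrow> \<zero>\<^bsub>K\<^esub> \<odot> x = \<zero>"
  by (rule additive_zero[OF K.abelian_group_axioms V.M.abelian_group_axioms, of "\<lambda>c. c \<odot> x"])
     (auto simp: V.smult_closed V.smult_l_distr)

lemma form_zero: "form K V \<phi> \<Longrightarrow> \<phi> \<zero> = \<zero>\<^bsub>K\<^esub>"
  by (rule additive_zero[OF V.M.abelian_group_axioms K.abelian_group_axioms])
     (simp_all add: form_closed form_add)

lemma form_finsum: 
  assumes "form K V \<phi>" "c \<in> I \<rightarrow> carrier K" "e \<in> I \<rightarrow> carrier V"
  shows "\<phi> (\<Oplus>i\<in>I. c i \<odot> e i) = (\<Oplus>\<^bsub>K\<^esub>i\<in>I. c i \<otimes>\<^bsub>K\<^esub> \<phi> (e i))"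
proof -
  have "\<phi> (\<Oplus>i\<in>I. c i \<odot> e i) = (\<Oplus>\<^bsub>K\<^esub>i\<in>I. \<phi> (c i \<odot> e i))"
    by (rule additive_finsum[OF V.M.abelian_group_axioms K.abelian_group_axioms])
       (use assms in \<open>auto simp: form_closed form_add V.smult_closed Pi_iff\<close>)
  also have "\<dots> = (\<Oplus>\<^bsub>K\<^esub>i\<in>I. c i \<otimes>\<^bsub>K\<^esub> \<phi> (e i))"
    using assms by (intro K.finsum_cong') (auto simp: form_smult Pi_iff form_closed)
  finally show ?thesis .
qed

lemma form_add_scaled:
  assumes \<phi>: "form K V \<phi>" and \<xi>: "form K V \<xi>" and c: "c \<in> carrier K"
  shows "form K V (\<lambda>x. \<phi> x \<oplus>\<^bsub>K\<^esub> c \<otimes>\<^bsub>K\<^esub> \<xi> x)"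
proof (rule mod_linI)
  fix x assume x: "x \<in> carrier V"
  note cx = form_closed[OF \<phi> x] form_closed[OF \<xi> x]
  show "\<phi> x \<oplus>\<^bsub>K\<^esub> c \<otimes>\<^bsub>K\<^esub> \<xi> x \<in> carrier (regular_module K)" using cx c by simp
  { fix y assume y: "y \<in> carrier V"
    note cy = form_closed[OF \<phi> y] form_closed[OF \<xi> y]
    show "\<phi> (x \<oplus> y) \<oplus>\<^bsub>K\<^esub> c \<otimes>\<^bsub>K\<^esub> \<xi> (x \<oplus> y) =
        (\<phi> x \<oplus>\<^bsub>K\<^esub> c \<otimes>\<^bsub>K\<^esub> \<xi> x) \<oplus>\<^bsub>regular_module K\<^esub> (\<phi> y \<oplus>\<^bsub>K\<^esub> c \<otimes>\<^bsub>K\<^esub> \<xi> y)"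
      using cx cy c by (simp add: form_add[OF \<phi> x y] form_add[OF \<xi> x y] K.r_distr K.a_ac) }
  { fix a assume a: "a \<in> carrier K"
    show "\<phi> (a \<odot> x) \<oplus>\<^bsub>K\<^esub> c \<otimes>\<^bsub>K\<^esub> \<xi> (a \<odot> x) =
        a \<odot>\<^bsub>regular_module K\<^esub> (\<phi> x \<oplus>\<^bsub>K\<^esub> c \<otimes>\<^bsub>K\<^esub> \<xi> x)"
      using cx c a by (simp add: form_smult[OF \<phi> a x] form_smult[OF \<xi> a x] K.r_distr K.m_lcomm) }
qed

lemma form_combination:
  assumes "finite I" "\<And>i. i \<in> I \<Longrightarrow> form K V (\<xi> i)" "c \<in> I \<rightarrow> carrier K"
  shows "form K V (\<lambda>x. \<Oplus>\<^bsub>K\<^esub>i\<in>I. c i \<otimes>\<^bsub>K\<^esub> \<xi> i x)"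
  using assms
proof (induction I rule: finite_induct)
  case empty
  then show ?case by (intro mod_linI) auto
next
  case (insert j I)
  then have 1: "form K V (\<lambda>x. (\<Oplus>\<^bsub>K\<^esub>i\<in>I. c i \<otimes>\<^bsub>K\<^esub> \<xi> i x) \<oplus>\<^bsub>K\<^esub> c j \<otimes>\<^bsub>K\<^esub> \<xi> j x)"
    by (intro form_add_scaled) auto
  have eq: "(\<Oplus>\<^bsub>K\<^esub>i\<in>insert j I. c i \<otimes>\<^bsub>K\<^esub> \<xi> i x) = (\<Oplus>\<^bsub>K\<^esub>i\<in>I. c i \<otimes>\<^bsub>K\<^esub> \<xi> i x) \<oplus>\<^bsub>K\<^esub> c j \<otimes>\<^bsub>K\<^esub> \<xi> j x"
    if x: "x \<in> carrier V" for x
  proof -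
    have \<xi>x: "\<xi> i x \<in> carrier K" if "i \<in> insert j I" for i
      using form_closed[OF insert.prems(1)[OF that] x] .
    have "(\<lambda>i. c i \<otimes>\<^bsub>K\<^esub> \<xi> i x) \<in> insert j I \<rightarrow> carrier K" using \<xi>x insert.prems(2) by auto
    then show ?thesis using insert.hyps by (simp add: K.a_comm)
  qed
  show ?case
    using 1 eq V.smult_closed by (simp add: mod_lin_def Pi_iff)
qed

text \<open>Duality in the form used throughout: forms vanishing on the common kernel of finitely
  many forms lie in their span. The forms are removed one at a time, correcting
  \<open>\<phi>\<close> by a multiple of \<open>\<xi> j\<close> until it vanishes on the common
  kernel of the others. Extending a form along a map \<open>g\<close> is the case where the
  \<open>\<xi> i\<close> are pulled back along \<open>g\<close>, so no complement of a subspace is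
  chosen.\<close>

lemma form_in_span:
  assumes "finite I" "\<And>i. i \<in> I \<Longrightarrow> form K V (\<xi> i)" "form K V \<phi>"
    and "\<And>x. x \<in> carrier V \<Longrightarrow> (\<And>i. i \<in> I \<Longrightarrow> \<xi> i x = \<zero>\<^bsub>K\<^esub>) \<Longrightarrow> \<phi> x = \<zero>\<^bsub>K\<^esub>"
  shows "\<exists>c\<in>I \<rightarrow> carrier K. \<forall>x\<in>carrier V. \<phi> x = (\<Oplus>\<^bsub>K\<^esub>i\<in>I. c i \<otimes>\<^bsub>K\<^esub> \<xi> i x)"
  using assms
proof (induction I arbitrary: \<phi> rule: finite_induct)
  case empty
  then show ?case by auto
next
  case (insert j I)
  have \<xi>: "form K V (\<xi> i)" if "i \<in> insert j I" for i using insert.prems(1)[OF that] .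
  have \<xi>j: "form K V (\<xi> j)" using \<xi> by simp
  note \<phi> = insert.prems(2)
  have \<xi>c: "\<xi> i x \<in> carrier K" if "i \<in> insert j I" "x \<in> carrier V" for i x
    using form_closed[OF \<xi>[OF that(1)] that(2)] .
  note \<xi>jc = form_closed[OF \<xi>j] and \<phi>c = form_closed[OF \<phi>]
  \<comment> \<open>The multiple of \<open>\<xi> j\<close> that makes the corrected form vanish
    wherever all \<open>\<xi> i\<close> with \<open>i \<in> I\<close> vanish; zero works if
    \<open>\<xi> j\<close> vanishes there as well.\<close>
  obtain b where b: "b \<in> carrier K"
    and van: "\<And>x. x \<in> carrier V \<Longrightarrow> (\<And>i. i \<in> I \<Longrightarrow> \<xi> i x = \<zero>\<^bsub>K\<^esub>) \<Longrightarrow> \<phi> x \<oplus>\<^bsub>K\<^esub> b \<otimes>\<^bsub>K\<^esub> \<xi> j x = \<zero>\<^bsub>K\<^esub>"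
  proof (cases "\<forall>x\<in>carrier V. (\<forall>i\<in>I. \<xi> i x = \<zero>\<^bsub>K\<^esub>) \<longrightarrow> \<xi> j x = \<zero>\<^bsub>K\<^esub>")
    case True
    then have "\<phi> x \<oplus>\<^bsub>K\<^esub> \<zero>\<^bsub>K\<^esub> \<otimes>\<^bsub>K\<^esub> \<xi> j x = \<zero>\<^bsub>K\<^esub>"
      if x: "x \<in> carrier V" "\<And>i. i \<in> I \<Longrightarrow> \<xi> i x = \<zero>\<^bsub>K\<^esub>" for x
    proof -
      have "\<phi> x = \<zero>\<^bsub>K\<^esub>" using insert.prems(3)[OF x(1)] True x by blast
      then show ?thesis using \<xi>jc[OF x(1)] by simp
    qed
    then show ?thesis using that K.zero_closed by blast
  next
    case False
    then obtain z where z: "z \<in> carrier V" "\<And>i. i \<in> I \<Longrightarrow> \<xi> i z = \<zero>\<^bsub>K\<^esub>" "\<xi> j z \<noteq> \<zero>\<^bsub>K\<^esub>" by blast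
    define u where "u = inv\<^bsub>K\<^esub> \<xi> j z"
    have u: "u \<in> carrier K" "u \<otimes>\<^bsub>K\<^esub> \<xi> j z = \<one>\<^bsub>K\<^esub>"
      using z \<xi>jc[of z] by (simp_all add: u_def K.field_Units)
    \<comment> \<open>The only value for which \<open>\<phi> + b \<xi> j\<close> vanishes at
      \<open>z\<close>.\<close>
    define b where "b = \<ominus>\<^bsub>K\<^esub> (u \<otimes>\<^bsub>K\<^esub> \<phi> z)"
    have b: "b \<in> carrier K" using u \<phi>c z by (simp add: b_def)
    have "\<phi> x \<oplus>\<^bsub>K\<^esub> b \<otimes>\<^bsub>K\<^esub> \<xi> j x = \<zero>\<^bsub>K\<^esub>" if x: "x \<in> carrier V" "\<And>i. i \<in> I \<Longrightarrow> \<xi> i x = \<zero>\<^bsub>K\<^esub>" for x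
    proof -
      \<comment> \<open>Moves \<open>x\<close> along \<open>z\<close> into the kernel of
        \<open>\<xi> j\<close> without leaving the kernels of the other forms.\<close>
      define c where "c = \<ominus>\<^bsub>K\<^esub> (\<xi> j x \<otimes>\<^bsub>K\<^esub> u)"
      have c: "c \<in> carrier K" using u \<xi>jc x by (simp add: c_def)
      have val: "\<chi> (x \<oplus> c \<odot> z) = \<chi> x \<oplus>\<^bsub>K\<^esub> c \<otimes>\<^bsub>K\<^esub> \<chi> z" if "form K V \<chi>" for \<chi>
        using c x z by (simp add: form_add[OF that] form_smult[OF that] V.smult_closed)
      have "c \<otimes>\<^bsub>K\<^esub> \<xi> j z = \<ominus>\<^bsub>K\<^esub> (\<xi> j x \<otimes>\<^bsub>K\<^esub> (u \<otimes>\<^bsub>K\<^esub> \<xi> j z))"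
        using u(1) \<xi>jc z x by (simp add: c_def K.l_minus K.m_assoc)
      then have "\<xi> j x \<oplus>\<^bsub>K\<^esub> c \<otimes>\<^bsub>K\<^esub> \<xi> j z = \<zero>\<^bsub>K\<^esub>" using u \<xi>jc x by (simp add: K.r_neg)
      then have "\<xi> i (x \<oplus> c \<odot> z) = \<zero>\<^bsub>K\<^esub>" if "i \<in> insert j I" for i
        using val[OF \<xi>[OF that]] that c x z by auto
      then have "\<phi> (x \<oplus> c \<odot> z) = \<zero>\<^bsub>K\<^esub>"
        using c x z by (intro insert.prems(3)) (auto simp: V.smult_closed)
      then have 0: "\<phi> x \<oplus>\<^bsub>K\<^esub> c \<otimes>\<^bsub>K\<^esub> \<phi> z = \<zero>\<^bsub>K\<^esub>" using val[OF \<phi>] by simp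
      have "c \<otimes>\<^bsub>K\<^esub> \<phi> z = b \<otimes>\<^bsub>K\<^esub> \<xi> j x"
        using u(1) \<xi>jc[OF x(1)] \<phi>c[OF z(1)] by (simp add: c_def b_def K.l_minus K.r_minus K.m_ac)
      then show ?thesis using 0 by simp
    qed
    then show ?thesis using that b by blast
  qed
  define \<phi>' where "\<phi>' x = \<phi> x \<oplus>\<^bsub>K\<^esub> b \<otimes>\<^bsub>K\<^esub> \<xi> j x" for x
  have \<phi>': "form K V \<phi>'"
    unfolding \<phi>'_def by (rule form_add_scaled[OF \<phi> \<xi>j b])
  obtain c where c: "c \<in> I \<rightarrow> carrier K" "\<And>x. x \<in> carrier V \<Longrightarrow> \<phi>' x = (\<Oplus>\<^bsub>K\<^esub>i\<in>I. c i \<otimes>\<^bsub>K\<^esub> \<xi> i x)"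
    using insert.IH[OF \<xi> \<phi>'] van unfolding \<phi>'_def by blast
  show ?case
  proof (intro bexI[of _ "c(j := \<ominus>\<^bsub>K\<^esub> b)"] ballI)
    show "c(j := \<ominus>\<^bsub>K\<^esub> b) \<in> insert j I \<rightarrow> carrier K" using c b by auto
    fix x assume x: "x \<in> carrier V"
    have c\<xi>: "(\<lambda>i. c i \<otimes>\<^bsub>K\<^esub> \<xi> i x) \<in> I \<rightarrow> carrier K" using c(1) \<xi>c x by (auto simp: Pi_iff)
    have "(\<Oplus>\<^bsub>K\<^esub>i\<in>insert j I. (c(j := \<ominus>\<^bsub>K\<^esub> b)) i \<otimes>\<^bsub>K\<^esub> \<xi> i x) =
        (\<ominus>\<^bsub>K\<^esub> b) \<otimes>\<^bsub>K\<^esub> \<xi> j x \<oplus>\<^bsub>K\<^esub> (\<Oplus>\<^bsub>K\<^esub>i\<in>I. (c(j := \<ominus>\<^bsub>K\<^esub> b)) i \<otimes>\<^bsub>K\<^esub> \<xi> i x)"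
      using insert.hyps c(1) b \<xi>c x by (subst K.finsum_insert) (auto simp: Pi_iff)
    also have "(\<Oplus>\<^bsub>K\<^esub>i\<in>I. (c(j := \<ominus>\<^bsub>K\<^esub> b)) i \<otimes>\<^bsub>K\<^esub> \<xi> i x) = \<phi>' x"
      unfolding c(2)[OF x] using insert.hyps c\<xi> by (intro K.finsum_cong') auto
    also have "(\<ominus>\<^bsub>K\<^esub> b) \<otimes>\<^bsub>K\<^esub> \<xi> j x \<oplus>\<^bsub>K\<^esub> \<phi>' x = \<phi> x \<oplus>\<^bsub>K\<^esub> (b \<otimes>\<^bsub>K\<^esub> \<xi> j x \<oplus>\<^bsub>K\<^esub> \<ominus>\<^bsub>K\<^esub> (b \<otimes>\<^bsub>K\<^esub> \<xi> j x))"
      using b \<xi>jc[OF x] \<phi>c[OF x] by (simp add: \<phi>'_def K.l_minus K.a_ac)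
    also have "\<dots> = \<phi> x"
      using b \<xi>jc[OF x] \<phi>c[OF x] by (simp add: K.r_neg)
    finally show "\<phi> x = (\<Oplus>\<^bsub>K\<^esub>i\<in>insert j I. (c(j := \<ominus>\<^bsub>K\<^esub> b)) i \<otimes>\<^bsub>K\<^esub> \<xi> i x)" by simp
  qed
qed

lemma comb_add:
  assumes "c \<in> I \<rightarrow> carrier K" "c' \<in> I \<rightarrow> carrier K" "e \<in> I \<rightarrow> carrier V"
  shows "(\<Oplus>i\<in>I. (c i \<oplus>\<^bsub>K\<^esub> c' i) \<odot> e i) = (\<Oplus>i\<in>I. c i \<odot> e i) \<oplus> (\<Oplus>i\<in>I. c' i \<odot> e i)"
proof -
  have "(\<lambda>i. c i \<odot> e i) \<in> I \<rightarrow> carrier V" "(\<lambda>i. c' i \<odot> e i) \<in> I \<rightarrow> carrier V"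
    using assms by (auto simp: Pi_iff V.smult_closed)
  then have "(\<Oplus>i\<in>I. c i \<odot> e i) \<oplus> (\<Oplus>i\<in>I. c' i \<odot> e i) =
      (\<Oplus>i\<in>I. c i \<odot> e i \<oplus> c' i \<odot> e i)"
    by (simp add: V.M.finsum_addf)
  also have "\<dots> = (\<Oplus>i\<in>I. (c i \<oplus>\<^bsub>K\<^esub> c' i) \<odot> e i)"
    using assms by (intro V.M.finsum_cong') (auto simp: Pi_iff V.smult_closed V.smult_l_distr)
  finally show ?thesis by simp
qed

lemma comb_smult:
  assumes "c \<in> I \<rightarrow> carrier K" "e \<in> I \<rightarrow> carrier V" "a \<in> carrier K"
  shows "(\<Oplus>i\<in>I. (a \<otimes>\<^bsub>K\<^esub> c i) \<odot> e i) = a \<odot> (\<Oplus>i\<in>I. c i \<odot> e i)"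
proof -
  have "a \<odot> (\<Oplus>i\<in>I. c i \<odot> e i) = (\<Oplus>i\<in>I. a \<odot> (c i \<odot> e i))"
    by (rule additive_finsum[OF V.M.abelian_group_axioms V.M.abelian_group_axioms])
       (use assms in \<open>auto simp: V.smult_closed V.smult_r_distr Pi_iff\<close>)
  also have "\<dots> = (\<Oplus>i\<in>I. (a \<otimes>\<^bsub>K\<^esub> c i) \<odot> e i)"
    using assms by (intro V.M.finsum_cong') (auto simp: Pi_iff V.smult_closed V.smult_assoc1)
  finally show ?thesis by simp
qed

lemma comb_closed:
  assumes "c \<in> I \<rightarrow> carrier K" "e \<in> I \<rightarrow> carrier V"
  shows "(\<Oplus>i\<in>I. c i \<odot> e i) \<in> carrier V"
  using assms by (intro V.M.finsum_closed) (auto simp: Pi_iff V.smult_closed)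

text \<open>\<open>fin_dim\<close> asks for coefficients indexed by the vectors of a set. A family
  may repeat vectors, so the coefficients of equal members have to be collected.\<close>

lemma fin_dim_family:
  assumes "finite I" "e \<in> I \<rightarrow> carrier V"
    and "\<And>v. v \<in> carrier V \<Longrightarrow> \<exists>c\<in>I \<rightarrow> carrier K. v = (\<Oplus>i\<in>I. c i \<odot> e i)"
  shows "fin_dim K V"
proof -
  define S where "S = e ` I"
  have S: "finite S" "S \<subseteq> carrier V" using assms by (auto simp: S_def)
  have subset_id: "(\<lambda>b. b) \<in> S \<rightarrow> carrier V" using S by auto
  have "\<exists>c'\<in>S \<rightarrow> carrier K. (\<Oplus>i\<in>J. c i \<odot> e i) = (\<Oplus>b\<in>S. c' b \<odot> b)"
    if "J \<subseteq> I" "c \<in> J \<rightarrow> carrier K" for J c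
    using finite_subset[OF that(1) assms(1)] that
  proof (induction J rule: finite_induct)
    case empty
    have "(\<Oplus>b\<in>S. \<zero>\<^bsub>K\<^esub> \<odot> b) = (\<Oplus>b\<in>S. \<zero>)"
      using S by (intro V.M.finsum_cong') (auto simp: smult_l_null)
    then show ?case by (intro bexI[of _ "\<lambda>_. \<zero>\<^bsub>K\<^esub>"]) auto
  next
    case (insert j J)
    then have "J \<subseteq> I" "c \<in> J \<rightarrow> carrier K" by auto
    from insert.IH[OF this] obtain c' where c': "c' \<in> S \<rightarrow> carrier K"
      "(\<Oplus>i\<in>J. c i \<odot> e i) = (\<Oplus>b\<in>S. c' b \<odot> b)" by blast
    have j: "e j \<in> S" "c j \<in> carrier K" "e j \<in> carrier V" using insert.prems assms(2) by (auto simp: S_def)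
    \<comment> \<open>The summand \<open>c j \<odot> e j\<close> as a combination over
      \<open>S\<close>. It is added to the combination found so far, since \<open>e j\<close> may
      have occurred before.\<close>
    define d where "d b = (if e j = b then c j else \<zero>\<^bsub>K\<^esub>)" for b
    have d: "d \<in> S \<rightarrow> carrier K" using j by (auto simp: d_def)
    have "(\<Oplus>b\<in>S. d b \<odot> b) = (\<Oplus>b\<in>S. if e j = b then c j \<odot> b else \<zero>)"
      using S j by (intro V.M.finsum_cong') (auto simp: d_def smult_l_null V.smult_closed)
    also have "\<dots> = c j \<odot> e j"
      using S j by (intro V.M.finsum_singleton) (auto simp: V.smult_closed)
    finally have dj: "(\<Oplus>b\<in>S. d b \<odot> b) = c j \<odot> e j" .
    have "(\<Oplus>i\<in>insert j J. c i \<odot> e i) = c j \<odot> e j \<oplus> (\<Oplus>i\<in>J. c i \<odot> e i)"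
      using insert.hyps insert.prems assms(2) by (subst V.M.finsum_insert) (auto intro!: V.smult_closed)
    also have "\<dots> = (\<Oplus>b\<in>S. (d b \<oplus>\<^bsub>K\<^esub> c' b) \<odot> b)"
      using comb_add[OF d c'(1) subset_id] dj c'(2) by simp
    finally show ?case using d c'(1) by (intro bexI[of _ "\<lambda>b. d b \<oplus>\<^bsub>K\<^esub> c' b"]) auto
  qed
  note regroup = this
  have "\<exists>c'\<in>S \<rightarrow> carrier K. v = (\<Oplus>b\<in>S. c' b \<odot> b)" if v: "v \<in> carrier V" for v
  proof -
    obtain c where c: "c \<in> I \<rightarrow> carrier K" "v = (\<Oplus>i\<in>I. c i \<odot> e i)"
      using assms(3)[OF v] by blast
    show ?thesis unfolding c(2) by (rule regroup[OF order_refl c(1)])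
  qed
  then show ?thesis using S unfolding fin_dim_def by blast
qed

end

text \<open>Despite the name, the vectors \<^term>\<open>e i\<close> only have to span; their independence is not required.\<close>

definition dual_basis ::
    "'k ring \<Rightarrow> ('k, 'v) module \<Rightarrow> 'i set \<Rightarrow> ('i \<Rightarrow> 'v) \<Rightarrow> ('i \<Rightarrow> 'v \<Rightarrow> 'k) \<Rightarrow> bool" where
  "dual_basis K V I e \<xi> \<longleftrightarrow> finite I \<and> e \<in> I \<rightarrow> carrier V \<and> (\<forall>i\<in>I. form K V (\<xi> i)) \<and>
     (\<forall>v\<in>carrier V. v = (\<Oplus>\<^bsub>V\<^esub>i\<in>I. \<xi> i v \<odot>\<^bsub>V\<^esub> e i))"

section \<open>Dual bases and descending chains of subspaces\<close>

context vspace begin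

text \<open>A spanning set of least cardinality has unique coefficients, and uniqueness makes the
  coefficient functions linear.\<close>

lemma ex_dual_basis:
  assumes "fin_dim K V"
  shows "\<exists>B \<xi>. dual_basis K V B (\<lambda>b. b) \<xi>"
proof -
  define spans where "spans B \<longleftrightarrow> finite B \<and> B \<subseteq> carrier V \<and>
     (\<forall>v\<in>carrier V. \<exists>c\<in>B \<rightarrow> carrier K. v = (\<Oplus>b\<in>B. c b \<odot> b))" for B
  obtain B0 where "spans B0" using assms by (auto simp: fin_dim_def spans_def)
  then obtain B where B: "spans B" and min: "\<And>B'. spans B' \<Longrightarrow> card B \<le> card B'"
    using ex_has_least_nat[of spans B0 card] by auto
  have fin: "finite B" and sub: "B \<subseteq> carrier V" "(\<lambda>b. b) \<in> B \<rightarrow> carrier V"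
    using B by (auto simp: spans_def)
  have unique: "c b = c' b"
    if c: "c \<in> B \<rightarrow> carrier K" and c': "c' \<in> B \<rightarrow> carrier K" and b: "b \<in> B"
      and eq: "(\<Oplus>b\<in>B. c b \<odot> b) = (\<Oplus>b\<in>B. c' b \<odot> b)" for c c' b
  proof (rule ccontr)
    assume neq: "c b \<noteq> c' b"
    define d where "d i = c i \<oplus>\<^bsub>K\<^esub> (\<ominus>\<^bsub>K\<^esub> \<one>\<^bsub>K\<^esub>) \<otimes>\<^bsub>K\<^esub> c' i" for i
    have d: "d \<in> B \<rightarrow> carrier K" using c c' by (auto simp: d_def Pi_iff)
    have "(\<Oplus>b\<in>B. d b \<odot> b) =
        (\<Oplus>b\<in>B. c b \<odot> b) \<oplus> (\<ominus>\<^bsub>K\<^esub> \<one>\<^bsub>K\<^esub>) \<odot> (\<Oplus>b\<in>B. c' b \<odot> b)"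
      unfolding d_def using c c' sub comb_smult[OF c' sub(2), of "\<ominus>\<^bsub>K\<^esub> \<one>\<^bsub>K\<^esub>"]
      by (subst comb_add) (auto simp: Pi_iff)
    also have "\<dots> = (\<one>\<^bsub>K\<^esub> \<oplus>\<^bsub>K\<^esub> \<ominus>\<^bsub>K\<^esub> \<one>\<^bsub>K\<^esub>) \<odot> (\<Oplus>b\<in>B. c b \<odot> b)"
      unfolding eq[symmetric] using comb_closed[OF c sub(2)] by (simp only: V.smult_l_distr V.smult_one K.one_closed K.a_inv_closed)
    also have "\<dots> = \<zero>" using comb_closed[OF c sub(2)] by (simp add: K.r_neg smult_l_null)
    finally have d0: "(\<Oplus>b\<in>B. d b \<odot> b) = \<zero>" .
    have cb: "c b \<in> carrier K" "c' b \<in> carrier K" using c c' b by auto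
    have "d b \<noteq> \<zero>\<^bsub>K\<^esub>"
    proof
      assume "d b = \<zero>\<^bsub>K\<^esub>"
      then have "c b \<oplus>\<^bsub>K\<^esub> \<ominus>\<^bsub>K\<^esub> c' b = \<zero>\<^bsub>K\<^esub>" using cb by (simp add: d_def K.l_minus)
      then have "c b = c' b" using cb K.minus_equality[of "c b" "\<ominus>\<^bsub>K\<^esub> c' b"] by (simp add: K.minus_minus)
      with neq show False ..
    qed
    then have u: "inv\<^bsub>K\<^esub> d b \<in> carrier K" "inv\<^bsub>K\<^esub> d b \<otimes>\<^bsub>K\<^esub> d b = \<one>\<^bsub>K\<^esub>"
      using d b by (auto simp: K.field_Units Pi_iff)
    \<comment> \<open>The difference \<open>d\<close> of two expansions is a relation with
      invertible coefficient at \<open>b\<close>, so \<open>b\<close> can be eliminated, against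
      minimality.\<close>
    have "spans (B - {b})"
      unfolding spans_def
    proof (intro conjI ballI)
      fix v assume "v \<in> carrier V"
      then obtain a where a: "a \<in> B \<rightarrow> carrier K" "v = (\<Oplus>b\<in>B. a b \<odot> b)"
        using B by (auto simp: spans_def)
      \<comment> \<open>Adding \<open>t\<close> times the relation leaves \<open>v\<close> unchanged
        and cancels its coefficient at \<open>b\<close>.\<close>
      define t where "t = \<ominus>\<^bsub>K\<^esub> (a b \<otimes>\<^bsub>K\<^esub> inv\<^bsub>K\<^esub> d b)"
      have ab: "a b \<in> carrier K" and t: "t \<in> carrier K" using a u b by (auto simp: t_def)
      define a' where "a' i = a i \<oplus>\<^bsub>K\<^esub> t \<otimes>\<^bsub>K\<^esub> d i" for i
      have a': "a' \<in> B \<rightarrow> carrier K" using a d t by (auto simp: a'_def Pi_iff)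
      have "t \<otimes>\<^bsub>K\<^esub> d b = \<ominus>\<^bsub>K\<^esub> (a b \<otimes>\<^bsub>K\<^esub> (inv\<^bsub>K\<^esub> d b \<otimes>\<^bsub>K\<^esub> d b))"
        using u(1) ab d b by (simp add: t_def K.l_minus K.m_assoc Pi_iff)
      then have a'b: "a' b = \<zero>\<^bsub>K\<^esub>" using u ab by (simp add: a'_def K.r_neg)
      have "(\<Oplus>b\<in>B. a' b \<odot> b) = v \<oplus> t \<odot> (\<Oplus>b\<in>B. d b \<odot> b)"
        unfolding a'_def a(2) using a(1) d t sub comb_smult[OF d sub(2) t]
        by (subst comb_add) (auto simp: Pi_iff)
      also have "\<dots> = v"
        using d0 t \<open>v \<in> carrier V\<close> additive_zero[OF V.M.abelian_group_axioms V.M.abelian_group_axioms, of "\<lambda>x. t \<odot> x"]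
        by (simp add: V.smult_closed V.smult_r_distr)
      finally have v: "v = (\<Oplus>b\<in>B. a' b \<odot> b)" by simp
      have Bb: "a' \<in> B - {b} \<rightarrow> carrier K" "(\<lambda>i. i) \<in> B - {b} \<rightarrow> carrier V" using a' sub by auto
      note v
      also have "B = insert b (B - {b})" using b by blast
      also have "(\<Oplus>i\<in>insert b (B - {b}). a' i \<odot> i) = a' b \<odot> b \<oplus> (\<Oplus>i\<in>B - {b}. a' i \<odot> i)"
        using fin sub a' b by (subst V.M.finsum_insert) (auto intro!: V.smult_closed)
      also have "\<dots> = (\<Oplus>i\<in>B - {b}. a' i \<odot> i)"
        using a'b b sub(1) subsetD[OF sub(1) b] comb_closed[of a' "B - {b}" "\<lambda>i. i", OF Bb]
        by (simp add: smult_l_null)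
      finally show "\<exists>c\<in>B - {b} \<rightarrow> carrier K. v = (\<Oplus>b\<in>B - {b}. c b \<odot> b)" using a' by blast
    qed (use fin sub in auto)
    then have "card B \<le> card (B - {b})" by (rule min)
    then show False using card_Diff1_less[OF fin b] by simp
  qed
  have "\<exists>c. \<forall>v\<in>carrier V. c v \<in> B \<rightarrow> carrier K \<and> v = (\<Oplus>b\<in>B. c v b \<odot> b)"
    using B unfolding spans_def by (intro bchoice) blast
  then obtain c where c: "\<And>v. v \<in> carrier V \<Longrightarrow> c v \<in> B \<rightarrow> carrier K"
    "\<And>v. v \<in> carrier V \<Longrightarrow> (\<Oplus>b\<in>B. c v b \<odot> b) = v" by metis
  have "form K V (\<lambda>v. c v b)" if b: "b \<in> B" for b
  proof (rule mod_linI)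
    fix x assume x: "x \<in> carrier V"
    show "c x b \<in> carrier (regular_module K)" using c(1)[OF x] b by auto
    { fix y assume y: "y \<in> carrier V"
      have "(\<Oplus>b\<in>B. (c x b \<oplus>\<^bsub>K\<^esub> c y b) \<odot> b) = x \<oplus> y"
        using comb_add[OF c(1)[OF x] c(1)[OF y] sub(2)] c(2) x y by simp
      then show "c (x \<oplus> y) b = c x b \<oplus>\<^bsub>regular_module K\<^esub> c y b"
        using unique[of "c (x \<oplus> y)" "\<lambda>b. c x b \<oplus>\<^bsub>K\<^esub> c y b" b] c[of "x \<oplus> y"] c(1)[OF x] c(1)[OF y] b x y
        by (auto simp: Pi_iff) }
    { fix a assume a: "a \<in> carrier K"
      have "(\<Oplus>b\<in>B. (a \<otimes>\<^bsub>K\<^esub> c x b) \<odot> b) = a \<odot> x"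
        using comb_smult[OF c(1)[OF x] sub(2) a] c(2) x by simp
      then show "c (a \<odot> x) b = a \<odot>\<^bsub>regular_module K\<^esub> c x b"
        using unique[of "c (a \<odot> x)" "\<lambda>b. a \<otimes>\<^bsub>K\<^esub> c x b" b] c[of "a \<odot> x"] c(1)[OF x] b x a
        by (auto simp: Pi_iff V.smult_closed) }
  qed
  then have "dual_basis K V B (\<lambda>b. b) (\<lambda>b v. c v b)"
    unfolding dual_basis_def using fin sub c by auto
  then show ?thesis by blast
qed

lemma dual_basis_separates:
  assumes "dual_basis K V I e \<xi>" "v \<in> carrier V" "w \<in> carrier V" "\<And>i. i \<in> I \<Longrightarrow> \<xi> i v = \<xi> i w"
  shows "v = w"
proof -
  have *: "e \<in> I \<rightarrow> carrier V" "\<And>i. i \<in> I \<Longrightarrow> form K V (\<xi> i)" "v = (\<Oplus>i\<in>I. \<xi> i v \<odot> e i)"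
    "w = (\<Oplus>i\<in>I. \<xi> i w \<odot> e i)"
    using assms by (simp_all add: dual_basis_def)
  have "(\<Oplus>i\<in>I. \<xi> i v \<odot> e i) = (\<Oplus>i\<in>I. \<xi> i w \<odot> e i)"
    using *(1) form_closed[OF *(2) assms(3)] assms(4)
    by (intro V.M.finsum_cong') (auto simp: Pi_iff V.smult_closed)
  then show ?thesis using *(3,4) by simp
qed

lemma form_expand:
  assumes "dual_basis K V I e \<xi>" "form K V \<phi>" "v \<in> carrier V"
  shows "\<phi> v = (\<Oplus>\<^bsub>K\<^esub>i\<in>I. \<xi> i v \<otimes>\<^bsub>K\<^esub> \<phi> (e i))"
proof -
  have *: "e \<in> I \<rightarrow> carrier V" "\<And>i. i \<in> I \<Longrightarrow> form K V (\<xi> i)" "v = (\<Oplus>i\<in>I. \<xi> i v \<odot> e i)"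
    using assms by (simp_all add: dual_basis_def)
  have "\<phi> (\<Oplus>i\<in>I. \<xi> i v \<odot> e i) = (\<Oplus>\<^bsub>K\<^esub>i\<in>I. \<xi> i v \<otimes>\<^bsub>K\<^esub> \<phi> (e i))"
    using * form_closed[OF *(2) assms(3)] by (intro form_finsum[OF assms(2)]) auto
  then show ?thesis using *(3) by simp
qed

text \<open>Induction on the number of separating forms instead of on dimension. The subspaces on
  which one form \<open>\<xi> n\<close> vanishes are separated by the remaining forms and stabilise
  by induction. Then either \<open>\<xi> n\<close> vanishes on some \<open>U l\<close>, or it is
  nonzero somewhere on every \<open>U j\<close>, and one such vector suffices to regain
  \<open>U k\<close> inside \<open>U j\<close>.\<close>

lemma descending_subspaces_stable:
  assumes "finite I" "\<And>i. i \<in> I \<Longrightarrow> form K V (\<xi> i)"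
    and "\<And>k. U k \<subseteq> carrier V" "\<And>k. U (Suc k) \<subseteq> U k"
    and "\<And>k x y. x \<in> U k \<Longrightarrow> y \<in> U k \<Longrightarrow> x \<oplus> y \<in> U k"
    and "\<And>k c x. c \<in> carrier K \<Longrightarrow> x \<in> U k \<Longrightarrow> c \<odot> x \<in> U k"
    and "\<And>k. \<zero> \<in> U k"
    and "\<And>x. x \<in> U 0 \<Longrightarrow> (\<And>i. i \<in> I \<Longrightarrow> \<xi> i x = \<zero>\<^bsub>K\<^esub>) \<Longrightarrow> x = \<zero>"
  shows "\<exists>k. \<forall>j\<ge>k. U j = U k"
  using assms
proof (induction I arbitrary: U rule: finite_induct)
  case empty
  have "U k \<subseteq> U 0" for k by (rule lift_Suc_antimono_le[of U]) (use empty.prems(3) in auto)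
  then have "U k = {\<zero>}" for k using empty.prems(6)[of k] empty.prems(7) by blast
  then show ?case by auto
next
  case (insert n I)
  note \<xi> = insert.prems(1) and sub = insert.prems(2) and dec = insert.prems(3) and add = insert.prems(4)
    and sm = insert.prems(5) and zero = insert.prems(6) and sep = insert.prems(7)
  have \<xi>n: "form K V (\<xi> n)" using \<xi> by simp
  have anti: "U j \<subseteq> U k" if "k \<le> j" for j k
    by (rule lift_Suc_antimono_le[of U, OF _ that]) (use dec in auto)
  define W where "W k = {x \<in> U k. \<xi> n x = \<zero>\<^bsub>K\<^esub>}" for k
  have "\<exists>k. \<forall>j\<ge>k. W j = W k"
  proof (rule insert.IH)
    show "form K V (\<xi> i)" if "i \<in> I" for i using \<xi> that by simp
    show "W k \<subseteq> carrier V" for k using sub by (auto simp: W_def)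
    show "W (Suc k) \<subseteq> W k" for k using dec by (auto simp: W_def)
    show "x \<oplus> y \<in> W k" if "x \<in> W k" "y \<in> W k" for k x y
      using that add form_add[OF \<xi>n, of x y] subsetD[OF sub] by (auto simp: W_def)
    show "c \<odot> x \<in> W k" if "c \<in> carrier K" "x \<in> W k" for k c x
      using that sm form_smult[OF \<xi>n, of c x] subsetD[OF sub] by (auto simp: W_def)
    show "\<zero> \<in> W k" for k using zero form_zero[OF \<xi>n] by (simp add: W_def)
    show "x = \<zero>" if "x \<in> W 0" "\<And>i. i \<in> I \<Longrightarrow> \<xi> i x = \<zero>\<^bsub>K\<^esub>" for x
      using that by (intro sep) (auto simp: W_def)
  qed
  then obtain k where k: "\<And>j. j \<ge> k \<Longrightarrow> W j = W k" by blast
  show ?case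
  proof (cases "\<exists>l. \<forall>x\<in>U l. \<xi> n x = \<zero>\<^bsub>K\<^esub>")
    case True
    then obtain l where l: "\<And>x. x \<in> U l \<Longrightarrow> \<xi> n x = \<zero>\<^bsub>K\<^esub>" by blast
    have "U j = W j" if "j \<ge> l" for j using l anti[OF that] by (auto simp: W_def)
    then have "U j = U (max k l)" if "j \<ge> max k l" for j using that k[of j] k[of "max k l"] by auto
    then show ?thesis by blast
  next
    case False
    have "U j = U k" if j: "j \<ge> k" for j
    proof
      show "U j \<subseteq> U k" by (rule anti[OF j])
      show "U k \<subseteq> U j"
      proof
        fix u assume u: "u \<in> U k"
        obtain w where w: "w \<in> U j" "\<xi> n w \<noteq> \<zero>\<^bsub>K\<^esub>" using False by blast
        have uV: "u \<in> carrier V" and wV: "w \<in> carrier V" using sub u w by auto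
        note cl = form_closed[OF \<xi>n uV] form_closed[OF \<xi>n wV]
        \<comment> \<open>\<open>u - c w\<close> lies in the kernel of \<open>\<xi> n\<close>, where
          the chain is already constant; adding back \<open>c w \<in> U j\<close> puts
          \<open>u\<close> into \<open>U j\<close>.\<close>
        define c where "c = \<xi> n u \<otimes>\<^bsub>K\<^esub> inv\<^bsub>K\<^esub> \<xi> n w"
        have i: "inv\<^bsub>K\<^esub> \<xi> n w \<in> carrier K" "inv\<^bsub>K\<^esub> \<xi> n w \<otimes>\<^bsub>K\<^esub> \<xi> n w = \<one>\<^bsub>K\<^esub>"
          using w cl by (simp_all add: K.field_Units)
        have c: "c \<in> carrier K" "\<ominus>\<^bsub>K\<^esub> c \<in> carrier K" "c \<otimes>\<^bsub>K\<^esub> \<xi> n w = \<xi> n u"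
          using i cl by (simp_all add: c_def K.m_assoc)
        have cwj: "c \<odot> w \<in> U j" and cw: "(\<ominus>\<^bsub>K\<^esub> c) \<odot> w \<in> U k" using sm c w anti[OF j] by auto
        have cwV: "(\<ominus>\<^bsub>K\<^esub> c) \<odot> w \<in> carrier V" "c \<odot> w \<in> carrier V" using cw cwj sub by auto
        have "\<xi> n (u \<oplus> (\<ominus>\<^bsub>K\<^esub> c) \<odot> w) = \<zero>\<^bsub>K\<^esub>"
          using c cl by (simp add: form_add[OF \<xi>n uV cwV(1)] form_smult[OF \<xi>n c(2) wV] K.l_minus K.r_neg)
        then have "u \<oplus> (\<ominus>\<^bsub>K\<^esub> c) \<odot> w \<in> W k" using add[OF u cw] by (simp add: W_def)
        then have "u \<oplus> (\<ominus>\<^bsub>K\<^esub> c) \<odot> w \<in> U j" using k[OF j] by (auto simp: W_def)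
        then have "(u \<oplus> (\<ominus>\<^bsub>K\<^esub> c) \<odot> w) \<oplus> c \<odot> w \<in> U j" using add cwj by blast
        moreover have "(\<ominus>\<^bsub>K\<^esub> c) \<odot> w \<oplus> c \<odot> w = \<zero>"
          using V.smult_l_distr[OF c(2,1) wV] c wV by (simp add: K.l_neg smult_l_null)
        ultimately show "u \<in> U j" using uV cwV by (simp add: V.M.a_assoc)
      qed
    qed
    then show ?thesis by blast
  qed
qed

end

section \<open>Algebras and the coregular module\<close>

lemma opposite_sel [simp]:
  "carrier (opposite A) = carrier A" "\<one>\<^bsub>opposite A\<^esub> = \<one>\<^bsub>A\<^esub>" "\<zero>\<^bsub>opposite A\<^esub> = \<zero>\<^bsub>A\<^esub>"
  "x \<otimes>\<^bsub>opposite A\<^esub> y = y \<otimes>\<^bsub>A\<^esub> x" "add (opposite A) = add A"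
  by (simp_all add: opposite_def)

lemma opposite_smult [simp]: "smult (opposite A) = smult A"
  by (simp add: opposite_def)

lemma opposite_opposite [simp]: "opposite (opposite A) = (A :: ('k, 'a) module)"
  by (simp add: opposite_def)

locale kalg =
  fixes K :: "'k ring" and A :: "('k, 'a) module" (structure)
  assumes k_algebra: "k_algebra K A"
begin

sublocale K: field K using k_algebra by (simp add: k_algebra_def)
sublocale A: ring A using k_algebra by (simp add: k_algebra_def)
sublocale AM: module K A using k_algebra by (simp add: k_algebra_def)
sublocale vs: vspace K A
  by unfold_locales (auto simp: AM.smult_l_distr AM.smult_r_distr AM.smult_assoc1)

lemma smult_mult:
  assumes "c \<in> carrier K" "x \<in> carrier A" "y \<in> carrier A"
  shows "(c \<odot> x) \<otimes> y = c \<odot> (x \<otimes> y)" "x \<otimes> (c \<odot> y) = c \<odot> (x \<otimes> y)"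
  using assms k_algebra by (auto simp: k_algebra_def)

lemma opposite_kalg: "kalg K (opposite A)"
proof -
  have ag: "abelian_group (opposite A)"
    by (rule abelian_groupI) (auto simp: A.a_ac intro: A.add.l_inv_ex)
  have m: "Group.monoid (opposite A)"
    by (rule monoidI) (auto simp: A.m_assoc)
  have "ring (opposite A)"
    by (rule ringI[OF ag m]) (auto simp: A.l_distr A.r_distr)
  moreover have "module K (opposite A)"
    by (rule moduleI[OF K.is_cring ag])
       (auto simp: AM.smult_l_distr AM.smult_r_distr AM.smult_assoc1)
  ultimately show ?thesis
    by unfold_locales (auto simp: k_algebra_def K.field_axioms smult_mult)
qed

lemma underlying_sel [simp]:
  "carrier (underlying_space A M) = carrier M" "add (underlying_space A M) = add M"
  "zero (underlying_space A M) = zero M"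
  "c \<odot>\<^bsub>underlying_space A M\<^esub> x = (c \<odot> \<one>) \<odot>\<^bsub>M\<^esub> x"
  by (simp_all add: underlying_space_def)

lemma underlying_vspace:
  assumes "left_module A M"
  shows "vspace K (underlying_space A M)"
proof -
  interpret M: left_module A M by fact
  have ag: "abelian_group (underlying_space A M)"
    by (rule abelian_groupI) (auto simp: M.M.a_ac intro: M.M.add.l_inv_ex)
  have eq: "(c \<otimes>\<^bsub>K\<^esub> d) \<odot> \<one> = (c \<odot> \<one>) \<otimes> (d \<odot> \<one>)"
    if "c \<in> carrier K" "d \<in> carrier K" for c d
    using that by (simp add: smult_mult(1) AM.smult_assoc1)
  show ?thesis
  proof (intro vspace.intro left_module.intro K.field_axioms K.ring_axioms ag left_module_axioms.intro)
  qed (auto simp: M.smult_closed AM.smult_l_distr M.smult_l_distr M.smult_r_distr eq M.smult_assoc1 M.smult_one)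
qed

lemma mod_lin_underlying:
  "mod_lin A M N f \<Longrightarrow> mod_lin K (underlying_space A M) (underlying_space A N) f"
  by (auto simp: mod_lin_def)

end

text \<open>The injective cogenerator \<open>D A\<close> as a left module, with
  \<open>(a \<phi>)(x) = \<phi>(x a)\<close>. The opposite occurs twice because dualising switches
  sides: a left module over \<open>A\<close> arises as the dual of a right one.\<close>

abbreviation coreg :: "'k ring \<Rightarrow> ('k, 'a) module \<Rightarrow> ('a, 'a \<Rightarrow> 'k) module" where
  "coreg K A \<equiv> dual K (opposite A) (regular_module (opposite A))"

lemma coreg_sel:
  "\<zero>\<^bsub>coreg K A\<^esub> = (\<lambda>x\<in>carrier A. \<zero>\<^bsub>K\<^esub>)"
  "\<phi> \<oplus>\<^bsub>coreg K A\<^esub> \<psi> = (\<lambda>x\<in>carrier A. \<phi> x \<oplus>\<^bsub>K\<^esub> \<psi> x)"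
  "a \<odot>\<^bsub>coreg K A\<^esub> \<phi> = (\<lambda>x\<in>carrier A. \<phi> (x \<otimes>\<^bsub>A\<^esub> a))"
  by (simp_all add: dual_def)

context kalg begin

lemma coreg_iff: "\<phi> \<in> carrier (coreg K A) \<longleftrightarrow> form K A \<phi> \<and> \<phi> \<in> extensional (carrier A)"
proof -
  have "\<phi> \<in> carrier (coreg K A) \<longleftrightarrow> mod_lin K (underlying_space (opposite A) (regular_module (opposite A))) (regular_module K) \<phi>
      \<and> \<phi> \<in> extensional (carrier A)"
    by (simp add: dual_def mod_hom_iff underlying_space_def)
  also have "mod_lin K (underlying_space (opposite A) (regular_module (opposite A))) (regular_module K) \<phi> \<longleftrightarrow> form K A \<phi>"
    by (simp add: mod_lin_def underlying_space_def smult_mult cong: ball_cong)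
  finally show ?thesis .
qed

lemma coregD:
  assumes "\<phi> \<in> carrier (coreg K A)"
  shows "x \<in> carrier A \<Longrightarrow> \<phi> x \<in> carrier K"
    and "x \<in> carrier A \<Longrightarrow> y \<in> carrier A \<Longrightarrow> \<phi> (x \<oplus> y) = \<phi> x \<oplus>\<^bsub>K\<^esub> \<phi> y"
    and "c \<in> carrier K \<Longrightarrow> x \<in> carrier A \<Longrightarrow> \<phi> (c \<odot> x) = c \<otimes>\<^bsub>K\<^esub> \<phi> x"
    and "form K A \<phi>" "\<phi> \<in> extensional (carrier A)"
  using assms form_closed form_add form_smult by (auto simp: coreg_iff)

lemma coregI:
  assumes "\<And>x. x \<in> carrier A \<Longrightarrow> \<phi> x \<in> carrier K"
    and "\<And>x y. x \<in> carrier A \<Longrightarrow> y \<in> carrier A \<Longrightarrow> \<phi> (x \<oplus> y) = \<phi> x \<oplus>\<^bsub>K\<^esub> \<phi> y"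
    and "\<And>c x. c \<in> carrier K \<Longrightarrow> x \<in> carrier A \<Longrightarrow> \<phi> (c \<odot> x) = c \<otimes>\<^bsub>K\<^esub> \<phi> x"
  shows "(\<lambda>x\<in>carrier A. \<phi> x) \<in> carrier (coreg K A)"
  using assms by (auto simp: coreg_iff mod_lin_def)

text \<open>The right action \<open>\<phi> a = \<phi>(a -)\<close> on the bimodule
  \<open>D A\<close>; it commutes with the left action recorded in \<open>coreg\<close>.\<close>

lemma coreg_translate_left:
  assumes "\<phi> \<in> carrier (coreg K A)" "a \<in> carrier A"
  shows "(\<lambda>x\<in>carrier A. \<phi> (a \<otimes> x)) \<in> carrier (coreg K A)"
  using assms coregD[OF assms(1)]
  by (intro coregI) (auto simp: A.l_distr A.r_distr smult_mult)

text \<open>The linear maps from \<open>A\<close> to \<open>W\<close> with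
  \<open>(a f)(x) = f(x a)\<close>. The cases are \<open>W = K\<close>, the coregular module, and
  \<open>W = A\<close>, the module \<open>endo_module\<close>; \<open>X\<close> is given through
  equations because the two records are built differently.\<close>

lemma coinduced_left_module:
  assumes W: "vspace K W"
    and carrier: "\<And>f. f \<in> carrier X \<longleftrightarrow> mod_lin K A W f \<and> f \<in> extensional (carrier A)"
    and zero: "\<zero>\<^bsub>X\<^esub> = (\<lambda>x\<in>carrier A. \<zero>\<^bsub>W\<^esub>)"
    and add: "\<And>f g. f \<oplus>\<^bsub>X\<^esub> g = (\<lambda>x\<in>carrier A. f x \<oplus>\<^bsub>W\<^esub> g x)"
    and smult: "\<And>a f. a \<odot>\<^bsub>X\<^esub> f = (\<lambda>x\<in>carrier A. f (x \<otimes> a))"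
  shows "left_module A X"
proof -
  interpret W: vspace K W by fact
  have D: "\<And>x. x \<in> carrier A \<Longrightarrow> f x \<in> carrier W"
    "\<And>x y. x \<in> carrier A \<Longrightarrow> y \<in> carrier A \<Longrightarrow> f (x \<oplus> y) = f x \<oplus>\<^bsub>W\<^esub> f y"
    "\<And>c x. c \<in> carrier K \<Longrightarrow> x \<in> carrier A \<Longrightarrow> f (c \<odot> x) = c \<odot>\<^bsub>W\<^esub> f x"
    if "f \<in> carrier X" for f
    using that unfolding carrier mod_lin_def by auto
  have I: "(\<lambda>x\<in>carrier A. f x) \<in> carrier X"
    if "\<And>x. x \<in> carrier A \<Longrightarrow> f x \<in> carrier W"
      "\<And>x y. x \<in> carrier A \<Longrightarrow> y \<in> carrier A \<Longrightarrow> f (x \<oplus> y) = f x \<oplus>\<^bsub>W\<^esub> f y"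
      "\<And>c x. c \<in> carrier K \<Longrightarrow> x \<in> carrier A \<Longrightarrow> f (c \<odot> x) = c \<odot>\<^bsub>W\<^esub> f x" for f
    unfolding carrier using that by (auto simp: mod_lin_def)
  have sm_cl: "a \<odot>\<^bsub>X\<^esub> f \<in> carrier X" if "a \<in> carrier A" "f \<in> carrier X" for a f
    unfolding smult using that D[OF that(2)] by (intro I) (auto simp: A.l_distr smult_mult)
  have add_cl: "f \<oplus>\<^bsub>X\<^esub> g \<in> carrier X" if f: "f \<in> carrier X" and g: "g \<in> carrier X" for f g
    unfolding add using D[OF f] D[OF g]
    by (intro I) (auto simp: W.V.M.a_ac W.V.smult_r_distr)
  have zero_smult: "c \<odot>\<^bsub>W\<^esub> \<zero>\<^bsub>W\<^esub> = \<zero>\<^bsub>W\<^esub>" if "c \<in> carrier K" for c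
    by (rule additive_zero[OF W.V.M.abelian_group_axioms W.V.M.abelian_group_axioms])
       (use that W.V.smult_closed W.V.smult_r_distr in auto)
  have zero_cl: "\<zero>\<^bsub>X\<^esub> \<in> carrier X"
    unfolding zero by (intro I) (auto simp: zero_smult)
  have eqI: "f = g" if "f \<in> carrier X" "g \<in> carrier X" "\<And>x. x \<in> carrier A \<Longrightarrow> f x = g x" for f g
    using that by (intro extensionalityI[of _ "carrier A"]) (auto simp: carrier)
  have minus_smult: "c \<odot>\<^bsub>W\<^esub> (\<ominus>\<^bsub>W\<^esub> x) = \<ominus>\<^bsub>W\<^esub> (c \<odot>\<^bsub>W\<^esub> x)" if c: "c \<in> carrier K" and x: "x \<in> carrier W" for c x
  proof (rule W.V.M.minus_equality[symmetric])
    show "c \<odot>\<^bsub>W\<^esub> (\<ominus>\<^bsub>W\<^esub> x) \<oplus>\<^bsub>W\<^esub> c \<odot>\<^bsub>W\<^esub> x = \<zero>\<^bsub>W\<^esub>"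
      using W.V.smult_r_distr[OF c, of "\<ominus>\<^bsub>W\<^esub> x" x] c x by (simp add: W.V.M.l_neg zero_smult)
  qed (use c x W.V.smult_closed in auto)
  have ag: "abelian_group X"
  proof (rule abelian_groupI)
    fix f g h assume f: "f \<in> carrier X" and g: "g \<in> carrier X" and h: "h \<in> carrier X"
    show "f \<oplus>\<^bsub>X\<^esub> g \<oplus>\<^bsub>X\<^esub> h = f \<oplus>\<^bsub>X\<^esub> (g \<oplus>\<^bsub>X\<^esub> h)"
      using D[OF f] D[OF g] D[OF h] by (auto simp: add fun_eq_iff W.V.M.a_assoc)
  next
    fix f g assume f: "f \<in> carrier X" and g: "g \<in> carrier X"
    show "f \<oplus>\<^bsub>X\<^esub> g = g \<oplus>\<^bsub>X\<^esub> f"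
      using D[OF f] D[OF g] by (auto simp: add fun_eq_iff W.V.M.a_comm)
  next
    fix f assume f: "f \<in> carrier X"
    show "\<zero>\<^bsub>X\<^esub> \<oplus>\<^bsub>X\<^esub> f = f"
      by (rule eqI[OF add_cl[OF zero_cl f] f]) (use D[OF f] in \<open>auto simp: add zero\<close>)
    have "(\<lambda>x\<in>carrier A. \<ominus>\<^bsub>W\<^esub> f x) \<in> carrier X"
      using D[OF f] by (intro I) (auto simp: W.V.M.minus_add minus_smult)
    moreover have "(\<lambda>x\<in>carrier A. \<ominus>\<^bsub>W\<^esub> f x) \<oplus>\<^bsub>X\<^esub> f = \<zero>\<^bsub>X\<^esub>"
      using D[OF f] by (auto simp: add zero fun_eq_iff W.V.M.l_neg)
    ultimately show "\<exists>g\<in>carrier X. g \<oplus>\<^bsub>X\<^esub> f = \<zero>\<^bsub>X\<^esub>" by blast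
  qed (use add_cl zero_cl in auto)
  show ?thesis
  proof (intro left_module.intro A.ring_axioms ag left_module_axioms.intro)
    fix a f assume a: "a \<in> carrier A" and f: "f \<in> carrier X"
    show "a \<odot>\<^bsub>X\<^esub> f \<in> carrier X" by (rule sm_cl[OF a f])
    { fix b assume b: "b \<in> carrier A"
      show "(a \<oplus> b) \<odot>\<^bsub>X\<^esub> f = a \<odot>\<^bsub>X\<^esub> f \<oplus>\<^bsub>X\<^esub> b \<odot>\<^bsub>X\<^esub> f"
        using a b D[OF f] by (auto simp: add smult fun_eq_iff A.r_distr)
      show "(a \<otimes> b) \<odot>\<^bsub>X\<^esub> f = a \<odot>\<^bsub>X\<^esub> (b \<odot>\<^bsub>X\<^esub> f)"
        using a b D[OF f] by (auto simp: smult fun_eq_iff A.m_assoc) }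
    fix g assume g: "g \<in> carrier X"
    show "a \<odot>\<^bsub>X\<^esub> (f \<oplus>\<^bsub>X\<^esub> g) = a \<odot>\<^bsub>X\<^esub> f \<oplus>\<^bsub>X\<^esub> a \<odot>\<^bsub>X\<^esub> g"
      using a D[OF f] D[OF g] by (auto simp: add smult fun_eq_iff)
  next
    fix f assume f: "f \<in> carrier X"
    show "\<one> \<odot>\<^bsub>X\<^esub> f = f"
      by (rule eqI[OF sm_cl[OF A.one_closed f] f]) (auto simp: smult)
  qed
qed

lemma regular_vspace: "vspace K (regular_module K)"
proof -
  have "abelian_group (regular_module K)"
    by (rule abelian_groupI) (auto simp: K.a_ac intro: K.add.l_inv_ex)
  then show ?thesis
    by (intro vspace.intro left_module.intro K.field_axioms K.ring_axioms left_module_axioms.intro)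
       (auto simp: K.l_distr K.r_distr K.m_assoc)
qed

lemma coreg_left_module: "left_module A (coreg K A)"
  by (rule coinduced_left_module[OF regular_vspace]) (auto simp: coreg_iff coreg_sel)

sublocale D: left_module A "coreg K A"
  by (rule coreg_left_module)

end

section \<open>Left-right symmetry of the trace condition\<close>

text \<open>Built one summand at a time, each with its own \<open>G\<close>, so that properties
  additive in \<open>c\<close> are proved by induction. Negatives are covered by
  \<open>- G \<phi> = G (- \<phi>)\<close>.\<close>

inductive_set coreg_trace :: "'k ring \<Rightarrow> ('k, 'a) module \<Rightarrow> 'a set" for K A where
  zero: "\<zero>\<^bsub>A\<^esub> \<in> coreg_trace K A"
| add: "c \<in> coreg_trace K A \<Longrightarrow> mod_lin A (coreg K A) (regular_module A) G \<Longrightarrow> \<phi> \<in> carrier (coreg K A) \<Longrightarrow>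
    c \<oplus>\<^bsub>A\<^esub> G \<phi> \<in> coreg_trace K A"

text \<open>\<open>H\<close> is the dual map \<open>D G\<close> from \<open>D A\<close> to the
  bidual of \<open>A\<close>, the latter identified with \<open>A\<close>. Only the pairing is
  recorded; linearity of \<open>H\<close> follows from it.\<close>

definition adjoint_pair where
  "adjoint_pair K A G H \<longleftrightarrow> mod_lin A (coreg K A) (regular_module A) G \<and> H \<in> carrier (coreg K A) \<rightarrow> carrier A \<and>
     (\<forall>\<phi>\<in>carrier (coreg K A). \<forall>\<psi>\<in>carrier (coreg K A). \<psi> (H \<phi>) = \<phi> (G \<psi>))"

text \<open>For \<open>J\<close> the whole of \<open>A\<close> this is the additive span of the
  values of all adjoints \<open>H\<close>, since \<open>b = 1\<close> is allowed.\<close>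

inductive_set shift_ideal :: "'k ring \<Rightarrow> ('k, 'a) module \<Rightarrow> 'a set \<Rightarrow> 'a set" for K A J where
  zero: "\<zero>\<^bsub>A\<^esub> \<in> shift_ideal K A J"
| add: "c \<in> shift_ideal K A J \<Longrightarrow> adjoint_pair K A G H \<Longrightarrow> \<phi> \<in> carrier (coreg K A) \<Longrightarrow> b \<in> J \<Longrightarrow>
    c \<oplus>\<^bsub>A\<^esub> H (b \<odot>\<^bsub>coreg K A\<^esub> \<phi>) \<in> shift_ideal K A J"

definition two_sided :: "('a, 'z) ring_scheme \<Rightarrow> 'a set \<Rightarrow> bool" where
  "two_sided A J \<longleftrightarrow> J \<subseteq> carrier A \<and> \<zero>\<^bsub>A\<^esub> \<in> J \<and> (\<forall>x\<in>J. \<forall>y\<in>J. x \<oplus>\<^bsub>A\<^esub> y \<in> J) \<and>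
     (\<forall>x\<in>J. \<forall>a\<in>carrier A. a \<otimes>\<^bsub>A\<^esub> x \<in> J \<and> x \<otimes>\<^bsub>A\<^esub> a \<in> J)"

lemma dual_sel:
  "\<zero>\<^bsub>dual K A M\<^esub> = (\<lambda>x\<in>carrier M. \<zero>\<^bsub>K\<^esub>)"
  "\<phi> \<oplus>\<^bsub>dual K A M\<^esub> \<psi> = (\<lambda>x\<in>carrier M. \<phi> x \<oplus>\<^bsub>K\<^esub> \<psi> x)"
  "a \<odot>\<^bsub>dual K A M\<^esub> \<phi> = (\<lambda>x\<in>carrier M. \<phi> (a \<odot>\<^bsub>M\<^esub> x))"
  by (simp_all add: dual_def)

context kalg begin

lemma coreg_smult_apply:
  "x \<in> carrier A \<Longrightarrow> (a \<odot>\<^bsub>coreg K A\<^esub> \<phi>) x = \<phi> (x \<otimes> a)"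
  by (simp add: coreg_sel)

lemma coreg_eqI:
  assumes "\<phi> \<in> carrier (coreg K A)" "\<psi> \<in> carrier (coreg K A)" "\<And>x. x \<in> carrier A \<Longrightarrow> \<phi> x = \<psi> x"
  shows "\<phi> = \<psi>"
  using assms by (intro extensionalityI[of _ "carrier A"]) (auto simp: coreg_iff)

text \<open>Both coregular modules consist of the same linear forms and differ only in the action,
  so one form can be fed to \<open>G\<close> and to its adjoint \<open>H\<close>.\<close>

lemma coreg_opposite_carrier: "carrier (dual K A (regular_module A)) = carrier (coreg K A)"
proof -
  interpret op: kalg K "opposite A" by (rule opposite_kalg)
  show ?thesis
    using op.coreg_iff by (auto simp: coreg_iff mod_lin_def)
qed

lemma coreg_zero_closed: "\<zero>\<^bsub>coreg K A\<^esub> \<in> carrier (coreg K A)"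
  using D.M.zero_closed .

lemma hom_zero:
  assumes "mod_lin A (coreg K A) (regular_module A) G"
  shows "G \<zero>\<^bsub>coreg K A\<^esub> = \<zero>"
  by (rule additive_zero[OF D.M.abelian_group_axioms A.abelian_group_axioms])
     (use mod_lin_closed[OF assms] mod_lin_add[OF assms] in auto)

lemma hom_closed:
  assumes "mod_lin A (coreg K A) (regular_module A) G" "\<phi> \<in> carrier (coreg K A)"
  shows "G \<phi> \<in> carrier A"
  using mod_lin_closed[OF assms] by simp

lemma coreg_trace_closed: "c \<in> coreg_trace K A \<Longrightarrow> c \<in> carrier A"
  by (induction rule: coreg_trace.induct) (auto intro: hom_closed)

lemma coreg_trace_add:
  assumes "c \<in> coreg_trace K A" "d \<in> coreg_trace K A"
  shows "c \<oplus> d \<in> coreg_trace K A"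
  using assms(2)
proof (induction rule: coreg_trace.induct)
  case zero
  then show ?case using assms(1) coreg_trace_closed by simp
next
  case (add d G \<phi>)
  have "(c \<oplus> d) \<oplus> G \<phi> \<in> coreg_trace K A"
    by (rule coreg_trace.add) (use add in auto)
  then show ?case
    using coreg_trace_closed[OF assms(1)] coreg_trace_closed[OF add.hyps(1)] hom_closed[OF add.hyps(2,3)]
    by (simp add: A.a_assoc)
qed

lemma underlying_coreg_vspace: "vspace K (underlying_space A (coreg K A))"
  by (rule underlying_vspace[OF coreg_left_module])

end

section \<open>Reflexivity, adjoints and the shift operator on ideals\<close>

locale fd_alg = kalg K A
  for K :: "'k ring" and A :: "('k, 'a) module" (structure) +
  assumes fin_dim: "fin_dim K A"
begin

lemma coreg_separates:
  assumes "x \<in> carrier A" "y \<in> carrier A" "\<And>\<phi>. \<phi> \<in> carrier (coreg K A) \<Longrightarrow> \<phi> x = \<phi> y"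
  shows "x = y"
proof -
  obtain B \<xi> where db: "dual_basis K A B (\<lambda>b. b) \<xi>" using vs.ex_dual_basis[OF fin_dim] by blast
  have "\<xi> b x = \<xi> b y" if "b \<in> B" for b
  proof -
    have "form K A (\<xi> b)" using db that by (auto simp: dual_basis_def)
    then have "restrict (\<xi> b) (carrier A) \<in> carrier (coreg K A)"
      by (intro coregI) (auto simp: form_closed form_add form_smult)
    from assms(3)[OF this] show ?thesis using assms(1,2) by simp
  qed
  then show ?thesis by (rule vs.dual_basis_separates[OF db assms(1,2)])
qed

text \<open>The bidual of \<open>A\<close> is \<open>A\<close>: the form \<open>L\<close> vanishes
  on every \<open>\<psi>\<close> that kills a spanning set \<open>B\<close>, hence is a combination
  of evaluations at elements of \<open>B\<close>, and the same combination of those elements is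
  \<open>h\<close>.\<close>

lemma coreg_reflexive:
  assumes L: "form K (underlying_space A (coreg K A)) L"
  shows "\<exists>h\<in>carrier A. \<forall>\<psi>\<in>carrier (coreg K A). L \<psi> = \<psi> h"
proof -
  interpret D: vspace K "underlying_space A (coreg K A)" by (rule underlying_coreg_vspace)
  obtain B \<xi> where db: "dual_basis K A B (\<lambda>b. b) \<xi>" using vs.ex_dual_basis[OF fin_dim] by blast
  have B: "finite B" "B \<subseteq> carrier A" using db by (auto simp: dual_basis_def)
  have ev: "form K (underlying_space A (coreg K A)) (\<lambda>\<psi>. \<psi> b)" if "b \<in> B" for b
    using that B coregD by (intro mod_linI) (auto simp: smult_mult coreg_sel)
  have van: "L \<psi> = \<zero>\<^bsub>K\<^esub>" if \<psi>: "\<psi> \<in> carrier (coreg K A)" and 0: "\<And>b. b \<in> B \<Longrightarrow> \<psi> b = \<zero>\<^bsub>K\<^esub>" for \<psi>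
  proof -
    have "\<psi> x = \<zero>\<^bsub>coreg K A\<^esub> x" if x: "x \<in> carrier A" for x
    proof -
      have "\<psi> x = (\<Oplus>\<^bsub>K\<^esub>b\<in>B. \<xi> b x \<otimes>\<^bsub>K\<^esub> \<psi> b)" by (rule vs.form_expand[OF db coregD(4)[OF \<psi>] x])
      also have "\<dots> = (\<Oplus>\<^bsub>K\<^esub>b\<in>B. \<zero>\<^bsub>K\<^esub>)"
      proof (rule K.finsum_cong')
        fix b assume b: "b \<in> B"
        then have "form K A (\<xi> b)" using db by (simp add: dual_basis_def)
        from form_closed[OF this x] show "\<xi> b x \<otimes>\<^bsub>K\<^esub> \<psi> b = \<zero>\<^bsub>K\<^esub>" using 0[OF b] by simp
      qed auto
      finally show ?thesis using x by (simp add: coreg_sel)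
    qed
    then have "\<psi> = \<zero>\<^bsub>coreg K A\<^esub>" by (intro coreg_eqI \<psi> coreg_zero_closed)
    then show ?thesis using D.form_zero[OF L] by simp
  qed
  obtain c where c: "c \<in> B \<rightarrow> carrier K"
    and Lc: "\<And>\<psi>. \<psi> \<in> carrier (coreg K A) \<Longrightarrow> L \<psi> = (\<Oplus>\<^bsub>K\<^esub>b\<in>B. c b \<otimes>\<^bsub>K\<^esub> \<psi> b)"
    using D.form_in_span[where \<xi> = "\<lambda>b \<psi>. \<psi> b", OF B(1) ev L] van by auto
  have id: "(\<lambda>b. b) \<in> B \<rightarrow> carrier A" using B by auto
  have "L \<psi> = \<psi> (\<Oplus>b\<in>B. c b \<odot> b)" if \<psi>: "\<psi> \<in> carrier (coreg K A)" for \<psi>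
    using vs.form_finsum[OF coregD(4)[OF \<psi>] c id] Lc[OF \<psi>] by simp
  then show ?thesis using vs.comb_closed[OF c id] by blast
qed

text \<open>For fixed \<open>\<phi>\<close>, the composite of \<open>G\<close> with
  \<open>\<phi>\<close> is a linear form on \<open>D A\<close>, hence evaluation at an element; this
  element is taken as \<open>H \<phi>\<close>.\<close>

lemma ex_adjoint:
  assumes G: "mod_lin A (coreg K A) (regular_module A) G"
  shows "\<exists>H. adjoint_pair K A G H"
proof -
  have "\<exists>h\<in>carrier A. \<forall>\<psi>\<in>carrier (coreg K A). \<phi> (G \<psi>) = \<psi> h" if \<phi>: "\<phi> \<in> carrier (coreg K A)" for \<phi>
  proof (rule coreg_reflexive[of "\<lambda>\<psi>. \<phi> (G \<psi>)"])
    show "form K (underlying_space A (coreg K A)) (\<lambda>\<psi>. \<phi> (G \<psi>))"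
      using hom_closed[OF G] coregD[OF \<phi>] mod_lin_add[OF G] mod_lin_smult[OF G]
      by (intro mod_linI) (auto simp: smult_mult)
  qed
  then have "\<exists>H. \<forall>\<phi>\<in>carrier (coreg K A). H \<phi> \<in> carrier A \<and> (\<forall>\<psi>\<in>carrier (coreg K A). \<phi> (G \<psi>) = \<psi> (H \<phi>))"
    by (intro bchoice) blast
  then obtain H where "\<forall>\<phi>\<in>carrier (coreg K A). H \<phi> \<in> carrier A \<and> (\<forall>\<psi>\<in>carrier (coreg K A). \<phi> (G \<psi>) = \<psi> (H \<phi>))"
    by blast
  then have "adjoint_pair K A G H" using G by (auto simp: adjoint_pair_def)
  then show ?thesis by blast
qed

lemma adjoint_pairD:
  assumes "adjoint_pair K A G H"
  shows "mod_lin A (coreg K A) (regular_module A) G"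
    and "\<phi> \<in> carrier (coreg K A) \<Longrightarrow> H \<phi> \<in> carrier A"
    and "\<phi> \<in> carrier (coreg K A) \<Longrightarrow> \<psi> \<in> carrier (coreg K A) \<Longrightarrow> \<psi> (H \<phi>) = \<phi> (G \<psi>)"
  using assms by (auto simp: adjoint_pair_def)

text \<open>Tested against all forms \<open>\<psi>\<close>: right multiplication by \<open>a\<close>
  is absorbed into \<open>a \<psi>\<close>, and left linearity of \<open>G\<close> moves
  \<open>a\<close> into the argument of \<open>\<phi>\<close>.\<close>

lemma adjoint_right_mult:
  assumes GH: "adjoint_pair K A G H" and \<phi>: "\<phi> \<in> carrier (coreg K A)" and a: "a \<in> carrier A"
  shows "H \<phi> \<otimes> a = H (\<lambda>x\<in>carrier A. \<phi> (a \<otimes> x))"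
proof (rule coreg_separates)
  note G = adjoint_pairD(1)[OF GH]
  have \<phi>a: "(\<lambda>x\<in>carrier A. \<phi> (a \<otimes> x)) \<in> carrier (coreg K A)" by (rule coreg_translate_left[OF \<phi> a])
  show "H \<phi> \<otimes> a \<in> carrier A" "H (\<lambda>x\<in>carrier A. \<phi> (a \<otimes> x)) \<in> carrier A"
    using adjoint_pairD(2)[OF GH] \<phi> \<phi>a a by auto
  fix \<psi> assume \<psi>: "\<psi> \<in> carrier (coreg K A)"
  have a\<psi>: "a \<odot>\<^bsub>coreg K A\<^esub> \<psi> \<in> carrier (coreg K A)" using D.smult_closed a \<psi> by blast
  have "\<psi> (H \<phi> \<otimes> a) = (a \<odot>\<^bsub>coreg K A\<^esub> \<psi>) (H \<phi>)"
    using adjoint_pairD(2)[OF GH \<phi>] by (simp add: coreg_smult_apply)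
  also have "\<dots> = \<phi> (a \<otimes> G \<psi>)"
    using adjoint_pairD(3)[OF GH \<phi> a\<psi>] mod_lin_smult[OF G a \<psi>] by simp
  also have "\<dots> = \<psi> (H (\<lambda>x\<in>carrier A. \<phi> (a \<otimes> x)))"
    using adjoint_pairD(3)[OF GH \<phi>a \<psi>] hom_closed[OF G \<psi>] by simp
  finally show "\<psi> (H \<phi> \<otimes> a) = \<psi> (H (\<lambda>x\<in>carrier A. \<phi> (a \<otimes> x)))" .
qed

lemma adjoint_add:
  assumes GH: "adjoint_pair K A G H" and \<phi>: "\<phi> \<in> carrier (coreg K A)" and \<chi>: "\<chi> \<in> carrier (coreg K A)"
  shows "H (\<phi> \<oplus>\<^bsub>coreg K A\<^esub> \<chi>) = H \<phi> \<oplus> H \<chi>"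
proof (rule coreg_separates)
  note G = adjoint_pairD(1)[OF GH]
  have s: "\<phi> \<oplus>\<^bsub>coreg K A\<^esub> \<chi> \<in> carrier (coreg K A)" using \<phi> \<chi> by (rule D.M.a_closed)
  show "H (\<phi> \<oplus>\<^bsub>coreg K A\<^esub> \<chi>) \<in> carrier A" "H \<phi> \<oplus> H \<chi> \<in> carrier A"
    using adjoint_pairD(2)[OF GH] s \<phi> \<chi> by auto
  fix \<psi> assume \<psi>: "\<psi> \<in> carrier (coreg K A)"
  show "\<psi> (H (\<phi> \<oplus>\<^bsub>coreg K A\<^esub> \<chi>)) = \<psi> (H \<phi> \<oplus> H \<chi>)"
    using adjoint_pairD(3)[OF GH _ \<psi>] s \<phi> \<chi> coregD(2)[OF \<psi>] adjoint_pairD(2)[OF GH] hom_closed[OF G \<psi>]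
    by (simp add: coreg_sel)
qed

lemma adjoint_opposite:
  assumes GH: "adjoint_pair K A G H"
  shows "mod_lin (opposite A) (coreg K (opposite A)) (regular_module (opposite A)) H"
  using adjoint_pairD(2)[OF GH] adjoint_add[OF GH] adjoint_right_mult[OF GH]
  by (intro mod_linI) (auto simp: coreg_opposite_carrier dual_sel coreg_sel)

text \<open>Adjoints are linear over the opposite algebra, so their values belong to its
  trace.\<close>

lemma shift_ideal_op_trace:
  assumes "c \<in> shift_ideal K A J" "J \<subseteq> carrier A"
  shows "c \<in> coreg_trace K (opposite A)"
  using assms(1)
proof (induction rule: shift_ideal.induct)
  case zero
  then show ?case using coreg_trace.zero[of "opposite A"] by simp
next
  case (add c G H \<phi> b)
  have "b \<odot>\<^bsub>coreg K A\<^esub> \<phi> \<in> carrier (coreg K A)" using add.hyps assms(2) D.smult_closed by blast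
  then show ?case
    using coreg_trace.add[OF add.IH adjoint_opposite[OF add.hyps(2)]] by (simp add: coreg_opposite_carrier)
qed

text \<open>Left multiplication of \<open>H\<close> stays within adjoint pairs once \<open>G\<close>
  is precomposed with the right action of \<open>a\<close> on \<open>D A\<close>.\<close>

lemma adjoint_left_mult:
  assumes GH: "adjoint_pair K A G H" and a: "a \<in> carrier A"
  shows "adjoint_pair K A (\<lambda>\<psi>. G (\<lambda>x\<in>carrier A. \<psi> (a \<otimes> x))) (\<lambda>\<phi>. a \<otimes> H \<phi>)"
proof -
  note G = adjoint_pairD(1)[OF GH]
  have tr: "(\<lambda>x\<in>carrier A. \<psi> (a \<otimes> x)) \<in> carrier (coreg K A)" if "\<psi> \<in> carrier (coreg K A)" for \<psi>
    by (rule coreg_translate_left[OF that a])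
  have "mod_lin A (coreg K A) (regular_module A) (\<lambda>\<psi>. G (\<lambda>x\<in>carrier A. \<psi> (a \<otimes> x)))"
  proof (rule mod_linI)
    fix \<psi> assume \<psi>: "\<psi> \<in> carrier (coreg K A)"
    show "G (\<lambda>x\<in>carrier A. \<psi> (a \<otimes> x)) \<in> carrier (regular_module A)"
      using hom_closed[OF G tr[OF \<psi>]] by simp
    { fix \<chi> assume \<chi>: "\<chi> \<in> carrier (coreg K A)"
      have "(\<lambda>x\<in>carrier A. (\<psi> \<oplus>\<^bsub>coreg K A\<^esub> \<chi>) (a \<otimes> x)) =
          (\<lambda>x\<in>carrier A. \<psi> (a \<otimes> x)) \<oplus>\<^bsub>coreg K A\<^esub> (\<lambda>x\<in>carrier A. \<chi> (a \<otimes> x))"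
        using a by (auto simp: coreg_sel fun_eq_iff)
      then show "G (\<lambda>x\<in>carrier A. (\<psi> \<oplus>\<^bsub>coreg K A\<^esub> \<chi>) (a \<otimes> x)) =
          G (\<lambda>x\<in>carrier A. \<psi> (a \<otimes> x)) \<oplus>\<^bsub>regular_module A\<^esub> G (\<lambda>x\<in>carrier A. \<chi> (a \<otimes> x))"
        using mod_lin_add[OF G tr[OF \<psi>] tr[OF \<chi>]] by simp }
    { fix b assume b: "b \<in> carrier A"
      have "(\<lambda>x\<in>carrier A. (b \<odot>\<^bsub>coreg K A\<^esub> \<psi>) (a \<otimes> x)) =
          b \<odot>\<^bsub>coreg K A\<^esub> (\<lambda>x\<in>carrier A. \<psi> (a \<otimes> x))"
        using a b by (auto simp: coreg_sel fun_eq_iff A.m_assoc)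
      then show "G (\<lambda>x\<in>carrier A. (b \<odot>\<^bsub>coreg K A\<^esub> \<psi>) (a \<otimes> x)) =
          b \<odot>\<^bsub>regular_module A\<^esub> G (\<lambda>x\<in>carrier A. \<psi> (a \<otimes> x))"
        using mod_lin_smult[OF G b tr[OF \<psi>]] by simp }
  qed
  moreover have "\<psi> (a \<otimes> H \<phi>) = \<phi> (G (\<lambda>x\<in>carrier A. \<psi> (a \<otimes> x)))"
    if "\<phi> \<in> carrier (coreg K A)" "\<psi> \<in> carrier (coreg K A)" for \<phi> \<psi>
    using adjoint_pairD(3)[OF GH that(1) tr[OF that(2)]] adjoint_pairD(2)[OF GH that(1)] by simp
  ultimately show ?thesis using adjoint_pairD(2)[OF GH] a by (auto simp: adjoint_pair_def)
qed

lemma shift_ideal_closed: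
  assumes "J \<subseteq> carrier A" "c \<in> shift_ideal K A J"
  shows "c \<in> carrier A"
  using assms(2)
proof (induction rule: shift_ideal.induct)
  case (add c G H \<phi> b)
  have "b \<odot>\<^bsub>coreg K A\<^esub> \<phi> \<in> carrier (coreg K A)" using add.hyps assms(1) D.smult_closed by blast
  then show ?case using add.IH adjoint_pairD(2)[OF add.hyps(2)] by simp
qed simp

text \<open>A left factor is absorbed by changing the pair \<open>G\<close>, \<open>H\<close>, a
  right factor by letting it act on \<open>\<phi>\<close>; the element \<open>b\<close> is untouched
  in both cases.\<close>

lemma two_sided_shift_ideal:
  assumes J: "J \<subseteq> carrier A"
  shows "two_sided A (shift_ideal K A J)"
proof -
  have cl: "H (b \<odot>\<^bsub>coreg K A\<^esub> \<phi>) \<in> carrier A" "b \<odot>\<^bsub>coreg K A\<^esub> \<phi> \<in> carrier (coreg K A)"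
    if "adjoint_pair K A G H" "\<phi> \<in> carrier (coreg K A)" "b \<in> J" for G H \<phi> b
  proof -
    show 1: "b \<odot>\<^bsub>coreg K A\<^esub> \<phi> \<in> carrier (coreg K A)" using that J D.smult_closed by blast
    show "H (b \<odot>\<^bsub>coreg K A\<^esub> \<phi>) \<in> carrier A" by (rule adjoint_pairD(2)[OF that(1) 1])
  qed
  have add: "x \<oplus> y \<in> shift_ideal K A J"
    if x: "x \<in> shift_ideal K A J" and y: "y \<in> shift_ideal K A J" for x y
    using y
  proof (induction rule: shift_ideal.induct)
    case zero
    then show ?case using x shift_ideal_closed[OF J x] by simp
  next
    case (add c G H \<phi> b)
    have "(x \<oplus> c) \<oplus> H (b \<odot>\<^bsub>coreg K A\<^esub> \<phi>) \<in> shift_ideal K A J"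
      by (rule shift_ideal.add[OF add.IH add.hyps(2-4)])
    then show ?case
      using shift_ideal_closed[OF J x] shift_ideal_closed[OF J add.hyps(1)] cl[OF add.hyps(2-4)]
      by (simp add: A.a_assoc)
  qed
  have left: "a \<otimes> x \<in> shift_ideal K A J" if "x \<in> shift_ideal K A J" and a: "a \<in> carrier A" for x a
    using that(1)
  proof (induction rule: shift_ideal.induct)
    case (add c G H \<phi> b)
    have "a \<otimes> c \<oplus> a \<otimes> H (b \<odot>\<^bsub>coreg K A\<^esub> \<phi>) \<in> shift_ideal K A J"
      by (rule shift_ideal.add[OF add.IH adjoint_left_mult[OF add.hyps(2) a] add.hyps(3,4)])
    then show ?case
      using a shift_ideal_closed[OF J add.hyps(1)] cl[OF add.hyps(2-4)] by (simp add: A.r_distr)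
  qed (use a shift_ideal.zero in simp)
  have right: "x \<otimes> a \<in> shift_ideal K A J" if "x \<in> shift_ideal K A J" and a: "a \<in> carrier A" for x a
    using that(1)
  proof (induction rule: shift_ideal.induct)
    case (add c G H \<phi> b)
    have b: "b \<in> carrier A" using add.hyps J by auto
    have "(\<lambda>x\<in>carrier A. (b \<odot>\<^bsub>coreg K A\<^esub> \<phi>) (a \<otimes> x)) = b \<odot>\<^bsub>coreg K A\<^esub> (\<lambda>x\<in>carrier A. \<phi> (a \<otimes> x))"
      using a b by (auto simp: coreg_sel fun_eq_iff A.m_assoc)
    then have "H (b \<odot>\<^bsub>coreg K A\<^esub> \<phi>) \<otimes> a = H (b \<odot>\<^bsub>coreg K A\<^esub> (\<lambda>x\<in>carrier A. \<phi> (a \<otimes> x)))"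
      using adjoint_right_mult[OF add.hyps(2) cl(2)[OF add.hyps(2-4)] a] by simp
    moreover have "c \<otimes> a \<oplus> H (b \<odot>\<^bsub>coreg K A\<^esub> (\<lambda>x\<in>carrier A. \<phi> (a \<otimes> x))) \<in> shift_ideal K A J"
      by (rule shift_ideal.add[OF add.IH add.hyps(2) coreg_translate_left[OF add.hyps(3) a] add.hyps(4)])
    ultimately show ?case
      using a shift_ideal_closed[OF J add.hyps(1)] cl[OF add.hyps(2-4)] by (simp add: A.l_distr)
  qed (use a shift_ideal.zero in simp)
  show ?thesis
    unfolding two_sided_def using shift_ideal_closed[OF J] shift_ideal.zero add left right by auto
qed

lemma shift_ideal_mono:
  assumes "J \<subseteq> J'" shows "shift_ideal K A J \<subseteq> shift_ideal K A J'"
proof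
  fix c assume "c \<in> shift_ideal K A J"
  then show "c \<in> shift_ideal K A J'"
    by (induction rule: shift_ideal.induct) (use assms in \<open>auto intro: shift_ideal.intros\<close>)
qed

text \<open>The computation \<open>\<psi>(H(b \<phi>) x) = (b \<phi>)(G(x \<psi>)) = \<phi>(x
  G(\<psi>) b)\<close> shows that \<open>\<psi>(c -) = (G(\<psi>) b) \<phi>\<close> for
  \<open>c = H(b \<phi>)\<close>; then left linearity of \<open>G'\<close> applies.\<close>

lemma adjoint_composite:
  assumes GH: "adjoint_pair K A G H" and G': "mod_lin A (coreg K A) (regular_module A) G'"
    and \<phi>: "\<phi> \<in> carrier (coreg K A)" and \<psi>: "\<psi> \<in> carrier (coreg K A)" and b: "b \<in> carrier A"
  shows "G' (\<lambda>x\<in>carrier A. \<psi> (H (b \<odot>\<^bsub>coreg K A\<^esub> \<phi>) \<otimes> x)) = G \<psi> \<otimes> b \<otimes> G' \<phi>"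
proof -
  note G = adjoint_pairD(1)[OF GH]
  have b\<phi>: "b \<odot>\<^bsub>coreg K A\<^esub> \<phi> \<in> carrier (coreg K A)" using D.smult_closed[OF b \<phi>] .
  note cl = adjoint_pairD(2)[OF GH b\<phi>] hom_closed[OF G \<psi>]
  have "\<psi> (H (b \<odot>\<^bsub>coreg K A\<^esub> \<phi>) \<otimes> x) = \<phi> (x \<otimes> (G \<psi> \<otimes> b))" if x: "x \<in> carrier A" for x
  proof -
    have x\<psi>: "x \<odot>\<^bsub>coreg K A\<^esub> \<psi> \<in> carrier (coreg K A)" using D.smult_closed[OF x \<psi>] .
    have "\<psi> (H (b \<odot>\<^bsub>coreg K A\<^esub> \<phi>) \<otimes> x) = (b \<odot>\<^bsub>coreg K A\<^esub> \<phi>) (G (x \<odot>\<^bsub>coreg K A\<^esub> \<psi>))"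
      using adjoint_pairD(3)[OF GH b\<phi> x\<psi>] cl by (simp add: coreg_smult_apply)
    also have "\<dots> = \<phi> (x \<otimes> G \<psi> \<otimes> b)"
      using mod_lin_smult[OF G x \<psi>] cl x b by (simp add: coreg_smult_apply)
    finally show ?thesis using x b cl by (simp add: A.m_assoc)
  qed
  then have "(\<lambda>x\<in>carrier A. \<psi> (H (b \<odot>\<^bsub>coreg K A\<^esub> \<phi>) \<otimes> x)) = (G \<psi> \<otimes> b) \<odot>\<^bsub>coreg K A\<^esub> \<phi>"
    by (auto simp: coreg_sel fun_eq_iff)
  then show ?thesis using mod_lin_smult[OF G', of "G \<psi> \<otimes> b" \<phi>] cl b \<phi> by simp
qed

text \<open>A partial inverse of the shift: \<open>adjoint_composite\<close> brings each summand of
  \<open>c\<close> back into \<open>J\<close>.\<close>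

lemma shift_ideal_pull_back:
  assumes J: "two_sided A J" and c: "c \<in> shift_ideal K A J"
    and G': "mod_lin A (coreg K A) (regular_module A) G'" and \<psi>: "\<psi> \<in> carrier (coreg K A)"
  shows "G' (\<lambda>x\<in>carrier A. \<psi> (c \<otimes> x)) \<in> J"
  using c
proof (induction rule: shift_ideal.induct)
  case zero
  have "(\<lambda>x\<in>carrier A. \<psi> (\<zero> \<otimes> x)) = \<zero>\<^bsub>coreg K A\<^esub>"
    using vs.form_zero[OF coregD(4)[OF \<psi>]] by (auto simp: coreg_sel fun_eq_iff)
  then show ?case using hom_zero[OF G'] J by (simp add: two_sided_def)
next
  case (add c G H \<phi> b)
  have JA: "J \<subseteq> carrier A" using J by (simp add: two_sided_def)
  then have b: "b \<in> carrier A" using add.hyps by auto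
  have cA: "c \<in> carrier A" by (rule shift_ideal_closed[OF JA add.hyps(1)])
  define h where "h = H (b \<odot>\<^bsub>coreg K A\<^esub> \<phi>)"
  have h: "h \<in> carrier A"
    unfolding h_def using adjoint_pairD(2)[OF add.hyps(2)] D.smult_closed[OF b add.hyps(3)] by blast
  have "(\<lambda>x\<in>carrier A. \<psi> ((c \<oplus> h) \<otimes> x)) =
      (\<lambda>x\<in>carrier A. \<psi> (c \<otimes> x)) \<oplus>\<^bsub>coreg K A\<^esub> (\<lambda>x\<in>carrier A. \<psi> (h \<otimes> x))"
    using cA h coregD(2)[OF \<psi>] by (auto simp: coreg_sel fun_eq_iff A.l_distr)
  then have "G' (\<lambda>x\<in>carrier A. \<psi> ((c \<oplus> h) \<otimes> x)) =
      G' (\<lambda>x\<in>carrier A. \<psi> (c \<otimes> x)) \<oplus> G \<psi> \<otimes> b \<otimes> G' \<phi>"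
    using mod_lin_add[OF G' coreg_translate_left[OF \<psi> cA] coreg_translate_left[OF \<psi> h]]
      adjoint_composite[OF add.hyps(2) G' add.hyps(3) \<psi> b] by (simp add: h_def)
  moreover have "G \<psi> \<otimes> b \<otimes> G' \<phi> \<in> J"
    using J add.hyps(4) hom_closed[OF adjoint_pairD(1)[OF add.hyps(2)] \<psi>] hom_closed[OF G' add.hyps(3)]
    by (auto simp: two_sided_def)
  ultimately show ?case using add.IH J unfolding h_def[symmetric] two_sided_def by metis
qed

text \<open>Write \<open>b = 1 b 1\<close> with both units as sums of values. Each product
  \<open>G(\<psi>) b G'(\<phi>)\<close> is recovered from \<open>H(b \<phi>)\<close>, which lies in
  the shift of \<open>J\<close> and therefore in that of \<open>J'\<close>.\<close>

lemma shift_ideal_reflects: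
  assumes one: "\<one> \<in> coreg_trace K A" and J: "two_sided A J" and J': "two_sided A J'"
    and sub: "shift_ideal K A J \<subseteq> shift_ideal K A J'"
  shows "J \<subseteq> J'"
proof
  fix b assume b: "b \<in> J"
  have bA: "b \<in> carrier A" using b J by (auto simp: two_sided_def)
  have 1: "G \<psi> \<otimes> b \<otimes> t \<in> J'"
    if G: "mod_lin A (coreg K A) (regular_module A) G" and \<psi>: "\<psi> \<in> carrier (coreg K A)"
      and t: "t \<in> coreg_trace K A" for G \<psi> t
    using t
  proof (induction rule: coreg_trace.induct)
    case zero
    show ?case using J' hom_closed[OF G \<psi>] bA by (auto simp: two_sided_def)
  next
    case (add t G' \<phi>)
    obtain H where H: "adjoint_pair K A G H" using ex_adjoint[OF G] by blast
    have "\<zero> \<oplus> H (b \<odot>\<^bsub>coreg K A\<^esub> \<phi>) \<in> shift_ideal K A J"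
      by (rule shift_ideal.add[OF shift_ideal.zero H add.hyps(3) b])
    moreover have "H (b \<odot>\<^bsub>coreg K A\<^esub> \<phi>) \<in> carrier A"
      using adjoint_pairD(2)[OF H] D.smult_closed[OF bA add.hyps(3)] by blast
    ultimately have "H (b \<odot>\<^bsub>coreg K A\<^esub> \<phi>) \<in> shift_ideal K A J'" using sub by auto
    from shift_ideal_pull_back[OF J' this add.hyps(2) \<psi>]
    have "G \<psi> \<otimes> b \<otimes> G' \<phi> \<in> J'" using adjoint_composite[OF H add.hyps(2,3) \<psi> bA] by simp
    then have "G \<psi> \<otimes> b \<otimes> t \<oplus> G \<psi> \<otimes> b \<otimes> G' \<phi> \<in> J'"
      using add.IH J' by (auto simp: two_sided_def)
    then show ?case
      using hom_closed[OF G \<psi>] bA coreg_trace_closed[OF add.hyps(1)] hom_closed[OF add.hyps(2,3)]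
      by (simp add: A.r_distr)
  qed
  have 2: "s \<otimes> b \<in> J'" if "s \<in> coreg_trace K A" for s
    using that
  proof (induction rule: coreg_trace.induct)
    case zero
    show ?case using J' bA by (auto simp: two_sided_def)
  next
    case (add s G \<psi>)
    have "G \<psi> \<otimes> b \<in> J'" using 1[OF add.hyps(2,3) one] hom_closed[OF add.hyps(2,3)] bA by simp
    then have "s \<otimes> b \<oplus> G \<psi> \<otimes> b \<in> J'" using add.IH J' by (auto simp: two_sided_def)
    then show ?case
      using bA coreg_trace_closed[OF add.hyps(1)] hom_closed[OF add.hyps(2,3)] by (simp add: A.l_distr)
  qed
  show "b \<in> J'" using 2[OF one] bA by simp
qed

theorem coreg_trace_opposite:
  assumes one: "\<one> \<in> coreg_trace K A"
  shows "\<one> \<in> coreg_trace K (opposite A)"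
proof -
  define U where "U k = (shift_ideal K A ^^ k) (carrier A)" for k
  have U_Suc: "U (Suc k) = shift_ideal K A (U k)" for k by (simp add: U_def)
  have ts: "two_sided A (U k)" for k
  proof (cases k)
    case 0
    then show ?thesis by (simp add: U_def two_sided_def)
  next
    case (Suc n)
    have "U n \<subseteq> carrier A"
    proof (induction n)
      case 0
      then show ?case by (simp add: U_def)
    next
      case (Suc n)
      then show ?case using shift_ideal_closed unfolding U_Suc by blast
    qed
    then show ?thesis unfolding Suc U_Suc by (rule two_sided_shift_ideal)
  qed
  have sub: "U k \<subseteq> carrier A" for k using ts by (simp add: two_sided_def)
  have dec: "U (Suc k) \<subseteq> U k" for k
  proof (induction k)
    case 0
    then show ?case using sub[of 1] by (simp add: U_def)
  next
    case (Suc k)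
    then show ?case unfolding U_Suc[of "Suc k"] U_Suc[of k] by (rule shift_ideal_mono)
  qed
  obtain B \<xi> where db: "dual_basis K A B (\<lambda>b. b) \<xi>" using vs.ex_dual_basis[OF fin_dim] by blast
  have "\<exists>k. \<forall>j\<ge>k. U j = U k"
  proof (rule vs.descending_subspaces_stable[of B \<xi>])
    show "finite B" "\<And>i. i \<in> B \<Longrightarrow> form K A (\<xi> i)" using db by (auto simp: dual_basis_def)
    show "c \<odot> x \<in> U k" if "c \<in> carrier K" "x \<in> U k" for k c x
    proof -
      have "(c \<odot> \<one>) \<otimes> x \<in> U k" using that ts[of k] by (auto simp: two_sided_def)
      then show ?thesis using that sub by (simp add: smult_mult subset_iff)
    qed
    show "x = \<zero>" if x: "x \<in> U 0" "\<And>i. i \<in> B \<Longrightarrow> \<xi> i x = \<zero>\<^bsub>K\<^esub>" for x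
    proof (rule vs.dual_basis_separates[OF db])
      show "x \<in> carrier A" using x sub by auto
      show "\<xi> i x = \<xi> i \<zero>" if "i \<in> B" for i
        using x(2)[OF that] vs.form_zero[of "\<xi> i"] db that by (auto simp: dual_basis_def)
    qed simp
  qed (use sub dec ts in \<open>auto simp: two_sided_def\<close>)
  then obtain k where k: "U (Suc k) = U k" by (metis le_Suc_eq order_refl)
  \<comment> \<open>As \<open>U (Suc k)\<close> is the shift of \<open>U k\<close>, reflection
    cancels one application of the operator on both sides, and equality at any stage descends to
    \<open>U 1 = U 0\<close>, the whole algebra.\<close>
  have "U (Suc k) = U k \<Longrightarrow> U 1 = U 0" for k
  proof (induction k)
    case (Suc k)
    have "U k \<subseteq> U (Suc k)"
      by (rule shift_ideal_reflects[OF one ts ts]) (use Suc.prems U_Suc in simp)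
    then show ?case using Suc.IH dec by blast
  qed simp
  with k have "\<one> \<in> shift_ideal K A (carrier A)" by (simp add: U_def)
  then show ?thesis by (rule shift_ideal_op_trace) simp
qed

end

section \<open>Transport to coordinates\<close>

text \<open>\<open>injective_module\<close> tests modules whose elements are functions
  \<open>nat \<Rightarrow> 'k\<close>, while the test is wanted on the regular module and on
  \<open>endo_module\<close>. Copying the structure along an injection of the carrier bridges the
  gap.\<close>

definition transport :: "('m \<Rightarrow> 'n) \<Rightarrow> ('a, 'm) module \<Rightarrow> ('a, 'n) module" where
  "transport \<theta> M =
     \<lparr>carrier = \<theta> ` carrier M, monoid.mult = undefined, one = undefined, zero = \<theta> \<zero>\<^bsub>M\<^esub>,
      add = (\<lambda>x y. \<theta> (inv_into (carrier M) \<theta> x \<oplus>\<^bsub>M\<^esub> inv_into (carrier M) \<theta> y)),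
      smult = (\<lambda>a x. \<theta> (a \<odot>\<^bsub>M\<^esub> inv_into (carrier M) \<theta> x))\<rparr>"

lemma transport_sel:
  assumes "inj_on \<theta> (carrier M)"
  shows "carrier (transport \<theta> M) = \<theta> ` carrier M" "\<zero>\<^bsub>transport \<theta> M\<^esub> = \<theta> \<zero>\<^bsub>M\<^esub>"
    "x \<in> carrier M \<Longrightarrow> y \<in> carrier M \<Longrightarrow> \<theta> x \<oplus>\<^bsub>transport \<theta> M\<^esub> \<theta> y = \<theta> (x \<oplus>\<^bsub>M\<^esub> y)"
    "x \<in> carrier M \<Longrightarrow> a \<odot>\<^bsub>transport \<theta> M\<^esub> \<theta> x = \<theta> (a \<odot>\<^bsub>M\<^esub> x)"
  using assms by (simp_all add: transport_def)

lemma transport_left_module: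
  assumes "left_module A M" and inj: "inj_on \<theta> (carrier M)"
  shows "left_module A (transport \<theta> M)"
proof -
  interpret M: left_module A M by fact
  note [simp] = transport_sel[OF inj]
  have "abelian_group (transport \<theta> M)"
  proof (rule abelian_groupI)
    fix x assume "x \<in> carrier (transport \<theta> M)"
    then obtain v where v: "v \<in> carrier M" "x = \<theta> v" by auto
    then have "\<theta> (\<ominus>\<^bsub>M\<^esub> v) \<oplus>\<^bsub>transport \<theta> M\<^esub> x = \<zero>\<^bsub>transport \<theta> M\<^esub>" by (simp add: M.M.l_neg)
    then show "\<exists>y\<in>carrier (transport \<theta> M). y \<oplus>\<^bsub>transport \<theta> M\<^esub> x = \<zero>\<^bsub>transport \<theta> M\<^esub>"
      using v by (intro bexI[of _ "\<theta> (\<ominus>\<^bsub>M\<^esub> v)"]) auto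
  qed (auto simp: M.M.a_ac)
  then show ?thesis
    by (intro left_module.intro M.R.ring_axioms left_module_axioms.intro)
       (auto simp: M.smult_closed M.smult_l_distr M.smult_r_distr M.smult_assoc1 M.smult_one)
qed

lemma transport_mod_lin:
  assumes "inj_on \<theta> (carrier M)"
  shows "mod_lin A M (transport \<theta> M) \<theta>"
  by (intro mod_linI) (simp_all add: transport_sel[OF assms])

context kalg begin

lemma transport_fd_module:
  assumes "fd_module K A M" and inj: "inj_on \<theta> (carrier M)"
  shows "fd_module K A (transport \<theta> M)"
proof -
  have lm: "left_module A M" using assms by (simp add: fd_module_def)
  have lt: "left_module A (transport \<theta> M)" by (rule transport_left_module[OF lm inj])
  interpret M: vspace K "underlying_space A M" by (rule underlying_vspace[OF lm])
  interpret T: vspace K "underlying_space A (transport \<theta> M)" by (rule underlying_vspace[OF lt])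
  obtain B where B: "finite B" "B \<subseteq> carrier M"
    "\<And>v. v \<in> carrier M \<Longrightarrow> \<exists>c\<in>B \<rightarrow> carrier K. v = (\<Oplus>\<^bsub>underlying_space A M\<^esub>b\<in>B. c b \<odot>\<^bsub>underlying_space A M\<^esub> b)"
    using assms(1) unfolding fd_module_def fin_dim_def by auto
  have \<theta>: "mod_lin K (underlying_space A M) (underlying_space A (transport \<theta> M)) \<theta>"
    by (rule mod_lin_underlying[OF transport_mod_lin[OF inj]])
  have "fin_dim K (underlying_space A (transport \<theta> M))"
  proof (rule T.fin_dim_family[OF B(1)])
    show "\<theta> \<in> B \<rightarrow> carrier (underlying_space A (transport \<theta> M))"
      using B(2) by (auto simp: transport_sel[OF inj])
    fix w assume "w \<in> carrier (underlying_space A (transport \<theta> M))"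
    then obtain v where v: "v \<in> carrier M" "w = \<theta> v" by (auto simp: transport_sel[OF inj])
    obtain c where c: "c \<in> B \<rightarrow> carrier K"
      "v = (\<Oplus>\<^bsub>underlying_space A M\<^esub>b\<in>B. c b \<odot>\<^bsub>underlying_space A M\<^esub> b)" using B(3)[OF v(1)] by blast
    have "\<theta> v = (\<Oplus>\<^bsub>underlying_space A (transport \<theta> M)\<^esub>b\<in>B. \<theta> (c b \<odot>\<^bsub>underlying_space A M\<^esub> b))"
      unfolding c(2)
    proof (rule additive_finsum[OF M.V.M.abelian_group_axioms T.V.M.abelian_group_axioms])
      show "(\<lambda>b. c b \<odot>\<^bsub>underlying_space A M\<^esub> b) \<in> B \<rightarrow> carrier (underlying_space A M)"
        using c(1) B(2) M.V.smult_closed by (auto simp: Pi_iff simp del: underlying_sel(4))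
    qed (use mod_lin_closed[OF \<theta>] mod_lin_add[OF \<theta>] in auto)
    also have "\<dots> = (\<Oplus>\<^bsub>underlying_space A (transport \<theta> M)\<^esub>b\<in>B. c b \<odot>\<^bsub>underlying_space A (transport \<theta> M)\<^esub> \<theta> b)"
    proof (rule T.V.M.finsum_cong'[OF refl])
      have *: "c b \<in> carrier K" "b \<in> carrier (underlying_space A M)" if "b \<in> B" for b using c(1) B(2) that by auto
      show "\<theta> (c b \<odot>\<^bsub>underlying_space A M\<^esub> b) = c b \<odot>\<^bsub>underlying_space A (transport \<theta> M)\<^esub> \<theta> b" if "b \<in> B" for b
        using mod_lin_smult[OF \<theta> *[OF that]] .
      show "(\<lambda>b. c b \<odot>\<^bsub>underlying_space A (transport \<theta> M)\<^esub> \<theta> b) \<in> B \<rightarrow> carrier (underlying_space A (transport \<theta> M))"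
        using T.V.smult_closed[OF *(1) mod_lin_closed[OF \<theta> *(2)]] by blast
    qed
    finally show "\<exists>c\<in>B \<rightarrow> carrier K. w = (\<Oplus>\<^bsub>underlying_space A (transport \<theta> M)\<^esub>b\<in>B. c b \<odot>\<^bsub>underlying_space A (transport \<theta> M)\<^esub> \<theta> b)"
      using c(1) v(2) by blast
  qed
  with lt show ?thesis by (simp add: fd_module_def)
qed

lemma fd_module_coordinates:
  fixes M :: "('a, 'm) module"
  assumes "fd_module K A M"
  shows "\<exists>\<theta> :: 'm \<Rightarrow> nat \<Rightarrow> 'k. inj_on \<theta> (carrier M)"
proof -
  have lm: "left_module A M" and fd: "fin_dim K (underlying_space A M)"
    using assms by (simp_all add: fd_module_def)
  interpret M: vspace K "underlying_space A M" by (rule underlying_vspace[OF lm])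
  obtain B \<xi> where db: "dual_basis K (underlying_space A M) B (\<lambda>b. b) \<xi>" using M.ex_dual_basis[OF fd] by blast
  then have "finite B" by (simp add: dual_basis_def)
  then obtain e :: "'m \<Rightarrow> nat" where e: "inj_on e B"
    using finite_imp_inj_to_nat_seg[of B] by auto
  \<comment> \<open>The coordinate at \<open>j\<close> is that of the basis vector numbered
    \<open>j\<close>. Numbers outside the range of \<open>e\<close> give unspecified values, which
    do no harm to injectivity.\<close>
  have "inj_on (\<lambda>v j. \<xi> (inv_into B e j) v) (carrier M)"
  proof (rule inj_onI)
    fix v w assume vw: "v \<in> carrier M" "w \<in> carrier M"
      and eq: "(\<lambda>j. \<xi> (inv_into B e j) v) = (\<lambda>j. \<xi> (inv_into B e j) w)"
    have "\<xi> b v = \<xi> b w" if "b \<in> B" for b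
      using fun_cong[OF eq, of "e b"] that e by simp
    then show "v = w" using vw by (intro M.dual_basis_separates[OF db]) auto
  qed
  then show ?thesis by blast
qed

text \<open>Frees the extension property from the element type: both modules are copied into
  coordinates, the map is extended there, and the extension is read back along
  \<open>\<eta>\<close>.\<close>

lemma injective_extend:
  fixes M :: "('a, 'm) module" and N :: "('a, 'n) module"
  assumes I: "injective_module K A I" and M: "fd_module K A M" and N: "fd_module K A N"
    and g: "mod_lin A M N g" and inj: "inj_on g (carrier M)" and f: "mod_lin A M I f"
  shows "\<exists>h. mod_lin A N I h \<and> (\<forall>x\<in>carrier M. h (g x) = f x)"
proof -
  obtain \<theta> :: "'m \<Rightarrow> nat \<Rightarrow> 'k" where \<theta>: "inj_on \<theta> (carrier M)" using fd_module_coordinates[OF M] by blast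
  obtain \<eta> :: "'n \<Rightarrow> nat \<Rightarrow> 'k" where \<eta>: "inj_on \<eta> (carrier N)" using fd_module_coordinates[OF N] by blast
  let ?M = "transport \<theta> M" and ?N = "transport \<eta> N"
  have lM: "left_module A M" and lN: "left_module A N" using M N by (auto simp: fd_module_def)
  interpret M: left_module A M by (rule lM)
  interpret N: left_module A N by (rule lN)
  interpret tM: left_module A ?M by (rule transport_left_module[OF lM \<theta>])
  interpret tN: left_module A ?N by (rule transport_left_module[OF lN \<eta>])
  note [simp] = transport_sel[OF \<theta>] transport_sel[OF \<eta>] inv_into_f_f[OF \<theta>] M.smult_closed N.smult_closed
  have cl: "g x \<in> carrier N" "f x \<in> carrier I" if "x \<in> carrier M" for x
    using that mod_lin_closed[OF g] mod_lin_closed[OF f] by auto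
  define g' where "g' = (\<lambda>v\<in>carrier ?M. \<eta> (g (inv_into (carrier M) \<theta> v)))"
  define f' where "f' = (\<lambda>v\<in>carrier ?M. f (inv_into (carrier M) \<theta> v))"
  have val: "g' (\<theta> x) = \<eta> (g x)" "f' (\<theta> x) = f x" if "x \<in> carrier M" for x
    using that by (simp_all add: g'_def f'_def)
  have "mod_lin A ?M ?N g'" "mod_lin A ?M I f'"
    using mod_lin_add[OF g] mod_lin_add[OF f] mod_lin_smult[OF g] mod_lin_smult[OF f]
    by (auto intro!: mod_linI simp: cl val)
  then have g': "g' \<in> mod_hom A ?M ?N" and f': "f' \<in> mod_hom A ?M I"
    by (simp_all add: mod_hom_iff g'_def f'_def)
  have "inj_on g' (carrier ?M)"
  proof (rule inj_onI)
    fix v w assume "v \<in> carrier ?M" "w \<in> carrier ?M" and eq: "g' v = g' w"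
    then obtain x y where xy: "x \<in> carrier M" "v = \<theta> x" "y \<in> carrier M" "w = \<theta> y" by auto
    then have "\<eta> (g x) = \<eta> (g y)" using eq by (simp add: val)
    then have "g x = g y" using inj_onD[OF \<eta> _ cl(1) cl(1)] xy by blast
    then show "v = w" using inj_onD[OF inj] xy by blast
  qed
  then obtain h where h: "h \<in> mod_hom A ?N I" "compose (carrier ?M) h g' = f'"
    using I transport_fd_module[OF M \<theta>] transport_fd_module[OF N \<eta>] g' f'
    unfolding injective_module_def by blast
  have hl: "mod_lin A ?N I h" using h by (simp add: mod_hom_iff)
  have "h (\<eta> (g x)) = f x" if x: "x \<in> carrier M" for x
    using fun_cong[OF h(2), of "\<theta> x"] x val[OF x] by (simp add: compose_def)
  moreover have "mod_lin A N I (\<lambda>x. h (\<eta> x))"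
    using mod_lin_closed[OF hl] mod_lin_add[OF hl] mod_lin_smult[OF hl]
    by (intro mod_linI) (auto simp flip: transport_sel(3,4)[OF \<eta>])
  ultimately show ?thesis by blast
qed

end

section \<open>Selfinjectivity in terms of the trace\<close>

lemma (in abelian_group) finsum_Times:
  assumes "finite I" "finite J" "\<And>i j. i \<in> I \<Longrightarrow> j \<in> J \<Longrightarrow> g i j \<in> carrier G"
  shows "(\<Oplus>p\<in>I \<times> J. g (fst p) (snd p)) = (\<Oplus>i\<in>I. \<Oplus>j\<in>J. g i j)"
  using assms(1,3)
proof (induction I rule: finite_induct)
  case (insert i I)
  have "(\<Oplus>p\<in>{i} \<times> J. g (fst p) (snd p)) = (\<Oplus>p\<in>Pair i ` J. g (fst p) (snd p))"
    by (rule arg_cong[where f = "finsum G _"]) auto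
  also have "\<dots> = (\<Oplus>j\<in>J. g (fst (i, j)) (snd (i, j)))"
    using insert.prems by (intro finsum_reindex) (auto simp: inj_on_def)
  finally have row: "(\<Oplus>p\<in>{i} \<times> J. g (fst p) (snd p)) = (\<Oplus>j\<in>J. g i j)" by simp
  have "insert i I \<times> J = {i} \<times> J \<union> I \<times> J" by auto
  also have "(\<Oplus>p\<in>{i} \<times> J \<union> I \<times> J. g (fst p) (snd p)) =
      (\<Oplus>p\<in>{i} \<times> J. g (fst p) (snd p)) \<oplus> (\<Oplus>p\<in>I \<times> J. g (fst p) (snd p))"
    using insert assms(2) by (intro finsum_Un_disjoint) auto
  finally show ?case
    using insert by (simp add: row finsum_closed Pi_iff)
qed simp

text \<open>Plays the part of a finite power of \<open>D A\<close>: a basis of the target identifies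
  it with tuples of linear forms, and \<open>a\<close> acts on each of them as in
  \<open>coreg\<close>.\<close>

definition endo_module :: "'k ring \<Rightarrow> ('k, 'a) module \<Rightarrow> ('a, 'a \<Rightarrow> 'a) module" where
  "endo_module K A =
     \<lparr>carrier = mod_hom K A A, monoid.mult = undefined, one = undefined,
      zero = (\<lambda>x\<in>carrier A. \<zero>\<^bsub>A\<^esub>), add = (\<lambda>f g. \<lambda>x\<in>carrier A. f x \<oplus>\<^bsub>A\<^esub> g x),
      smult = (\<lambda>a f. \<lambda>x\<in>carrier A. f (x \<otimes>\<^bsub>A\<^esub> a))\<rparr>"

lemma endo_module_sel:
  "f \<in> carrier (endo_module K A) \<longleftrightarrow> mod_lin K A A f \<and> f \<in> extensional (carrier A)"
  "\<zero>\<^bsub>endo_module K A\<^esub> = (\<lambda>x\<in>carrier A. \<zero>\<^bsub>A\<^esub>)"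
  "f \<oplus>\<^bsub>endo_module K A\<^esub> g = (\<lambda>x\<in>carrier A. f x \<oplus>\<^bsub>A\<^esub> g x)"
  "a \<odot>\<^bsub>endo_module K A\<^esub> f = (\<lambda>x\<in>carrier A. f (x \<otimes>\<^bsub>A\<^esub> a))"
  by (simp_all add: endo_module_def mod_hom_iff)

context kalg begin

lemma endo_left_module: "left_module A (endo_module K A)"
  by (rule coinduced_left_module[OF vs.vspace_axioms]) (simp_all add: endo_module_sel)

text \<open>With \<open>a\<close> fixed, \<open>\<phi> \<mapsto> \<phi>(-) a\<close> sends
  \<open>D A\<close> into \<open>endo_module\<close>, like a coordinate inclusion into the
  power.\<close>

lemma rank_one_endo:
  assumes \<phi>: "form K A \<phi>" and a: "a \<in> carrier A"
  shows "(\<lambda>x\<in>carrier A. \<phi> x \<odot> a) \<in> carrier (endo_module K A)"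
proof -
  note cl = form_closed[OF \<phi>]
  have "mod_lin K A A (\<lambda>x. \<phi> x \<odot> a)"
    using a cl by (intro mod_linI) (auto simp: form_add[OF \<phi>] form_smult[OF \<phi>] AM.smult_l_distr AM.smult_assoc1)
  then show ?thesis by (auto simp: endo_module_sel mod_lin_def)
qed

text \<open>Matrix entries: \<open>f\<close> is the sum of the maps
  \<open>\<xi> i (-) \<odot> j\<close> with coefficients \<open>\<xi> j (f i)\<close>.\<close>

lemma endo_fin_dim:
  assumes "fin_dim K A"
  shows "fin_dim K (underlying_space A (endo_module K A))"
proof -
  let ?E = "underlying_space A (endo_module K A)"
  interpret lE: left_module A "endo_module K A" by (rule endo_left_module)
  interpret E: vspace K ?E by (rule underlying_vspace[OF endo_left_module])
  obtain B \<xi> where db: "dual_basis K A B (\<lambda>b. b) \<xi>" using vs.ex_dual_basis[OF assms] by blast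
  have B: "finite B" "\<And>b. b \<in> B \<Longrightarrow> b \<in> carrier A" "\<And>b. b \<in> B \<Longrightarrow> form K A (\<xi> b)"
    "\<And>v. v \<in> carrier A \<Longrightarrow> (\<Oplus>b\<in>B. \<xi> b v \<odot> b) = v"
    using db by (auto simp: dual_basis_def)
  note \<xi>c = form_closed[OF B(3)]
  define e where "e p = (\<lambda>x\<in>carrier A. \<xi> (fst p) x \<odot> snd p)" for p
  have e: "e p \<in> carrier (endo_module K A)" if "p \<in> B \<times> B" for p
    unfolding e_def using that B by (intro rank_one_endo) auto
  show ?thesis
  proof (rule E.fin_dim_family[of "B \<times> B" e])
    show "finite (B \<times> B)" using B by simp
    show eE: "e \<in> B \<times> B \<rightarrow> carrier ?E" using e by auto
    fix f assume "f \<in> carrier ?E"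
    then have f: "mod_lin K A A f" "f \<in> extensional (carrier A)" by (auto simp: endo_module_sel)
    have fc: "f x \<in> carrier A" if "x \<in> carrier A" for x using mod_lin_closed[OF f(1) that] .
    define c where "c p = \<xi> (snd p) (f (fst p))" for p
    have c: "c \<in> B \<times> B \<rightarrow> carrier K" using B fc \<xi>c by (auto simp: c_def)
    have sumE: "(\<Oplus>\<^bsub>?E\<^esub>p\<in>B \<times> B. c p \<odot>\<^bsub>?E\<^esub> e p) \<in> carrier ?E" by (rule E.comb_closed[OF c eE])
    have "(\<Oplus>\<^bsub>?E\<^esub>p\<in>B \<times> B. c p \<odot>\<^bsub>?E\<^esub> e p) x = f x" if x: "x \<in> carrier A" for x
    proof -
      have 1: "(\<Oplus>\<^bsub>?E\<^esub>p\<in>B \<times> B. c p \<odot>\<^bsub>?E\<^esub> e p) x = (\<Oplus>p\<in>B \<times> B. (c p \<odot>\<^bsub>?E\<^esub> e p) x)"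
      proof (rule additive_finsum[where f = "\<lambda>f. f x", OF E.V.M.abelian_group_axioms A.abelian_group_axioms])
        show "(\<lambda>p. c p \<odot>\<^bsub>?E\<^esub> e p) \<in> B \<times> B \<rightarrow> carrier ?E"
          using c eE E.V.smult_closed by (auto simp: Pi_iff simp del: underlying_sel(4))
      qed (use x mod_lin_closed in \<open>auto simp: endo_module_sel\<close>)
      also have "\<dots> = (\<Oplus>p\<in>B \<times> B. \<xi> (fst p) x \<odot> (\<xi> (snd p) (f (fst p)) \<odot> snd p))"
      proof (rule A.finsum_cong'[OF refl])
        show "(\<lambda>p. \<xi> (fst p) x \<odot> (\<xi> (snd p) (f (fst p)) \<odot> snd p)) \<in> B \<times> B \<rightarrow> carrier A"
          using x B fc \<xi>c by auto
        fix p assume p: "p \<in> B \<times> B"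
        then obtain i j where ij: "p = (i, j)" "i \<in> B" "j \<in> B" by auto
        have cp: "c p \<in> carrier K" using c p by auto
        note k = \<xi>c[OF ij(2) x] \<xi>c[OF ij(3) fc[OF B(2)[OF ij(2)]]]
        have "(c p \<odot>\<^bsub>?E\<^esub> e p) x = \<xi> i (c p \<odot> x) \<odot> j"
          using x cp ij by (simp add: endo_module_sel e_def smult_mult)
        also have "\<dots> = \<xi> i x \<odot> (c p \<odot> j)"
          using x cp ij k B(2)[OF ij(3)] by (simp add: form_smult[OF B(3)] K.m_comm AM.smult_assoc1[symmetric])
        finally show "(c p \<odot>\<^bsub>?E\<^esub> e p) x = \<xi> (fst p) x \<odot> (\<xi> (snd p) (f (fst p)) \<odot> snd p)"
          by (simp add: ij c_def)
      qed
      also have "\<dots> = (\<Oplus>i\<in>B. \<Oplus>j\<in>B. \<xi> i x \<odot> (\<xi> j (f i) \<odot> j))"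
        using B fc \<xi>c x by (intro A.finsum_Times[where g = "\<lambda>i j. \<xi> i x \<odot> (\<xi> j (f i) \<odot> j)"]) auto
      also have "\<dots> = (\<Oplus>i\<in>B. \<xi> i x \<odot> f i)"
      proof (rule A.finsum_cong'[OF refl])
        fix i assume i: "i \<in> B"
        have "(\<Oplus>j\<in>B. \<xi> i x \<odot> (\<xi> j (f i) \<odot> j)) = \<xi> i x \<odot> (\<Oplus>j\<in>B. \<xi> j (f i) \<odot> j)"
          using i B fc \<xi>c x by (intro AM.finsum_smult_ldistr[symmetric]) auto
        then show "(\<Oplus>j\<in>B. \<xi> i x \<odot> (\<xi> j (f i) \<odot> j)) = \<xi> i x \<odot> f i"
          using B(4)[OF fc[OF B(2)[OF i]]] by simp
      qed (use B fc \<xi>c x in auto)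
      also have "\<dots> = (\<Oplus>i\<in>B. f (\<xi> i x \<odot> i))"
        using B fc \<xi>c x mod_lin_smult[OF f(1)] by (intro A.finsum_cong') auto
      also have "\<dots> = f (\<Oplus>i\<in>B. \<xi> i x \<odot> i)"
        using B \<xi>c x fc mod_lin_add[OF f(1)]
        by (intro additive_finsum[symmetric] A.abelian_group_axioms) auto
      also have "\<dots> = f x" using B(4)[OF x] by simp
      finally show ?thesis .
    qed
    then have "f = (\<Oplus>\<^bsub>?E\<^esub>p\<in>B \<times> B. c p \<odot>\<^bsub>?E\<^esub> e p)"
      using f(2) sumE by (intro extensionalityI[of _ "carrier A"]) (auto simp: endo_module_sel)
    with c show "\<exists>c\<in>B \<times> B \<rightarrow> carrier K. f = (\<Oplus>\<^bsub>?E\<^esub>p\<in>B \<times> B. c p \<odot>\<^bsub>?E\<^esub> e p)" by blast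
  qed
qed

lemma coreg_trace_finsum:
  assumes "finite B" "\<And>b. b \<in> B \<Longrightarrow> mod_lin A (coreg K A) (regular_module A) (G b)"
    "\<And>b. b \<in> B \<Longrightarrow> \<phi> b \<in> carrier (coreg K A)"
  shows "(\<Oplus>b\<in>B. G b (\<phi> b)) \<in> coreg_trace K A"
  using assms
proof (induction B rule: finite_induct)
  case empty
  show ?case using coreg_trace.zero by simp
next
  case (insert b B)
  have cl: "(\<lambda>b. G b (\<phi> b)) \<in> insert b B \<rightarrow> carrier A" using hom_closed insert.prems by blast
  have "(\<Oplus>b\<in>B. G b (\<phi> b)) \<oplus> G b (\<phi> b) \<in> coreg_trace K A"
    using insert by (intro coreg_trace.add) auto
  moreover have "(\<Oplus>b\<in>insert b B. G b (\<phi> b)) = (\<Oplus>b\<in>B. G b (\<phi> b)) \<oplus> G b (\<phi> b)"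
    using insert.hyps cl by (simp add: A.a_comm)
  ultimately show ?case by simp
qed

end

lemma (in fd_alg) selfinjective_imp_trace:
  assumes si: "selfinjective K A"
  shows "\<one> \<in> coreg_trace K A"
proof -
  let ?E = "endo_module K A" and ?R = "regular_module A"
  interpret E: left_module A ?E by (rule endo_left_module)
  have lR: "left_module A ?R"
  proof -
    have "abelian_group ?R"
      by (rule abelian_groupI) (auto simp: A.a_ac intro: A.add.l_inv_ex)
    then show ?thesis
      by (intro left_module.intro A.ring_axioms left_module_axioms.intro)
         (auto simp: A.l_distr A.r_distr A.m_assoc)
  qed
  have fR: "fd_module K A ?R"
  proof -
    interpret R: vspace K "underlying_space A ?R" by (rule underlying_vspace[OF lR])
    obtain B \<xi> where db: "dual_basis K A B (\<lambda>b. b) \<xi>" using vs.ex_dual_basis[OF fin_dim] by blast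
    have B: "finite B" "\<And>b. b \<in> B \<Longrightarrow> b \<in> carrier A" "\<And>b. b \<in> B \<Longrightarrow> form K A (\<xi> b)"
      "\<And>v. v \<in> carrier A \<Longrightarrow> (\<Oplus>b\<in>B. \<xi> b v \<odot> b) = v"
      using db by (auto simp: dual_basis_def)
    \<comment> \<open>Finite sums depend only on the additive monoid, which both records
      share.\<close>
    have am: "add_monoid (underlying_space A ?R) = add_monoid A" by (simp add: underlying_space_def)
    have "fin_dim K (underlying_space A ?R)"
    proof (rule R.fin_dim_family[OF B(1), of "\<lambda>b. b"])
      fix v assume "v \<in> carrier (underlying_space A ?R)"
      then have v: "v \<in> carrier A" by simp
      have "(\<Oplus>\<^bsub>underlying_space A ?R\<^esub>b\<in>B. \<xi> b v \<odot>\<^bsub>underlying_space A ?R\<^esub> b) =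
          (\<Oplus>b\<in>B. \<xi> b v \<odot>\<^bsub>underlying_space A ?R\<^esub> b)"
        by (simp only: finsum_def am)
      also have "\<dots> = (\<Oplus>b\<in>B. \<xi> b v \<odot> b)"
        using B v form_closed[OF B(3) v] by (intro A.finsum_cong') (auto simp: smult_mult)
      finally show "\<exists>c\<in>B \<rightarrow> carrier K. v = (\<Oplus>\<^bsub>underlying_space A ?R\<^esub>b\<in>B. c b \<odot>\<^bsub>underlying_space A ?R\<^esub> b)"
        using B(4)[OF v] form_closed[OF B(3) v] by (intro bexI[of _ "\<lambda>b. \<xi> b v"]) auto
    qed (use B in auto)
    with lR show ?thesis by (simp add: fd_module_def)
  qed
  have fE: "fd_module K A ?E"
    using endo_left_module endo_fin_dim[OF fin_dim] by (simp add: fd_module_def)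
  \<comment> \<open>Right multiplications are left linear in \<open>a\<close> for the action on
    \<open>endo_module\<close>, and evaluation at \<open>1\<close> recovers
    \<open>a\<close>.\<close>
  define g where "g a = (\<lambda>x\<in>carrier A. x \<otimes> a)" for a
  have gE: "g a \<in> carrier ?E" if "a \<in> carrier A" for a
    using that by (auto simp: g_def endo_module_sel mod_lin_def A.l_distr smult_mult)
  have g: "mod_lin A ?R ?E g"
  proof (rule mod_linI)
    fix a assume a: "a \<in> carrier ?R"
    then show "g a \<in> carrier ?E" using gE by simp
    { fix b assume "b \<in> carrier ?R"
      with a show "g (a \<oplus>\<^bsub>?R\<^esub> b) = g a \<oplus>\<^bsub>?E\<^esub> g b"
        by (auto simp: g_def endo_module_sel fun_eq_iff A.r_distr) }
    { fix b assume "b \<in> carrier A"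
      with a show "g (b \<odot>\<^bsub>?R\<^esub> a) = b \<odot>\<^bsub>?E\<^esub> g a"
        by (auto simp: g_def endo_module_sel fun_eq_iff A.m_assoc) }
  qed
  have inj: "inj_on g (carrier ?R)"
  proof (rule inj_onI)
    fix a b assume ab: "a \<in> carrier ?R" "b \<in> carrier ?R" "g a = g b"
    from fun_cong[OF ab(3), of "\<one>"] ab(1,2) show "a = b" by (simp add: g_def)
  qed
  \<comment> \<open>Injectivity of the regular module extends its identity along \<open>g\<close> to
    a retraction.\<close>
  obtain r where r: "mod_lin A ?E ?R r" and rg: "\<And>a. a \<in> carrier A \<Longrightarrow> r (g a) = a"
    using injective_extend[OF si[unfolded selfinjective_def] fR fE g inj, of "\<lambda>x. x"]
    by (auto simp: mod_lin_def)
  obtain B \<xi> where db: "dual_basis K A B (\<lambda>b. b) \<xi>" using vs.ex_dual_basis[OF fin_dim] by blast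
  have B: "finite B" "\<And>b. b \<in> B \<Longrightarrow> b \<in> carrier A" "\<And>b. b \<in> B \<Longrightarrow> form K A (\<xi> b)"
    "\<And>v. v \<in> carrier A \<Longrightarrow> (\<Oplus>b\<in>B. \<xi> b v \<odot> b) = v"
    using db by (auto simp: dual_basis_def)
  \<comment> \<open>The retraction \<open>r\<close> on the copy of \<open>D A\<close> that belongs
    to the basis element \<open>b\<close>.\<close>
  define G where "G b \<psi> = r (\<lambda>x\<in>carrier A. \<psi> x \<odot> b)" for b \<psi>
  have G: "mod_lin A (coreg K A) ?R (G b)" if b: "b \<in> B" for b
  proof (rule mod_linI)
    fix \<psi> assume \<psi>: "\<psi> \<in> carrier (coreg K A)"
    note \<psi>E = rank_one_endo[OF coregD(4)[OF \<psi>] B(2)[OF b]]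
    show "G b \<psi> \<in> carrier ?R" unfolding G_def by (rule mod_lin_closed[OF r \<psi>E])
    { fix \<chi> assume \<chi>: "\<chi> \<in> carrier (coreg K A)"
      note \<chi>E = rank_one_endo[OF coregD(4)[OF \<chi>] B(2)[OF b]]
      have "(\<lambda>x\<in>carrier A. (\<psi> \<oplus>\<^bsub>coreg K A\<^esub> \<chi>) x \<odot> b) =
          (\<lambda>x\<in>carrier A. \<psi> x \<odot> b) \<oplus>\<^bsub>?E\<^esub> (\<lambda>x\<in>carrier A. \<chi> x \<odot> b)"
        using B(2)[OF b] coregD(1)[OF \<psi>] coregD(1)[OF \<chi>]
        by (auto simp: coreg_sel endo_module_sel fun_eq_iff AM.smult_l_distr)
      then show "G b (\<psi> \<oplus>\<^bsub>coreg K A\<^esub> \<chi>) = G b \<psi> \<oplus>\<^bsub>?R\<^esub> G b \<chi>"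
        using mod_lin_add[OF r \<psi>E \<chi>E] by (simp add: G_def) }
    { fix a assume a: "a \<in> carrier A"
      have "(\<lambda>x\<in>carrier A. (a \<odot>\<^bsub>coreg K A\<^esub> \<psi>) x \<odot> b) = a \<odot>\<^bsub>?E\<^esub> (\<lambda>x\<in>carrier A. \<psi> x \<odot> b)"
        using a by (auto simp: coreg_sel endo_module_sel fun_eq_iff)
      then show "G b (a \<odot>\<^bsub>coreg K A\<^esub> \<psi>) = a \<odot>\<^bsub>?R\<^esub> G b \<psi>"
        using mod_lin_smult[OF r a \<psi>E] by (simp add: G_def) }
  qed
  have \<xi>': "restrict (\<xi> b) (carrier A) \<in> carrier (coreg K A)" if "b \<in> B" for b
    using B(3)[OF that] by (intro coregI) (auto simp: form_closed form_add form_smult)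
  have E: "(\<lambda>x\<in>carrier A. \<xi> b x \<odot> b) \<in> carrier ?E" if "b \<in> B" for b
    using rank_one_endo[OF B(3) B(2)] that by blast
  have "(\<Oplus>\<^bsub>?E\<^esub>b\<in>B. (\<lambda>x\<in>carrier A. \<xi> b x \<odot> b)) = g \<one>"
  proof (rule extensionalityI[of _ "carrier A"])
    have "(\<Oplus>\<^bsub>?E\<^esub>b\<in>B. (\<lambda>x\<in>carrier A. \<xi> b x \<odot> b)) \<in> carrier ?E"
      using E by (intro E.M.finsum_closed) auto
    then show "(\<Oplus>\<^bsub>?E\<^esub>b\<in>B. (\<lambda>x\<in>carrier A. \<xi> b x \<odot> b)) \<in> extensional (carrier A)"
      by (simp add: endo_module_sel)
    fix x assume x: "x \<in> carrier A"
    have "(\<Oplus>\<^bsub>?E\<^esub>b\<in>B. (\<lambda>x\<in>carrier A. \<xi> b x \<odot> b)) x = (\<Oplus>b\<in>B. (\<lambda>x\<in>carrier A. \<xi> b x \<odot> b) x)"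
      using E x mod_lin_closed
      by (intro additive_finsum[where f = "\<lambda>f. f x"] E.M.abelian_group_axioms A.abelian_group_axioms)
         (auto simp: endo_module_sel)
    then show "(\<Oplus>\<^bsub>?E\<^esub>b\<in>B. (\<lambda>x\<in>carrier A. \<xi> b x \<odot> b)) x = g \<one> x"
      using x B(4)[OF x] by (simp add: g_def)
  qed (simp add: g_def)
  \<comment> \<open>The identity of \<open>A\<close> is \<open>g 1\<close> and also the sum of its
    rank one parts, so \<open>r\<close> writes \<open>1\<close> as the sum of the values of
    \<open>G b\<close> at the coordinate forms.\<close>
  then have "\<one> = r (\<Oplus>\<^bsub>?E\<^esub>b\<in>B. (\<lambda>x\<in>carrier A. \<xi> b x \<odot> b))" using rg by simp
  also have "\<dots> = (\<Oplus>b\<in>B. r (\<lambda>x\<in>carrier A. \<xi> b x \<odot> b))"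
    using E mod_lin_closed[OF r] mod_lin_add[OF r]
    by (intro additive_finsum[where f = r] E.M.abelian_group_axioms A.abelian_group_axioms) auto
  also have "\<dots> = (\<Oplus>b\<in>B. G b (restrict (\<xi> b) (carrier A)))"
    by (simp add: G_def cong: restrict_cong)
  also have "\<dots> \<in> coreg_trace K A" using B(1) G \<xi>' by (rule coreg_trace_finsum)
  finally show ?thesis .
qed

section \<open>Extension of homomorphisms under the trace condition\<close>

context kalg begin

text \<open>For one summand \<open>G \<phi>\<close> of \<open>c\<close>: the form
  \<open>\<phi>(f(-))\<close> vanishes on the kernel of \<open>g\<close>, hence equals
  \<open>\<Psi>(g(-))\<close> for a form \<open>\<Psi>\<close> on \<open>N\<close>. The map
  \<open>\<psi> : N \<rightarrow> D A\<close> belonging to \<open>\<Psi>\<close> satisfies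
  \<open>\<psi>(g x) = f(x) \<phi>\<close>, and \<open>G\<close> turns this into
  \<open>f(x) G(\<phi>)\<close>.\<close>

lemma trace_extension:
  assumes M: "left_module A M" and N: "fd_module K A N"
    and f: "mod_lin A M (regular_module A) f" and g: "mod_lin A M N g"
    and ker: "\<And>x. x \<in> carrier M \<Longrightarrow> g x = \<zero>\<^bsub>N\<^esub> \<Longrightarrow> f x = \<zero>"
    and c: "c \<in> coreg_trace K A"
  shows "\<exists>h. mod_lin A N (regular_module A) h \<and> (\<forall>x\<in>carrier M. h (g x) = f x \<otimes> c)"
  using c
proof (induction rule: coreg_trace.induct)
  case zero
  have "mod_lin A N (regular_module A) (\<lambda>x. \<zero>)" by (intro mod_linI) auto
  then show ?case using mod_lin_closed[OF f] by (intro exI[of _ "\<lambda>x. \<zero>"]) auto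
next
  case (add c G \<phi>)
  note G = add.hyps(2) and \<phi> = add.hyps(3)
  obtain h where h: "mod_lin A N (regular_module A) h" "\<And>x. x \<in> carrier M \<Longrightarrow> h (g x) = f x \<otimes> c"
    using add.IH by blast
  have lN: "left_module A N" and fN: "fin_dim K (underlying_space A N)" using N by (auto simp: fd_module_def)
  interpret M: left_module A M by (rule M)
  interpret N: left_module A N by (rule lN)
  interpret uM: vspace K "underlying_space A M" by (rule underlying_vspace[OF M])
  interpret uN: vspace K "underlying_space A N" by (rule underlying_vspace[OF lN])
  obtain B \<xi> where db: "dual_basis K (underlying_space A N) B (\<lambda>b. b) \<xi>" using uN.ex_dual_basis[OF fN] by blast
  have B: "finite B" "\<And>b. b \<in> B \<Longrightarrow> form K (underlying_space A N) (\<xi> b)"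
    using db by (auto simp: dual_basis_def)
  have fc: "f x \<in> carrier A" and gc: "g x \<in> carrier N" if "x \<in> carrier M" for x
    using mod_lin_closed[OF f that] mod_lin_closed[OF g that] by auto
  note gu = mod_lin_underlying[OF g]
  \<comment> \<open>Coordinates on \<open>N\<close>, pulled back along \<open>g\<close>, have the
    kernel of \<open>g\<close> as common kernel. The resulting combination makes sense on all of
    \<open>N\<close>, which is the extension.\<close>
  have "\<exists>d\<in>B \<rightarrow> carrier K. \<forall>x\<in>carrier (underlying_space A M). \<phi> (f x) = (\<Oplus>\<^bsub>K\<^esub>b\<in>B. d b \<otimes>\<^bsub>K\<^esub> \<xi> b (g x))"
  proof (rule uM.form_in_span[where \<xi> = "\<lambda>b x. \<xi> b (g x)", OF B(1)])
    show "form K (underlying_space A M) (\<lambda>x. \<xi> b (g x))" if "b \<in> B" for b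
      using mod_lin_closed[OF gu] mod_lin_add[OF gu] mod_lin_smult[OF gu]
        form_closed[OF B(2)[OF that]] form_add[OF B(2)[OF that]] form_smult[OF B(2)[OF that]]
      by (intro mod_linI) (simp_all del: underlying_sel(4))
    show "form K (underlying_space A M) (\<lambda>x. \<phi> (f x))"
      using fc mod_lin_add[OF f] mod_lin_smult[OF f] coregD[OF \<phi>]
      by (intro mod_linI) (auto simp: smult_mult)
    fix x assume x: "x \<in> carrier (underlying_space A M)" and 0: "\<And>b. b \<in> B \<Longrightarrow> \<xi> b (g x) = \<zero>\<^bsub>K\<^esub>"
    have "g x = \<zero>\<^bsub>N\<^esub>"
    proof (rule uN.dual_basis_separates[OF db])
      show "\<xi> b (g x) = \<xi> b \<zero>\<^bsub>N\<^esub>" if "b \<in> B" for b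
        using 0[OF that] uN.form_zero[OF B(2)[OF that]] by simp
    qed (use x gc in auto)
    then have "f x = \<zero>" using ker x by simp
    then show "\<phi> (f x) = \<zero>\<^bsub>K\<^esub>" using vs.form_zero[OF coregD(4)[OF \<phi>]] by simp
  qed
  then obtain d where d: "d \<in> B \<rightarrow> carrier K"
    "\<And>x. x \<in> carrier M \<Longrightarrow> \<phi> (f x) = (\<Oplus>\<^bsub>K\<^esub>b\<in>B. d b \<otimes>\<^bsub>K\<^esub> \<xi> b (g x))" by auto
  define \<Psi> where "\<Psi> y = (\<Oplus>\<^bsub>K\<^esub>b\<in>B. d b \<otimes>\<^bsub>K\<^esub> \<xi> b y)" for y
  have \<Psi>: "form K (underlying_space A N) \<Psi>"
    unfolding \<Psi>_def using B d(1) by (intro uN.form_combination)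
  have \<Psi>f: "\<Psi> (g x) = \<phi> (f x)" if "x \<in> carrier M" for x using d(2)[OF that] by (simp add: \<Psi>_def)
  \<comment> \<open>The correspondence between linear forms on \<open>N\<close> and left linear maps
    from \<open>N\<close> to \<open>D A\<close>.\<close>
  define \<psi> where "\<psi> y = (\<lambda>a\<in>carrier A. \<Psi> (a \<odot>\<^bsub>N\<^esub> y))" for y
  have \<psi>: "\<psi> y \<in> carrier (coreg K A)" if y: "y \<in> carrier N" for y
  proof -
    have "\<Psi> ((c \<odot> a) \<odot>\<^bsub>N\<^esub> y) = c \<otimes>\<^bsub>K\<^esub> \<Psi> (a \<odot>\<^bsub>N\<^esub> y)" if "c \<in> carrier K" "a \<in> carrier A" for c a
    proof -
      have "(c \<odot> a) \<odot>\<^bsub>N\<^esub> y = (c \<odot> \<one>) \<odot>\<^bsub>N\<^esub> (a \<odot>\<^bsub>N\<^esub> y)"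
        using that y N.smult_assoc1[of "c \<odot> \<one>" a y] by (simp add: smult_mult)
      then show ?thesis using form_smult[OF \<Psi> that(1), of "a \<odot>\<^bsub>N\<^esub> y"] that y N.smult_closed by simp
    qed
    then show ?thesis
      unfolding \<psi>_def using y form_closed[OF \<Psi>] form_add[OF \<Psi>]
      by (intro coregI) (auto simp: N.smult_closed N.smult_l_distr)
  qed
  have \<psi>_lin: "mod_lin A N (coreg K A) \<psi>"
  proof (rule mod_linI)
    fix y assume y: "y \<in> carrier N"
    show "\<psi> y \<in> carrier (coreg K A)" by (rule \<psi>[OF y])
    { fix z assume z: "z \<in> carrier N"
      show "\<psi> (y \<oplus>\<^bsub>N\<^esub> z) = \<psi> y \<oplus>\<^bsub>coreg K A\<^esub> \<psi> z"
        using y z form_add[OF \<Psi>]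
        by (auto simp: \<psi>_def coreg_sel fun_eq_iff N.smult_closed N.smult_r_distr) }
    { fix a assume a: "a \<in> carrier A"
      show "\<psi> (a \<odot>\<^bsub>N\<^esub> y) = a \<odot>\<^bsub>coreg K A\<^esub> \<psi> y"
        using y a by (auto simp: \<psi>_def coreg_sel fun_eq_iff N.smult_assoc1) }
  qed
  have "mod_lin A N (regular_module A) (\<lambda>y. h y \<oplus> G (\<psi> y))"
    using mod_lin_closed[OF h(1)] mod_lin_add[OF h(1)] mod_lin_smult[OF h(1)] \<psi> hom_closed[OF G]
      mod_lin_add[OF \<psi>_lin] mod_lin_smult[OF \<psi>_lin] mod_lin_add[OF G] mod_lin_smult[OF G]
    by (intro mod_linI) (simp_all add: A.a_ac A.r_distr)
  moreover have "h (g x) \<oplus> G (\<psi> (g x)) = f x \<otimes> (c \<oplus> G \<phi>)" if x: "x \<in> carrier M" for x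
  proof -
    have "\<psi> (g x) = f x \<odot>\<^bsub>coreg K A\<^esub> \<phi>"
    proof -
      have "\<Psi> (a \<odot>\<^bsub>N\<^esub> g x) = \<phi> (a \<otimes> f x)" if "a \<in> carrier A" for a
        using \<Psi>f[of "a \<odot>\<^bsub>M\<^esub> x"] mod_lin_smult[OF g that x] mod_lin_smult[OF f that x] that x M.smult_closed
        by simp
      then show ?thesis by (auto simp: \<psi>_def coreg_sel fun_eq_iff)
    qed
    then show ?thesis
      using mod_lin_smult[OF G fc[OF x] \<phi>] h(2)[OF x] fc[OF x] hom_closed[OF G \<phi>] coreg_trace_closed[OF add.hyps(1)]
      by (simp add: A.r_distr)
  qed
  ultimately show ?case by blast
qed

lemma trace_factor:
  assumes one: "\<one> \<in> coreg_trace K A" and M: "left_module A M" and N: "fd_module K A N"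
    and f: "f \<in> mod_hom A M (regular_module A)" and g: "mod_lin A M N g"
    and ker: "\<And>x. x \<in> carrier M \<Longrightarrow> g x = \<zero>\<^bsub>N\<^esub> \<Longrightarrow> f x = \<zero>"
  shows "\<exists>h\<in>mod_hom A N (regular_module A). compose (carrier M) h g = f"
proof -
  have fl: "mod_lin A M (regular_module A) f" "f \<in> extensional (carrier M)" using f by (auto simp: mod_hom_iff)
  obtain h where h: "mod_lin A N (regular_module A) h" "\<And>x. x \<in> carrier M \<Longrightarrow> h (g x) = f x"
    using trace_extension[OF M N fl(1) g ker one] mod_lin_closed[OF fl(1)] by auto
  interpret N: left_module A N using N by (simp add: fd_module_def)
  have "restrict h (carrier N) \<in> mod_hom A N (regular_module A)"
    using h(1) N.smult_closed by (auto simp: mod_hom_iff mod_lin_def)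
  moreover have "compose (carrier M) (restrict h (carrier N)) g = f"
    using h(2) mod_lin_closed[OF g] by (intro extensionalityI[OF _ fl(2)]) (auto simp: compose_def)
  ultimately show ?thesis by blast
qed

theorem trace_imp_selfinjective:
  assumes one: "\<one> \<in> coreg_trace K A"
  shows "selfinjective K A"
  unfolding selfinjective_def injective_module_def
proof (intro allI impI ballI)
  fix M N :: "('a, nat \<Rightarrow> 'k) module" and g f
  assume M: "fd_module K A M" and N: "fd_module K A N" and g: "g \<in> mod_hom A M N"
    and f: "f \<in> mod_hom A M (regular_module A)" and inj: "inj_on g (carrier M)"
  have lM: "left_module A M" and lN: "left_module A N" using M N by (auto simp: fd_module_def)
  interpret M: left_module A M by (rule lM)
  interpret N: left_module A N by (rule lN)
  have gl: "mod_lin A M N g" and fl: "mod_lin A M (regular_module A) f" using f g by (auto simp: mod_hom_iff)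
  have g0: "g \<zero>\<^bsub>M\<^esub> = \<zero>\<^bsub>N\<^esub>"
    by (rule additive_zero[OF M.M.abelian_group_axioms N.M.abelian_group_axioms])
       (use mod_lin_closed[OF gl] mod_lin_add[OF gl] in auto)
  have f0: "f \<zero>\<^bsub>M\<^esub> = \<zero>"
    by (rule additive_zero[OF M.M.abelian_group_axioms A.abelian_group_axioms])
       (use mod_lin_closed[OF fl] mod_lin_add[OF fl] in auto)
  show "\<exists>h\<in>mod_hom A N (regular_module A). compose (carrier M) h g = f"
  proof (rule trace_factor[OF one lM N f gl])
    fix x assume x: "x \<in> carrier M" "g x = \<zero>\<^bsub>N\<^esub>"
    then have "x = \<zero>\<^bsub>M\<^esub>" using inj_onD[OF inj, of x "\<zero>\<^bsub>M\<^esub>"] g0 by simp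
    then show "f x = \<zero>" using f0 by simp
  qed
qed

end

section \<open>Exactness of the dual of a complex\<close>

text \<open>A window \<open>P (n + 1) \<rightarrow> P n \<rightarrow> P (n - 1)\<close> of a
  resolution, exact in the middle. The claims about Ext and about the translate in degree
  \<open>n\<close> concern only such a window.\<close>

locale exact_triple = kalg K A
  for K :: "'k ring" and A :: "('k, 'a) module" (structure) +
  fixes P2 P1 P0 :: "('a, 'p) module" and d2 d1
  assumes one: "\<one>\<^bsub>A\<^esub> \<in> coreg_trace K A"
    and fd: "fd_module K A P2" "fd_module K A P1" "fd_module K A P0"
    and d2: "d2 \<in> mod_hom A P2 P1" and d1: "d1 \<in> mod_hom A P1 P0"
    and exact: "d2 ` carrier P2 = a_kernel P1 P0 d1"
begin

sublocale P2: left_module A P2 using fd by (simp add: fd_module_def)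
sublocale P1: left_module A P1 using fd by (simp add: fd_module_def)
sublocale P0: left_module A P0 using fd by (simp add: fd_module_def)

lemma d1_lin: "mod_lin A P1 P0 d1" and d2_lin: "mod_lin A P2 P1 d2"
  using d1 d2 by (auto simp: mod_hom_iff)

lemma exact_iff: "x \<in> carrier P1 \<Longrightarrow> d1 x = \<zero>\<^bsub>P0\<^esub> \<longleftrightarrow> x \<in> d2 ` carrier P2"
  unfolding exact by (simp add: a_kernel_def')

lemma d1_d2: "x \<in> carrier P2 \<Longrightarrow> d1 (d2 x) = \<zero>\<^bsub>P0\<^esub>"
  using exact_iff[of "d2 x"] mod_lin_closed[OF d2_lin] by blast

text \<open>Exactness alone gives a factorisation over the image of \<open>d1\<close>; the trace
  condition extends it to all of \<open>P0\<close>.\<close>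

lemma hom_exact:
  assumes f: "f \<in> mod_hom A P1 (regular_module A)" and 0: "\<And>x. x \<in> carrier P2 \<Longrightarrow> f (d2 x) = \<zero>"
  shows "\<exists>h\<in>mod_hom A P0 (regular_module A). compose (carrier P1) h d1 = f"
proof (rule trace_factor[OF one P1.left_module_axioms fd(3) f d1_lin])
  fix x assume "x \<in> carrier P1" "d1 x = \<zero>\<^bsub>P0\<^esub>"
  then obtain y where "y \<in> carrier P2" "x = d2 y" using exact_iff by blast
  then show "f x = \<zero>" using 0 by simp
qed

lemma hom_complex:
  assumes h: "mod_lin A P0 (regular_module A) h" and x: "x \<in> carrier P2"
  shows "h (d1 (d2 x)) = \<zero>"
proof -
  have "h \<zero>\<^bsub>P0\<^esub> = \<zero>"
    by (rule additive_zero[OF P0.M.abelian_group_axioms A.abelian_group_axioms])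
       (use mod_lin_closed[OF h] mod_lin_add[OF h] in auto)
  then show ?thesis by (simp add: d1_d2[OF x])
qed

end

lemma (in kalg) star_left_module:
  assumes "left_module A M"
  shows "left_module (opposite A) (star A M)"
proof -
  interpret M: left_module A M by fact
  interpret S: abelian_group "star A M" by (rule star_abelian_group[OF A.ring_axioms assms])
  interpret op: kalg K "opposite A" by (rule opposite_kalg)
  show ?thesis
  proof (intro left_module.intro op.A.ring_axioms S.abelian_group_axioms left_module_axioms.intro)
    fix a b g assume a: "a \<in> carrier (opposite A)" and g: "g \<in> carrier (star A M)"
    show "a \<odot>\<^bsub>star A M\<^esub> g \<in> carrier (star A M)"
      using star_smult_closed[OF A.ring_axioms assms] a g by simp
    have gx: "\<And>x. x \<in> carrier M \<Longrightarrow> g x \<in> carrier A" using g by (simp add: star_iff)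
    { assume b: "b \<in> carrier (opposite A)"
      show "(a \<oplus>\<^bsub>opposite A\<^esub> b) \<odot>\<^bsub>star A M\<^esub> g = a \<odot>\<^bsub>star A M\<^esub> g \<oplus>\<^bsub>star A M\<^esub> b \<odot>\<^bsub>star A M\<^esub> g"
        using a b gx by (auto simp: star_sel fun_eq_iff A.r_distr)
      show "(a \<otimes>\<^bsub>opposite A\<^esub> b) \<odot>\<^bsub>star A M\<^esub> g = a \<odot>\<^bsub>star A M\<^esub> (b \<odot>\<^bsub>star A M\<^esub> g)"
        using a b gx by (auto simp: star_sel fun_eq_iff A.m_assoc) }
    { fix h assume h: "h \<in> carrier (star A M)"
      show "a \<odot>\<^bsub>star A M\<^esub> (g \<oplus>\<^bsub>star A M\<^esub> h) = a \<odot>\<^bsub>star A M\<^esub> g \<oplus>\<^bsub>star A M\<^esub> a \<odot>\<^bsub>star A M\<^esub> h"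
        using star_smult_add[OF A.ring_axioms assms _ g h] a by simp }
  next
    fix g assume g: "g \<in> carrier (star A M)"
    then have "\<And>x. x \<in> carrier M \<Longrightarrow> g x \<in> carrier A" "\<And>x. x \<notin> carrier M \<Longrightarrow> g x = undefined"
      by (simp_all add: star_iff)
    then show "\<one>\<^bsub>opposite A\<^esub> \<odot>\<^bsub>star A M\<^esub> g = g" by (auto simp: star_sel fun_eq_iff)
  qed
qed

section \<open>The Nakayama functor on an exact triple\<close>

context exact_triple begin

text \<open>A form on \<open>star A P1\<close> that kills the image of the star of \<open>d1\<close>
  kills the kernel of the star of \<open>d2\<close>, by \<open>hom_exact\<close>. It is therefore a
  combination of forms that factor through the star of \<open>d2\<close>, and so comes from a form
  on \<open>star A P2\<close>. The dual basis of \<open>A\<close> supplies enough forms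
  \<open>g \<mapsto> \<xi> j (g b)\<close>.\<close>

lemma nakayama_exact:
  assumes db: "dual_basis K A J e \<xi>"
  shows "a_kernel (nakayama K A P1) (nakayama K A P0) (nakayama_map K A P1 P0 d1) =
    nakayama_map K A P2 P1 d2 ` carrier (nakayama K A P2)"
proof -
  interpret op: kalg K "opposite A" by (rule opposite_kalg)
  let ?U = "\<lambda>P. underlying_space (opposite A) (star A P)"
  have lS: "left_module (opposite A) (star A P)" if "left_module A P" for P :: "('a, 'p) module"
    by (rule star_left_module[OF that])
  interpret U1: vspace K "?U P1" by (rule op.underlying_vspace[OF lS[OF P1.left_module_axioms]])
  interpret U2: vspace K "?U P2" by (rule op.underlying_vspace[OF lS[OF P2.left_module_axioms]])
  interpret uP2: vspace K "underlying_space A P2" by (rule underlying_vspace[OF P2.left_module_axioms])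
  have J: "finite J" "\<And>j. j \<in> J \<Longrightarrow> form K A (\<xi> j)" using db by (auto simp: dual_basis_def)
  have nak: "\<phi> \<in> carrier (nakayama K A P) \<longleftrightarrow> form K (?U P) \<phi> \<and> \<phi> \<in> extensional (carrier (star A P))" for P :: "('a, 'p) module" and \<phi>
    by (auto simp: nakayama_def dual_def mod_hom_iff)
  have map1: "nakayama_map K A P1 P0 d1 \<phi> = (\<lambda>g\<in>carrier (star A P0). \<phi> (star_map A P1 P0 d1 g))"
    if "\<phi> \<in> carrier (nakayama K A P1)" for \<phi>
    using that by (simp add: nakayama_map_def nakayama_def dual_map_def compose_def)
  have map2: "nakayama_map K A P2 P1 d2 \<phi> = (\<lambda>g\<in>carrier (star A P1). \<phi> (star_map A P2 P1 d2 g))"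
    if "\<phi> \<in> carrier (nakayama K A P2)" for \<phi>
    using that by (simp add: nakayama_map_def nakayama_def dual_map_def compose_def)
  have zero0: "\<zero>\<^bsub>nakayama K A P0\<^esub> = (\<lambda>g\<in>carrier (star A P0). \<zero>\<^bsub>K\<^esub>)"
    by (simp add: nakayama_def dual_def)
  have star_hom: "carrier (star A P) = mod_hom A P (regular_module A)" for P :: "('a, 'p) module"
    by (simp add: star_def)
  have s1: "star_map A P1 P0 d1 g \<in> carrier (star A P1)" "star_map A P1 P0 d1 g = compose (carrier P1) g d1"
    if "g \<in> carrier (star A P0)" for g
    using star_map_closed[OF A.ring_axioms P1.left_module_axioms P0.left_module_axioms d1 that] that
    by (simp_all add: star_map_def)
  have s2: "star_map A P2 P1 d2 g \<in> carrier (star A P2)" "star_map A P2 P1 d2 g = compose (carrier P2) g d2"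
    if "g \<in> carrier (star A P1)" for g
    using star_map_closed[OF A.ring_axioms P2.left_module_axioms P1.left_module_axioms d2 that] that
    by (simp_all add: star_map_def)
  have s2_lin: "mod_lin K (?U P1) (?U P2) (star_map A P2 P1 d2)"
    using s2(1) star_map_add[OF P2.left_module_axioms P1.left_module_axioms d2 _ _ A.ring_axioms]
      star_map_smult[OF P2.left_module_axioms P1.left_module_axioms d2 _ A.ring_axioms]
    by (intro mod_linI) auto
  have "nakayama_map K A P2 P1 d2 \<chi> \<in> a_kernel (nakayama K A P1) (nakayama K A P0) (nakayama_map K A P1 P0 d1)"
    if \<chi>: "\<chi> \<in> carrier (nakayama K A P2)" for \<chi>
  proof -
    have \<chi>f: "form K (?U P2) \<chi>" using \<chi> nak by blast
    have lin: "form K (?U P1) (\<lambda>g. \<chi> (star_map A P2 P1 d2 g))"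
      using mod_lin_closed[OF s2_lin] mod_lin_add[OF s2_lin] mod_lin_smult[OF s2_lin]
        form_closed[OF \<chi>f] form_add[OF \<chi>f] form_smult[OF \<chi>f]
      by (intro mod_linI) (simp_all del: op.underlying_sel(4))
    then have in1: "nakayama_map K A P2 P1 d2 \<chi> \<in> carrier (nakayama K A P1)"
      unfolding nak map2[OF \<chi>] mod_lin_def
      using U1.V.M.a_closed U1.V.smult_closed by (simp add: Pi_iff del: op.underlying_sel(4))
    have "\<chi> (star_map A P2 P1 d2 (star_map A P1 P0 d1 g)) = \<zero>\<^bsub>K\<^esub>" if g: "g \<in> carrier (star A P0)" for g
    proof -
      have gl: "mod_lin A P0 (regular_module A) g" using g unfolding star_hom mod_hom_iff by blast
      have "star_map A P2 P1 d2 (star_map A P1 P0 d1 g) = \<zero>\<^bsub>star A P2\<^esub>"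
        unfolding s2(2)[OF s1(1)[OF g]] star_sel unfolding s1(2)[OF g]
        using hom_complex[OF gl] mod_lin_closed[OF d2_lin] by (auto simp: compose_def fun_eq_iff)
      then show ?thesis using U2.form_zero[OF \<chi>f] by simp
    qed
    then have "nakayama_map K A P1 P0 d1 (nakayama_map K A P2 P1 d2 \<chi>) = \<zero>\<^bsub>nakayama K A P0\<^esub>"
      unfolding map1[OF in1] zero0 by (intro restrict_ext) (simp add: map2[OF \<chi>] s1(1))
    then show ?thesis using in1 by (simp add: a_kernel_def')
  qed
  moreover have "\<phi> \<in> nakayama_map K A P2 P1 d2 ` carrier (nakayama K A P2)"
    if \<phi>k: "\<phi> \<in> a_kernel (nakayama K A P1) (nakayama K A P0) (nakayama_map K A P1 P0 d1)" for \<phi>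
  proof -
    have \<phi>: "\<phi> \<in> carrier (nakayama K A P1)" "nakayama_map K A P1 P0 d1 \<phi> = \<zero>\<^bsub>nakayama K A P0\<^esub>"
      using \<phi>k by (auto simp: a_kernel_def')
    have \<phi>f: "form K (?U P1) \<phi>" and \<phi>e: "\<phi> \<in> extensional (carrier (star A P1))" using \<phi>(1) nak by auto
    have \<phi>0: "\<phi> (star_map A P1 P0 d1 h) = \<zero>\<^bsub>K\<^esub>" if "h \<in> carrier (star A P0)" for h
      using fun_cong[OF \<phi>(2), of h] that by (simp add: map1[OF \<phi>(1)] zero0)
    obtain B \<eta> where dbP: "dual_basis K (underlying_space A P2) B (\<lambda>b. b) \<eta>"
      using uP2.ex_dual_basis fd(1) by (auto simp: fd_module_def)
    have B: "finite B" "B \<subseteq> carrier P2" using dbP by (auto simp: dual_basis_def)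
    \<comment> \<open>Since \<open>B\<close> spans \<open>P2\<close> and the \<open>\<xi> j\<close>
      separate points of \<open>A\<close>, these finitely many forms separate points of
      \<open>star A P2\<close>.\<close>
    have ev: "form K (?U P2) (\<lambda>g. \<xi> (fst p) (g (snd p)))" if p: "p \<in> J \<times> B" for p
    proof -
      have "fst p \<in> J" and b: "snd p \<in> carrier P2" using p B by auto
      note \<xi> = J(2)[OF this(1)]
      have gc: "g (snd p) \<in> carrier A" if "g \<in> carrier (star A P2)" for g
        using that b by (simp add: star_iff)
      show ?thesis
        using b gc form_closed[OF \<xi>] form_add[OF \<xi>] form_smult[OF \<xi>]
        by (intro mod_linI) (auto simp: star_sel smult_mult)
    qed
    have "\<exists>c\<in>J \<times> B \<rightarrow> carrier K. \<forall>g\<in>carrier (?U P1). \<phi> g =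
        (\<Oplus>\<^bsub>K\<^esub>p\<in>J \<times> B. c p \<otimes>\<^bsub>K\<^esub> \<xi> (fst p) (star_map A P2 P1 d2 g (snd p)))"
    proof (rule U1.form_in_span[where \<xi> = "\<lambda>p g. \<xi> (fst p) (star_map A P2 P1 d2 g (snd p))"])
      show "finite (J \<times> B)" using J B by simp
      show "form K (?U P1) (\<lambda>g. \<xi> (fst p) (star_map A P2 P1 d2 g (snd p)))" if "p \<in> J \<times> B" for p
        using mod_lin_closed[OF s2_lin] mod_lin_add[OF s2_lin] mod_lin_smult[OF s2_lin]
          form_closed[OF ev[OF that]] form_add[OF ev[OF that]] form_smult[OF ev[OF that]]
        by (intro mod_linI) (simp_all del: op.underlying_sel(4))
      show "form K (?U P1) \<phi>" by (rule \<phi>f)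
      fix g assume "g \<in> carrier (?U P1)"
      then have g: "g \<in> carrier (star A P1)" by simp
      assume 0: "\<And>p. p \<in> J \<times> B \<Longrightarrow> \<xi> (fst p) (star_map A P2 P1 d2 g (snd p)) = \<zero>\<^bsub>K\<^esub>"
      define k where "k = star_map A P2 P1 d2 g"
      have kl: "mod_lin A P2 (regular_module A) k"
        using s2(1)[OF g] unfolding k_def star_hom mod_hom_iff by blast
      note kc = mod_lin_closed[OF kl]
      have kb: "k b = \<zero>" if b: "b \<in> B" for b
      proof (rule vs.dual_basis_separates[OF db])
        show "k b \<in> carrier A" using kc b B by auto
        show "\<xi> j (k b) = \<xi> j \<zero>" if "j \<in> J" for j
          using 0[of "(j, b)"] that b vs.form_zero[OF J(2)[OF that]] by (simp add: k_def)
      qed simp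
      have k0: "k x = \<zero>" if x: "x \<in> carrier P2" for x
      proof -
        have \<eta>x: "\<eta> b x \<in> carrier K" if "b \<in> B" for b
          using dbP x that form_closed[of K "underlying_space A P2" "\<eta> b" x] by (simp add: dual_basis_def)
        have "x = (\<Oplus>\<^bsub>underlying_space A P2\<^esub>b\<in>B. \<eta> b x \<odot>\<^bsub>underlying_space A P2\<^esub> b)"
          using dbP x by (simp add: dual_basis_def)
        then have "k x = k (\<Oplus>\<^bsub>underlying_space A P2\<^esub>b\<in>B. \<eta> b x \<odot>\<^bsub>underlying_space A P2\<^esub> b)" by (rule arg_cong)
        also have "\<dots> = (\<Oplus>b\<in>B. k (\<eta> b x \<odot>\<^bsub>underlying_space A P2\<^esub> b))"
        proof (rule additive_finsum[OF uP2.V.M.abelian_group_axioms A.abelian_group_axioms])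
          show "(\<lambda>b. \<eta> b x \<odot>\<^bsub>underlying_space A P2\<^esub> b) \<in> B \<rightarrow> carrier (underlying_space A P2)"
            using \<eta>x B P2.smult_closed by (auto simp: AM.smult_closed)
        qed (use kc mod_lin_add[OF kl] in auto)
        also have "\<dots> = (\<Oplus>b\<in>B. \<zero>)"
          using \<eta>x B kb mod_lin_smult[OF kl] by (intro A.finsum_cong') auto
        finally show ?thesis by simp
      qed
      \<comment> \<open>\<open>k = 0\<close> means that \<open>g\<close> vanishes on the image of
        \<open>d2\<close>; so \<open>g\<close> comes from some \<open>h\<close> on
        \<open>P0\<close>, and \<open>\<phi>\<close> kills such elements.\<close>
      have "g (d2 x) = \<zero>" if "x \<in> carrier P2" for x
        using k0[OF that] that by (simp add: k_def s2(2)[OF g] compose_def)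
      then obtain h where h: "h \<in> carrier (star A P0)" "compose (carrier P1) h d1 = g"
        using hom_exact g unfolding star_hom by blast
      then have "g = star_map A P1 P0 d1 h" using s1(2) by simp
      then show "\<phi> g = \<zero>\<^bsub>K\<^esub>" using \<phi>0[OF h(1)] by simp
    qed
    then obtain c where c: "c \<in> J \<times> B \<rightarrow> carrier K" "\<And>g. g \<in> carrier (star A P1) \<Longrightarrow> \<phi> g =
        (\<Oplus>\<^bsub>K\<^esub>p\<in>J \<times> B. c p \<otimes>\<^bsub>K\<^esub> \<xi> (fst p) (star_map A P2 P1 d2 g (snd p)))" by auto
    \<comment> \<open>The same coefficients read on \<open>star A P2\<close>: composing with the
      star of \<open>d2\<close> returns \<open>\<phi>\<close>.\<close>
    define \<chi> where "\<chi> = (\<lambda>g\<in>carrier (star A P2). (\<Oplus>\<^bsub>K\<^esub>p\<in>J \<times> B. c p \<otimes>\<^bsub>K\<^esub> \<xi> (fst p) (g (snd p))))"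
    have "form K (?U P2) (\<lambda>g. \<Oplus>\<^bsub>K\<^esub>p\<in>J \<times> B. c p \<otimes>\<^bsub>K\<^esub> \<xi> (fst p) (g (snd p)))"
      using U2.form_combination[of "J \<times> B" "\<lambda>p g. \<xi> (fst p) (g (snd p))" c] J(1) B(1) ev c(1) by blast
    then have \<chi>: "\<chi> \<in> carrier (nakayama K A P2)"
      unfolding nak \<chi>_def mod_lin_def
      using U2.V.M.a_closed U2.V.smult_closed by (simp add: Pi_iff del: op.underlying_sel(4))
    have "nakayama_map K A P2 P1 d2 \<chi> = \<phi>"
      unfolding map2[OF \<chi>]
      by (rule extensionalityI[OF _ \<phi>e]) (simp_all add: c(2) \<chi>_def s2(1))
    then show ?thesis using \<chi> by blast
  qed
  ultimately show ?thesis by blast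
qed

end

section \<open>Tensor products\<close>

lemma frag_extend_fun_add:
  "frag_extend (\<lambda>x. f x + g x) u = frag_extend f u + frag_extend g u"
  by (simp add: frag_extend_def frag_cmul_distrib2 sum.distrib)

lemma frag_extend_fun_diff:
  "frag_extend (\<lambda>x. f x - g x) u = frag_extend f u - frag_extend g u"
  using frag_extend_fun_add[of "\<lambda>x. f x - g x" g u] by simp

text \<open>Only closure of the two actions is assumed, so that the same facts cover two algebras
  over \<open>K\<close> and a right module paired with the coregular module over
  \<open>A\<close>.\<close>

locale tensor_pair = X: abelian_group X + Y: abelian_group Y
  for A :: "('a, 'z) ring_scheme" and X :: "('a, 'm) module" and Y :: "('a, 'n) module" +
  assumes smult_X: "a \<in> carrier A \<Longrightarrow> x \<in> carrier X \<Longrightarrow> a \<odot>\<^bsub>X\<^esub> x \<in> carrier X"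
    and smult_Y: "a \<in> carrier A \<Longrightarrow> y \<in> carrier Y \<Longrightarrow> a \<odot>\<^bsub>Y\<^esub> y \<in> carrier Y"
begin

abbreviation "S \<equiv> carrier X \<times> carrier Y"
abbreviation "F \<equiv> free_Abelian_group S"
abbreviation "R \<equiv> tensor_relations A X Y"
abbreviation "T \<equiv> tensor_group A X Y"
abbreviation "cls \<equiv> tensor_class A X Y"

definition relators :: "('m \<times> 'n \<Rightarrow>\<^sub>0 int) set" where
  "relators = {frag_of (x \<oplus>\<^bsub>X\<^esub> x', y) - frag_of (x, y) - frag_of (x', y) | x x' y.
         x \<in> carrier X \<and> x' \<in> carrier X \<and> y \<in> carrier Y} \<union>
      {frag_of (x, y \<oplus>\<^bsub>Y\<^esub> y') - frag_of (x, y) - frag_of (x, y') | x y y'.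
         x \<in> carrier X \<and> y \<in> carrier Y \<and> y' \<in> carrier Y} \<union>
      {frag_of (a \<odot>\<^bsub>X\<^esub> x, y) - frag_of (x, a \<odot>\<^bsub>Y\<^esub> y) | a x y.
         a \<in> carrier A \<and> x \<in> carrier X \<and> y \<in> carrier Y}"

lemma R_generate: "R = generate F relators"
  by (simp add: tensor_relations_def relators_def)

lemma keys_diff3: "Poly_Mapping.keys u \<subseteq> S \<Longrightarrow> Poly_Mapping.keys v \<subseteq> S \<Longrightarrow> Poly_Mapping.keys w \<subseteq> S \<Longrightarrow> Poly_Mapping.keys (u - v - w) \<subseteq> S"
  using keys_diff[of u v] keys_diff[of "u - v" w] by blast

lemma relators_cases:
  assumes "r \<in> relators"
  obtains x x' y where "r = frag_of (x \<oplus>\<^bsub>X\<^esub> x', y) - frag_of (x, y) - frag_of (x', y)"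
      "x \<in> carrier X" "x' \<in> carrier X" "y \<in> carrier Y"
    | x y y' where "r = frag_of (x, y \<oplus>\<^bsub>Y\<^esub> y') - frag_of (x, y) - frag_of (x, y')"
      "x \<in> carrier X" "y \<in> carrier Y" "y' \<in> carrier Y"
    | a x y where "r = frag_of (a \<odot>\<^bsub>X\<^esub> x, y) - frag_of (x, a \<odot>\<^bsub>Y\<^esub> y)"
      "a \<in> carrier A" "x \<in> carrier X" "y \<in> carrier Y"
  using assms unfolding relators_def by blast

lemma relators_F: "r \<in> relators \<Longrightarrow> Poly_Mapping.keys r \<subseteq> S"
proof -
  have *: "Poly_Mapping.keys (frag_of (a, b) - frag_of (c, d) - frag_of (e, f)) \<subseteq> S"
    "Poly_Mapping.keys (frag_of (a, b) - frag_of (c, d)) \<subseteq> S"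
    if "a \<in> carrier X" "b \<in> carrier Y" "c \<in> carrier X" "d \<in> carrier Y" "e \<in> carrier X" "f \<in> carrier Y"
    for a b c d e f
    using that keys_diff3[of "frag_of (a, b)" "frag_of (c, d)" "frag_of (e, f)"]
      keys_diff[of "frag_of (a, b)" "frag_of (c, d)"]
    by (auto simp: keys_frag_of)
  assume "r \<in> relators"
  then show "Poly_Mapping.keys r \<subseteq> S"
  proof (cases rule: relators_cases)
    case 1 then show ?thesis by (simp add: *(1))
  next
    case 2 then show ?thesis by (simp add: *(1))
  next
    case 3 then show ?thesis using *(2)[OF _ _ _ _ 3(3,4)] by (simp add: smult_X smult_Y)
  qed
qed

lemma relators_subset: "relators \<subseteq> carrier F"
  by (rule subsetI) (simp add: relators_F)

lemma R_F: "r \<in> R \<Longrightarrow> Poly_Mapping.keys r \<subseteq> S"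
  using group.generate_in_carrier[OF group_free_Abelian_group relators_subset]
  by (simp add: R_generate)

lemma R_subgroup: "subgroup R F"
  unfolding R_generate
  by (rule group.generate_is_subgroup[OF group_free_Abelian_group relators_subset])

lemma R_zero: "0 \<in> R"
  using subgroup.one_closed[OF R_subgroup] by simp

lemma R_add: "r \<in> R \<Longrightarrow> s \<in> R \<Longrightarrow> r + s \<in> R"
  using subgroup.m_closed[OF R_subgroup] by simp

lemma R_minus: "r \<in> R \<Longrightarrow> - r \<in> R"
  using subgroup.m_inv_closed[OF R_subgroup] R_F by simp

lemma R_diff: "r \<in> R \<Longrightarrow> s \<in> R \<Longrightarrow> r - s \<in> R"
  using R_add[of r "- s"] R_minus[of s] by simp

lemma R_relators: "r \<in> relators \<Longrightarrow> r \<in> R"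
  unfolding R_generate by (rule generate.incl)

lemma R_add_left:
  "x \<in> carrier X \<Longrightarrow> x' \<in> carrier X \<Longrightarrow> y \<in> carrier Y \<Longrightarrow>
    frag_of (x \<oplus>\<^bsub>X\<^esub> x', y) - frag_of (x, y) - frag_of (x', y) \<in> R"
  by (rule R_relators) (auto simp: relators_def)

lemma R_add_right:
  "x \<in> carrier X \<Longrightarrow> y \<in> carrier Y \<Longrightarrow> y' \<in> carrier Y \<Longrightarrow>
    frag_of (x, y \<oplus>\<^bsub>Y\<^esub> y') - frag_of (x, y) - frag_of (x, y') \<in> R"
  by (rule R_relators) (auto simp: relators_def)

lemma R_balanced:
  "a \<in> carrier A \<Longrightarrow> x \<in> carrier X \<Longrightarrow> y \<in> carrier Y \<Longrightarrow>
    frag_of (a \<odot>\<^bsub>X\<^esub> x, y) - frag_of (x, a \<odot>\<^bsub>Y\<^esub> y) \<in> R"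
  by (rule R_relators) (auto simp: relators_def)

lemma R_diff_left:
  assumes "x \<in> carrier X" "x' \<in> carrier X" "y \<in> carrier Y"
  shows "frag_of (x \<ominus>\<^bsub>X\<^esub> x', y) - (frag_of (x, y) - frag_of (x', y)) \<in> R"
proof -
  have eq: "(x \<ominus>\<^bsub>X\<^esub> x') \<oplus>\<^bsub>X\<^esub> x' = x" using assms by (simp add: X.minus_eq X.a_assoc X.l_neg)
  have "frag_of ((x \<ominus>\<^bsub>X\<^esub> x') \<oplus>\<^bsub>X\<^esub> x', y) - frag_of (x \<ominus>\<^bsub>X\<^esub> x', y) - frag_of (x', y) \<in> R"
    using assms by (intro R_add_left) auto
  from R_minus[OF this] show ?thesis unfolding eq by (simp add: algebra_simps)
qed

lemma R_induct [consumes 1, case_names zero add_left add_right balanced add minus]: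
  assumes "r \<in> R" and "P 0"
    and "\<And>x x' y. x \<in> carrier X \<Longrightarrow> x' \<in> carrier X \<Longrightarrow> y \<in> carrier Y \<Longrightarrow>
      P (frag_of (x \<oplus>\<^bsub>X\<^esub> x', y) - frag_of (x, y) - frag_of (x', y))"
    and "\<And>x y y'. x \<in> carrier X \<Longrightarrow> y \<in> carrier Y \<Longrightarrow> y' \<in> carrier Y \<Longrightarrow>
      P (frag_of (x, y \<oplus>\<^bsub>Y\<^esub> y') - frag_of (x, y) - frag_of (x, y'))"
    and "\<And>a x y. a \<in> carrier A \<Longrightarrow> x \<in> carrier X \<Longrightarrow> y \<in> carrier Y \<Longrightarrow>
      P (frag_of (a \<odot>\<^bsub>X\<^esub> x, y) - frag_of (x, a \<odot>\<^bsub>Y\<^esub> y))"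
    and "\<And>r s. Poly_Mapping.keys r \<subseteq> S \<Longrightarrow> Poly_Mapping.keys s \<subseteq> S \<Longrightarrow> P r \<Longrightarrow> P s \<Longrightarrow> P (r + s)"
    and "\<And>r. Poly_Mapping.keys r \<subseteq> S \<Longrightarrow> P r \<Longrightarrow> P (- r)"
  shows "P r"
proof -
  have rel: "P r" if "r \<in> relators" for r
    using that by (cases rule: relators_cases) (simp_all add: assms(3-5))
  show ?thesis
    using assms(1) unfolding R_generate
  proof (induction rule: generate.induct)
    case (inv h)
    then show ?case using rel assms(7) relators_F by simp
  next
    case (eng r s)
    then show ?case using assms(6) R_F by (simp add: R_generate)
  qed (use assms(2) rel in auto)
qed

text \<open>Differences cover sums and negatives at once, which is why maps on formal sums are
  recorded below with their rule for differences.\<close>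

lemma F_induct [consumes 1, case_names zero diff pure]:
  assumes "Poly_Mapping.keys u \<subseteq> S" and "P 0"
    and "\<And>u v. Poly_Mapping.keys u \<subseteq> S \<Longrightarrow> Poly_Mapping.keys v \<subseteq> S \<Longrightarrow> P u \<Longrightarrow> P v \<Longrightarrow> P (u - v)"
    and "\<And>x y. x \<in> carrier X \<Longrightarrow> y \<in> carrier Y \<Longrightarrow> P (frag_of (x, y))"
  shows "P u"
  using assms by (intro free_Abelian_group_induct[of u S P]) auto

lemma comm_group_F: "comm_group F"
  by (rule abelian_free_Abelian_group)

lemma normal_R: "R \<lhd> F"
  by (rule comm_group.subgroup_imp_normal[OF comm_group_F R_subgroup])

lemma cls_def': "cls u = {r + u | r. r \<in> R}"
  by (auto simp: tensor_class_def r_coset_def)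

lemma cls_self: "u \<in> cls u"
  using R_zero by (force simp: cls_def')

lemma in_cls_iff: "v \<in> cls u \<longleftrightarrow> v - u \<in> R"
  by (force simp: cls_def' algebra_simps)

lemma cls_eq_iff: "cls u = cls v \<longleftrightarrow> u - v \<in> R"
proof
  assume "cls u = cls v"
  then show "u - v \<in> R" using cls_self in_cls_iff by blast
next
  assume uv: "u - v \<in> R"
  have "w - u \<in> R \<longleftrightarrow> w - v \<in> R" for w
    using R_add[OF _ uv, of "w - u"] R_diff[OF _ uv, of "w - v"] by auto
  then show "cls u = cls v" using in_cls_iff by blast
qed

lemma cls_eqI: "u - v \<in> R \<Longrightarrow> cls u = cls v"
  by (simp add: cls_eq_iff)

lemma carrier_T: "carrier T = cls ` {u. Poly_Mapping.keys u \<subseteq> S}"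
  by (auto simp: tensor_group_def FactGroup_def RCOSETS_def tensor_class_def)

lemma cls_closed: "Poly_Mapping.keys u \<subseteq> S \<Longrightarrow> cls u \<in> carrier T"
  by (simp add: carrier_T)

lemma mult_T: "Poly_Mapping.keys u \<subseteq> S \<Longrightarrow> Poly_Mapping.keys v \<subseteq> S \<Longrightarrow> cls u \<otimes>\<^bsub>T\<^esub> cls v = cls (u + v)"
  using normal.rcos_sum[OF normal_R, of u v]
  by (simp add: tensor_group_def tensor_class_def)

lemma one_T: "\<one>\<^bsub>T\<^esub> = cls 0"
  by (simp add: tensor_group_def FactGroup_def cls_def')

lemma comm_group_T: "comm_group T"
  unfolding tensor_group_def
  by (rule comm_group.abelian_FactGroup[OF comm_group_F R_subgroup])

text \<open>Operations on tensor classes are defined as unions over representatives; the union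
  collapses once its members agree.\<close>

lemma Un_cls:
  assumes "\<And>v. v \<in> cls u \<Longrightarrow> h v = h u"
  shows "(\<Union>v\<in>cls u. h v) = h u"
  using assms cls_self by blast

lemma cls_F: "Poly_Mapping.keys u \<subseteq> S \<Longrightarrow> v \<in> cls u \<Longrightarrow> Poly_Mapping.keys v \<subseteq> S"
  using R_F keys_add by (fastforce simp: cls_def')

text \<open>The homomorphism is kept on formal sums together with its vanishing on the relations;
  descent to classes is carried out in \<open>C_lift\<close>.\<close>

definition is_lift :: "('g, 'y) ring_scheme \<Rightarrow> ('m \<Rightarrow> 'n \<Rightarrow> 'g) \<Rightarrow> (('m \<times> 'n \<Rightarrow>\<^sub>0 int) \<Rightarrow> 'g) \<Rightarrow> bool" where
  "is_lift G \<beta> h \<longleftrightarrow> (\<forall>u. Poly_Mapping.keys u \<subseteq> S \<longrightarrow> h u \<in> carrier G) \<and>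
     (\<forall>u v. Poly_Mapping.keys u \<subseteq> S \<longrightarrow> Poly_Mapping.keys v \<subseteq> S \<longrightarrow>
        h (u + v) = h u \<oplus>\<^bsub>G\<^esub> h v \<and> h (u - v) = h u \<ominus>\<^bsub>G\<^esub> h v) \<and>
     (\<forall>x\<in>carrier X. \<forall>y\<in>carrier Y. h (frag_of (x, y)) = \<beta> x y) \<and> (\<forall>r\<in>R. h r = \<zero>\<^bsub>G\<^esub>)"

lemma is_liftD:
  assumes "is_lift G \<beta> h"
  shows "Poly_Mapping.keys u \<subseteq> S \<Longrightarrow> h u \<in> carrier G"
    and "Poly_Mapping.keys u \<subseteq> S \<Longrightarrow> Poly_Mapping.keys v \<subseteq> S \<Longrightarrow> h (u + v) = h u \<oplus>\<^bsub>G\<^esub> h v"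
    and "Poly_Mapping.keys u \<subseteq> S \<Longrightarrow> Poly_Mapping.keys v \<subseteq> S \<Longrightarrow> h (u - v) = h u \<ominus>\<^bsub>G\<^esub> h v"
    and "x \<in> carrier X \<Longrightarrow> y \<in> carrier Y \<Longrightarrow> h (frag_of (x, y)) = \<beta> x y"
    and "r \<in> R \<Longrightarrow> h r = \<zero>\<^bsub>G\<^esub>"
  using assms unfolding is_lift_def by auto

lemma lift:
  assumes G: "abelian_group G"
    and cl: "\<And>x y. x \<in> carrier X \<Longrightarrow> y \<in> carrier Y \<Longrightarrow> \<beta> x y \<in> carrier G"
    and add_left: "\<And>x x' y. x \<in> carrier X \<Longrightarrow> x' \<in> carrier X \<Longrightarrow> y \<in> carrier Y \<Longrightarrow>
      \<beta> (x \<oplus>\<^bsub>X\<^esub> x') y = \<beta> x y \<oplus>\<^bsub>G\<^esub> \<beta> x' y"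
    and add_right: "\<And>x y y'. x \<in> carrier X \<Longrightarrow> y \<in> carrier Y \<Longrightarrow> y' \<in> carrier Y \<Longrightarrow>
      \<beta> x (y \<oplus>\<^bsub>Y\<^esub> y') = \<beta> x y \<oplus>\<^bsub>G\<^esub> \<beta> x y'"
    and bal: "\<And>a x y. a \<in> carrier A \<Longrightarrow> x \<in> carrier X \<Longrightarrow> y \<in> carrier Y \<Longrightarrow>
      \<beta> (a \<odot>\<^bsub>X\<^esub> x) y = \<beta> x (a \<odot>\<^bsub>Y\<^esub> y)"
  shows "\<exists>h. is_lift G \<beta> h"
proof -
  interpret G: abelian_group G by fact
  obtain h where h: "h \<in> hom F (add_monoid G)" "\<And>p. p \<in> S \<Longrightarrow> h (frag_of p) = (\<lambda>(x, y). \<beta> x y) p"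
    by (rule comm_group.free_Abelian_group_universal[OF G.a_comm_group, of "\<lambda>(x, y). \<beta> x y" S])
       (use cl in auto)
  have hc: "h u \<in> carrier G" if "Poly_Mapping.keys u \<subseteq> S" for u
    using hom_carrier[OF h(1)] that by (auto simp: image_subset_iff)
  have ha: "h (u + v) = h u \<oplus>\<^bsub>G\<^esub> h v" if "Poly_Mapping.keys u \<subseteq> S" "Poly_Mapping.keys v \<subseteq> S" for u v
    using hom_mult[OF h(1), of u v] that by simp
  have h0: "h 0 = \<zero>\<^bsub>G\<^esub>"
    using hom_one[OF h(1) group_free_Abelian_group G.a_group] by simp
  have hm: "h (- u) = \<ominus>\<^bsub>G\<^esub> h u" if "Poly_Mapping.keys u \<subseteq> S" for u
  proof -
    have "h (- u) \<oplus>\<^bsub>G\<^esub> h u = \<zero>\<^bsub>G\<^esub>" using ha[of "- u" u] that h0 by (simp add: keys_minus)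
    then show ?thesis using hc[of "- u"] hc[OF that] that
      by (intro G.minus_equality[symmetric]) (auto simp: keys_minus)
  qed
  have hd: "h (u - v) = h u \<ominus>\<^bsub>G\<^esub> h v" if "Poly_Mapping.keys u \<subseteq> S" "Poly_Mapping.keys v \<subseteq> S" for u v
    using ha[of u "- v"] hm[of v] that by (simp add: keys_minus a_minus_def)
  have hf: "h (frag_of (x, y)) = \<beta> x y" if "x \<in> carrier X" "y \<in> carrier Y" for x y
    using h(2)[of "(x, y)"] that by simp
  have k: "Poly_Mapping.keys (frag_of (x, y)) \<subseteq> S" if "x \<in> carrier X" "y \<in> carrier Y" for x y
    using that by (simp add: keys_frag_of)
  have k2: "Poly_Mapping.keys (frag_of p - frag_of q) \<subseteq> S" if "p \<in> S" "q \<in> S" for p q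
    using that keys_diff[of "frag_of p" "frag_of q"] by (auto simp: keys_frag_of)
  have "h r = \<zero>\<^bsub>G\<^esub>" if "r \<in> R" for r
    using that
  proof (induction rule: R_induct)
    case (add_left x x' y)
    then show ?case
      using cl by (simp add: hd k k2 hf assms(3) G.minus_eq G.minus_add G.a_ac G.r_neg G.r_neg1)
  next
    case (add_right x y y')
    then show ?case
      using cl by (simp add: hd k k2 hf assms(4) G.minus_eq G.minus_add G.a_ac G.r_neg G.r_neg1)
  next
    case (balanced a x y)
    then show ?case
      using cl smult_X smult_Y by (simp add: hd k hf bal G.minus_eq G.r_neg)
  next
    case (minus r)
    then show ?case by (simp add: hm)
  qed (simp_all add: h0 ha)
  with hc ha hd hf have "is_lift G \<beta> h" unfolding is_lift_def by (intro conjI allI impI ballI)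
  then show ?thesis by blast
qed

lemma T_induct [consumes 1, case_names zero pure add]:
  assumes "U \<in> carrier T"
    and "P (cls 0)"
    and "\<And>x y. x \<in> carrier X \<Longrightarrow> y \<in> carrier Y \<Longrightarrow> P (cls (frag_of (x, y)))"
    and "\<And>U V. U \<in> carrier T \<Longrightarrow> V \<in> carrier T \<Longrightarrow> P U \<Longrightarrow> P V \<Longrightarrow> P (U \<otimes>\<^bsub>T\<^esub> V)"
  shows "P U"
proof -
  \<comment> \<open>\<open>F_induct\<close> passes through differences, the present rule through
    sums. Proving the claim for \<open>u\<close> and \<open>- u\<close> together closes the gap,
    with \<open>-(x \<otimes> y) = (-x) \<otimes> y\<close> on pure tensors.\<close>
  have "P (cls u) \<and> P (cls (- u))" if "Poly_Mapping.keys u \<subseteq> S" for u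
    using that
  proof (induction u rule: F_induct)
    case zero
    then show ?case using assms(2) by simp
  next
    case (diff u v)
    have "P (cls u \<otimes>\<^bsub>T\<^esub> cls (- v))" "P (cls (- u) \<otimes>\<^bsub>T\<^esub> cls v)"
      using diff by (auto intro!: assms(4) cls_closed simp: keys_minus)
    then show ?case using diff by (simp add: mult_T keys_minus)
  next
    case (pure x y)
    note p = pure
    have "cls (- frag_of (x, y)) = cls (frag_of (\<ominus>\<^bsub>X\<^esub> x, y))"
    proof (rule cls_eqI)
      have 1: "frag_of (x \<oplus>\<^bsub>X\<^esub> \<ominus>\<^bsub>X\<^esub> x, y) - frag_of (x, y) - frag_of (\<ominus>\<^bsub>X\<^esub> x, y) \<in> R"
        by (rule R_add_left) (use p in auto)
      have 2: "frag_of (x \<oplus>\<^bsub>X\<^esub> \<ominus>\<^bsub>X\<^esub> x, y) \<in> R"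
        using R_minus[OF R_add_left[of "\<zero>\<^bsub>X\<^esub>" "\<zero>\<^bsub>X\<^esub>" y]] p by (simp add: X.r_neg)
      show "- frag_of (x, y) - frag_of (\<ominus>\<^bsub>X\<^esub> x, y) \<in> R" using R_diff[OF 1 2] by simp
    qed
    then show ?case using p assms(3) by simp
  qed
  then show ?thesis using assms(1) by (auto simp: carrier_T)
qed

end

text \<open>One criterion for well-definedness: it serves scalar multiplication, multiplication by a
  pure tensor and the maps induced by homomorphisms.\<close>

lemma frag_extend_relations:
  assumes XY: "tensor_pair A X Y" and r: "r \<in> tensor_relations A X Y"
    and XY': "tensor_pair A' X' Y'"
    and "\<And>x x' y. x \<in> carrier X \<Longrightarrow> x' \<in> carrier X \<Longrightarrow> y \<in> carrier Y \<Longrightarrow>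
      f (x \<oplus>\<^bsub>X\<^esub> x', y) - f (x, y) - f (x', y) \<in> tensor_relations A' X' Y'"
    and "\<And>x y y'. x \<in> carrier X \<Longrightarrow> y \<in> carrier Y \<Longrightarrow> y' \<in> carrier Y \<Longrightarrow>
      f (x, y \<oplus>\<^bsub>Y\<^esub> y') - f (x, y) - f (x, y') \<in> tensor_relations A' X' Y'"
    and "\<And>a x y. a \<in> carrier A \<Longrightarrow> x \<in> carrier X \<Longrightarrow> y \<in> carrier Y \<Longrightarrow>
      f (a \<odot>\<^bsub>X\<^esub> x, y) - f (x, a \<odot>\<^bsub>Y\<^esub> y) \<in> tensor_relations A' X' Y'"
  shows "frag_extend f r \<in> tensor_relations A' X' Y'"
proof -
  interpret P: tensor_pair A X Y by fact
  interpret P': tensor_pair A' X' Y' by fact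
  show ?thesis
    using r
    by (induction rule: P.R_induct)
       (use assms(4-6) P'.R_zero P'.R_add P'.R_minus in
          \<open>auto simp: frag_extend_diff frag_extend_add frag_extend_minus\<close>)
qed

section \<open>The tensor product of two algebras\<close>

locale algebra_pair = A: kalg K A + B: kalg K B
  for K :: "'k ring" and A :: "('k, 'a) module" and B :: "('k, 'b) module"

sublocale algebra_pair \<subseteq> tensor_pair K A B
  by unfold_locales auto

context algebra_pair begin

abbreviation "C \<equiv> tensor_algebra K A B"

text \<open>The product before passing to classes: associativity and the unit laws hold already for
  formal sums, by reduction to pure tensors.\<close>

definition fmul :: "('a \<times> 'b \<Rightarrow>\<^sub>0 int) \<Rightarrow> ('a \<times> 'b \<Rightarrow>\<^sub>0 int) \<Rightarrow> ('a \<times> 'b \<Rightarrow>\<^sub>0 int)" where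
  "fmul u v = frag_extend (\<lambda>(a, b). frag_extend (\<lambda>(a', b'). frag_of (a \<otimes>\<^bsub>A\<^esub> a', b \<otimes>\<^bsub>B\<^esub> b')) v) u"

definition fsm :: "'k \<Rightarrow> ('a \<times> 'b \<Rightarrow>\<^sub>0 int) \<Rightarrow> ('a \<times> 'b \<Rightarrow>\<^sub>0 int)" where
  "fsm c u = frag_extend (\<lambda>(a, b). frag_of (c \<odot>\<^bsub>A\<^esub> a, b)) u"

lemma fmul_diff_left: "fmul (u - u') v = fmul u v - fmul u' v"
  by (simp add: fmul_def frag_extend_diff)

lemma fmul_diff_right: "fmul u (v - v') = fmul u v - fmul u v'"
proof -
  have "(\<lambda>(a, b). frag_extend (\<lambda>(a', b'). frag_of (a \<otimes>\<^bsub>A\<^esub> a', b \<otimes>\<^bsub>B\<^esub> b')) (v - v')) =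
      (\<lambda>p. (\<lambda>(a, b). frag_extend (\<lambda>(a', b'). frag_of (a \<otimes>\<^bsub>A\<^esub> a', b \<otimes>\<^bsub>B\<^esub> b')) v) p -
           (\<lambda>(a, b). frag_extend (\<lambda>(a', b'). frag_of (a \<otimes>\<^bsub>A\<^esub> a', b \<otimes>\<^bsub>B\<^esub> b')) v') p)"
    by (auto simp: fun_eq_iff frag_extend_diff)
  then show ?thesis unfolding fmul_def by (simp only: frag_extend_fun_diff)
qed

lemma fmul_zero [simp]: "fmul 0 v = 0" "fmul u 0 = 0"
  using fmul_diff_left[of 0 0 v] fmul_diff_right[of u 0 0] by simp_all

lemma fmul_add: "fmul (u + u') v = fmul u v + fmul u' v" "fmul u (v + v') = fmul u v + fmul u v'"
  using fmul_diff_left[of u "- u'" v] fmul_diff_left[of 0 u' v]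
    fmul_diff_right[of u v "- v'"] fmul_diff_right[of u 0 v'] by simp_all

lemma fmul_pure [simp]: "fmul (frag_of (a, b)) (frag_of (a', b')) = frag_of (a \<otimes>\<^bsub>A\<^esub> a', b \<otimes>\<^bsub>B\<^esub> b')"
  by (simp add: fmul_def)

lemma fsm_diff: "fsm c (u - v) = fsm c u - fsm c v"
  by (simp add: fsm_def frag_extend_diff)

lemma fsm_add: "fsm c (u + v) = fsm c u + fsm c v"
  by (simp add: fsm_def frag_extend_add)

lemma fsm_zero [simp]: "fsm c 0 = 0"
  by (simp add: fsm_def)

lemma fsm_pure [simp]: "fsm c (frag_of (a, b)) = frag_of (c \<odot>\<^bsub>A\<^esub> a, b)"
  by (simp add: fsm_def)

lemma keys_fmul:
  assumes "Poly_Mapping.keys u \<subseteq> S" "Poly_Mapping.keys v \<subseteq> S"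
  shows "Poly_Mapping.keys (fmul u v) \<subseteq> S"
  using assms(1)
proof (induction u rule: F_induct)
  case (diff u u')
  then show ?case using keys_diff[of "fmul u v" "fmul u' v"] by (auto simp: fmul_diff_left)
next
  case (pure a b)
  note p = pure
  show ?case using assms(2)
  proof (induction v rule: F_induct)
    case (diff v v')
    then show ?case
      using keys_diff[of "fmul (frag_of (a, b)) v" "fmul (frag_of (a, b)) v'"] by (auto simp: fmul_diff_right)
  qed (use p in \<open>simp_all add: keys_frag_of\<close>)
qed simp

lemma keys_fsm:
  assumes c: "c \<in> carrier K" and "Poly_Mapping.keys u \<subseteq> S"
  shows "Poly_Mapping.keys (fsm c u) \<subseteq> S"
  using assms(2)
proof (induction u rule: F_induct)
  case (diff u u')
  then show ?case using keys_diff[of "fsm c u" "fsm c u'"] by (auto simp: fsm_diff)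
qed (use c in \<open>simp_all add: keys_frag_of\<close>)

lemma tensor_pair: "tensor_pair K A B" ..

lemma fsm_R:
  assumes c: "c \<in> carrier K" and r: "r \<in> R"
  shows "fsm c r \<in> R"
  unfolding fsm_def
proof (rule frag_extend_relations[OF tensor_pair r tensor_pair])
  fix d x y assume "d \<in> carrier K" "x \<in> carrier A" "y \<in> carrier B"
  moreover from this have "c \<odot>\<^bsub>A\<^esub> (d \<odot>\<^bsub>A\<^esub> x) = d \<odot>\<^bsub>A\<^esub> (c \<odot>\<^bsub>A\<^esub> x)"
    using c by (simp add: A.K.m_comm flip: A.AM.smult_assoc1)
  ultimately show "(case (d \<odot>\<^bsub>A\<^esub> x, y) of (a, b) \<Rightarrow> frag_of (c \<odot>\<^bsub>A\<^esub> a, b)) -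
      (case (x, d \<odot>\<^bsub>B\<^esub> y) of (a, b) \<Rightarrow> frag_of (c \<odot>\<^bsub>A\<^esub> a, b)) \<in> R"
    using c R_balanced[of d "c \<odot>\<^bsub>A\<^esub> x" y] by simp
qed (use c in \<open>auto simp: A.AM.smult_r_distr intro!: R_add_left R_add_right\<close>)

lemma fmul_R_left:
  assumes "r \<in> R" "Poly_Mapping.keys v \<subseteq> S"
  shows "fmul r v \<in> R"
  using assms(2)
proof (induction v rule: F_induct)
  case (diff v v')
  then show ?case by (simp add: fmul_diff_right R_diff)
next
  case (pure s t)
  note p = pure
  show ?case
    unfolding fmul_def
  proof (rule frag_extend_relations[OF tensor_pair assms(1) tensor_pair])
    fix c x y assume "c \<in> carrier K" "x \<in> carrier A" "y \<in> carrier B"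
    then show "(case (c \<odot>\<^bsub>A\<^esub> x, y) of (a, b) \<Rightarrow> frag_extend (\<lambda>(a', b'). frag_of (a \<otimes>\<^bsub>A\<^esub> a', b \<otimes>\<^bsub>B\<^esub> b')) (frag_of (s, t))) -
        (case (x, c \<odot>\<^bsub>B\<^esub> y) of (a, b) \<Rightarrow> frag_extend (\<lambda>(a', b'). frag_of (a \<otimes>\<^bsub>A\<^esub> a', b \<otimes>\<^bsub>B\<^esub> b')) (frag_of (s, t))) \<in> R"
      using p R_balanced[of c "x \<otimes>\<^bsub>A\<^esub> s" "y \<otimes>\<^bsub>B\<^esub> t"] by (simp add: A.smult_mult B.smult_mult)
  qed (use p in \<open>auto simp: A.A.l_distr B.A.l_distr intro!: R_add_left R_add_right\<close>)
qed (simp add: R_zero)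

lemma fmul_R_right:
  assumes "r \<in> R" "Poly_Mapping.keys u \<subseteq> S"
  shows "fmul u r \<in> R"
  using assms(2)
proof (induction u rule: F_induct)
  case (diff v v')
  then show ?case by (simp add: fmul_diff_left R_diff)
next
  case (pure a b)
  note p = pure
  have "frag_extend (\<lambda>(a', b'). frag_of (a \<otimes>\<^bsub>A\<^esub> a', b \<otimes>\<^bsub>B\<^esub> b')) r \<in> R"
  proof (rule frag_extend_relations[OF tensor_pair assms(1) tensor_pair])
    fix c x y assume "c \<in> carrier K" "x \<in> carrier A" "y \<in> carrier B"
    then show "(case (c \<odot>\<^bsub>A\<^esub> x, y) of (a', b') \<Rightarrow> frag_of (a \<otimes>\<^bsub>A\<^esub> a', b \<otimes>\<^bsub>B\<^esub> b')) -
        (case (x, c \<odot>\<^bsub>B\<^esub> y) of (a', b') \<Rightarrow> frag_of (a \<otimes>\<^bsub>A\<^esub> a', b \<otimes>\<^bsub>B\<^esub> b')) \<in> R"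
      using p R_balanced[of c "a \<otimes>\<^bsub>A\<^esub> x" "b \<otimes>\<^bsub>B\<^esub> y"] by (simp add: A.smult_mult B.smult_mult)
  qed (use p in \<open>auto simp: A.A.r_distr B.A.r_distr intro!: R_add_left R_add_right\<close>)
  then show ?case by (simp add: fmul_def)
qed (simp add: R_zero)

lemma C_sel:
  "carrier C = cls ` {u. Poly_Mapping.keys u \<subseteq> S}"
  "\<zero>\<^bsub>C\<^esub> = cls 0" "\<one>\<^bsub>C\<^esub> = cls (frag_of (\<one>\<^bsub>A\<^esub>, \<one>\<^bsub>B\<^esub>))"
  "Poly_Mapping.keys u \<subseteq> S \<Longrightarrow> Poly_Mapping.keys v \<subseteq> S \<Longrightarrow> cls u \<oplus>\<^bsub>C\<^esub> cls v = cls (u + v)"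
  by (simp_all add: tensor_algebra_def carrier_T one_T mult_T)

lemma C_mult:
  assumes u: "Poly_Mapping.keys u \<subseteq> S" and v: "Poly_Mapping.keys v \<subseteq> S"
  shows "cls u \<otimes>\<^bsub>C\<^esub> cls v = cls (fmul u v)"
proof -
  have "cls u \<otimes>\<^bsub>C\<^esub> cls v = (\<Union>u'\<in>cls u. \<Union>v'\<in>cls v. cls (fmul u' v'))"
    by (simp add: tensor_algebra_def fmul_def)
  also have "\<dots> = (\<Union>u'\<in>cls u. \<Union>v'\<in>cls v. cls (fmul u v))"
  proof (intro SUP_cong refl cls_eqI)
    fix u' v' assume u': "u' \<in> cls u" and v': "v' \<in> cls v"
    \<comment> \<open>Changing one factor at a time leaves a relation as a factor of each
      product.\<close>
    have "fmul u' v' - fmul u v = fmul (u' - u) v' + fmul u (v' - v)"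
      by (simp add: fmul_diff_left fmul_diff_right)
    also have "\<dots> \<in> R"
      using u' v' u v cls_F by (intro R_add fmul_R_left fmul_R_right) (auto simp: in_cls_iff)
    finally show "fmul u' v' - fmul u v \<in> R" .
  qed
  also have "\<dots> = cls (fmul u v)" using cls_self[of u] cls_self[of v] by auto
  finally show ?thesis .
qed

lemma C_smult:
  assumes c: "c \<in> carrier K" and u: "Poly_Mapping.keys u \<subseteq> S"
  shows "c \<odot>\<^bsub>C\<^esub> cls u = cls (fsm c u)"
proof -
  have "c \<odot>\<^bsub>C\<^esub> cls u = (\<Union>u'\<in>cls u. cls (fsm c u'))"
    by (simp add: tensor_algebra_def fsm_def)
  also have "\<dots> = cls (fsm c u)"
  proof (rule Un_cls, rule cls_eqI)
    fix u' assume "u' \<in> cls u"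
    then have "fsm c (u' - u) \<in> R" using c by (intro fsm_R) (auto simp: in_cls_iff)
    then show "fsm c u' - fsm c u \<in> R" by (simp add: fsm_diff)
  qed
  finally show ?thesis .
qed

lemma fmul_assoc:
  assumes "Poly_Mapping.keys u \<subseteq> S" "Poly_Mapping.keys v \<subseteq> S" "Poly_Mapping.keys w \<subseteq> S"
  shows "fmul (fmul u v) w = fmul u (fmul v w)"
  using assms(1)
proof (induction u rule: F_induct)
  case (pure a b)
  note p = pure
  show ?case using assms(2)
  proof (induction v rule: F_induct)
    case (pure a' b')
    note q = pure
    show ?case using assms(3)
      by (induction w rule: F_induct) (use p q in \<open>simp_all add: fmul_diff_right A.A.m_assoc B.A.m_assoc\<close>)
  qed (simp_all add: fmul_diff_right fmul_diff_left)
qed (simp_all add: fmul_diff_left)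

lemma fmul_one:
  assumes "Poly_Mapping.keys u \<subseteq> S"
  shows "fmul (frag_of (\<one>\<^bsub>A\<^esub>, \<one>\<^bsub>B\<^esub>)) u = u" "fmul u (frag_of (\<one>\<^bsub>A\<^esub>, \<one>\<^bsub>B\<^esub>)) = u"
  using assms by (induction u rule: F_induct) (simp_all add: fmul_diff_left fmul_diff_right)

lemma fsm_fmul:
  assumes c: "c \<in> carrier K" and "Poly_Mapping.keys u \<subseteq> S" "Poly_Mapping.keys v \<subseteq> S"
  shows "fmul (fsm c u) v = fsm c (fmul u v)" "fmul u (fsm c v) = fsm c (fmul u v)"
proof -
  have "fmul (fsm c u) v = fsm c (fmul u v) \<and> fmul u (fsm c v) = fsm c (fmul u v)"
    using assms(2)
  proof (induction u rule: F_induct)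
    case (pure a b)
    note p = pure
    show ?case using assms(3)
      by (induction v rule: F_induct) (use p c in \<open>simp_all add: fmul_diff_right fsm_diff A.smult_mult\<close>)
  qed (simp_all add: fmul_diff_left fsm_diff)
  then show "fmul (fsm c u) v = fsm c (fmul u v)" "fmul u (fsm c v) = fsm c (fmul u v)" by auto
qed

lemma fsm_assoc:
  assumes "c \<in> carrier K" "d \<in> carrier K" "Poly_Mapping.keys u \<subseteq> S"
  shows "fsm (c \<otimes>\<^bsub>K\<^esub> d) u = fsm c (fsm d u)"
  using assms(3)
  by (induction u rule: F_induct) (use assms(1,2) in \<open>simp_all add: fsm_diff A.AM.smult_assoc1\<close>)

lemma fsm_one:
  assumes "Poly_Mapping.keys u \<subseteq> S"
  shows "fsm \<one>\<^bsub>K\<^esub> u = u"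
  using assms by (induction u rule: F_induct) (simp_all add: fsm_diff)

text \<open>Among the laws of an algebra, the one that fails for formal sums:
  \<open>(c + d) a \<otimes> b\<close> is a single generator and agrees with
  \<open>c a \<otimes> b + d a \<otimes> b\<close> only up to relations.\<close>

lemma fsm_distr:
  assumes "c \<in> carrier K" "d \<in> carrier K" "Poly_Mapping.keys u \<subseteq> S"
  shows "fsm (c \<oplus>\<^bsub>K\<^esub> d) u - (fsm c u + fsm d u) \<in> R"
  using assms(3)
proof (induction u rule: F_induct)
  case (diff u v)
  have "fsm (c \<oplus>\<^bsub>K\<^esub> d) (u - v) - (fsm c (u - v) + fsm d (u - v)) =
      (fsm (c \<oplus>\<^bsub>K\<^esub> d) u - (fsm c u + fsm d u)) - (fsm (c \<oplus>\<^bsub>K\<^esub> d) v - (fsm c v + fsm d v))"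
    by (simp add: fsm_diff)
  then show ?case using R_diff[OF diff(3,4)] by simp
next
  case (pure a b)
  then show ?case
    using assms(1,2) R_add_left[of "c \<odot>\<^bsub>A\<^esub> a" "d \<odot>\<^bsub>A\<^esub> a" b]
    by (simp add: A.AM.smult_l_distr algebra_simps)
qed (simp add: R_zero)

lemma keys_add_S: "Poly_Mapping.keys u \<subseteq> S \<Longrightarrow> Poly_Mapping.keys v \<subseteq> S \<Longrightarrow> Poly_Mapping.keys (u + v) \<subseteq> S"
  using keys_add[of u v] by blast

theorem tensor_kalg: "kalg K C"
proof -
  have ag: "abelian_group C"
  proof (rule abelian_groupI)
    fix x assume "x \<in> carrier C"
    then obtain u where u: "Poly_Mapping.keys u \<subseteq> S" "x = cls u" by (auto simp: C_sel)
    then have "cls (- u) \<oplus>\<^bsub>C\<^esub> x = \<zero>\<^bsub>C\<^esub>" "cls (- u) \<in> carrier C"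
      by (auto simp: C_sel keys_minus)
    then show "\<exists>y\<in>carrier C. y \<oplus>\<^bsub>C\<^esub> x = \<zero>\<^bsub>C\<^esub>" by blast
  qed (auto simp: C_sel keys_add_S ac_simps)
  have one: "Poly_Mapping.keys (frag_of (\<one>\<^bsub>A\<^esub>, \<one>\<^bsub>B\<^esub>)) \<subseteq> S" by (simp add: keys_frag_of)
  have mon: "Group.monoid C"
    by (rule monoidI) (use one in \<open>auto simp: C_sel(1,3) C_mult keys_fmul fmul_assoc fmul_one\<close>)
  have ring: "ring C"
    by (rule ringI[OF ag mon]) (auto simp: C_sel(1,4) C_mult keys_fmul keys_add_S fmul_add)
  have "module K C"
  proof (rule moduleI[OF A.K.is_cring ag])
    fix c d x assume c: "c \<in> carrier K" and d: "d \<in> carrier K" and "x \<in> carrier C"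
    then obtain u where u: "Poly_Mapping.keys u \<subseteq> S" "x = cls u" by (auto simp: C_sel)
    show "(c \<oplus>\<^bsub>K\<^esub> d) \<odot>\<^bsub>C\<^esub> x = c \<odot>\<^bsub>C\<^esub> x \<oplus>\<^bsub>C\<^esub> d \<odot>\<^bsub>C\<^esub> x"
      using c d u fsm_distr by (auto simp: C_smult C_sel(4) keys_fsm intro!: cls_eqI)
  qed (auto simp: C_sel(1,4) C_smult keys_fsm keys_add_S fsm_add fsm_assoc fsm_one)
  then show ?thesis
    using ring by unfold_locales
      (auto simp: k_algebra_def A.K.field_axioms C_sel(1) C_smult C_mult keys_fsm keys_fmul fsm_fmul)
qed

end

sublocale algebra_pair \<subseteq> C: kalg K "tensor_algebra K A B"
  by (rule tensor_kalg)

section \<open>Pure tensors and linear forms on the tensor product\<close>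

context algebra_pair begin

definition pure :: "'a \<Rightarrow> 'b \<Rightarrow> ('a \<times> 'b \<Rightarrow>\<^sub>0 int) set" where
  "pure a b = cls (frag_of (a, b))"

lemma keys_pair: "a \<in> carrier A \<Longrightarrow> b \<in> carrier B \<Longrightarrow> Poly_Mapping.keys (frag_of (a, b)) \<subseteq> S"
  by (simp add: keys_frag_of)

lemma pure_closed: "a \<in> carrier A \<Longrightarrow> b \<in> carrier B \<Longrightarrow> pure a b \<in> carrier C"
  unfolding pure_def C_sel(1) using keys_pair by blast

lemma pure_add:
  "a \<in> carrier A \<Longrightarrow> a' \<in> carrier A \<Longrightarrow> b \<in> carrier B \<Longrightarrow> pure (a \<oplus>\<^bsub>A\<^esub> a') b = pure a b \<oplus>\<^bsub>C\<^esub> pure a' b"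
  "a \<in> carrier A \<Longrightarrow> b \<in> carrier B \<Longrightarrow> b' \<in> carrier B \<Longrightarrow> pure a (b \<oplus>\<^bsub>B\<^esub> b') = pure a b \<oplus>\<^bsub>C\<^esub> pure a b'"
  unfolding pure_def
  by (simp_all add: C_sel(4) keys_pair cls_eq_iff R_add_left R_add_right flip: diff_diff_eq)

lemma pure_smult:
  assumes "c \<in> carrier K" "a \<in> carrier A" "b \<in> carrier B"
  shows "pure (c \<odot>\<^bsub>A\<^esub> a) b = c \<odot>\<^bsub>C\<^esub> pure a b" "pure a (c \<odot>\<^bsub>B\<^esub> b) = c \<odot>\<^bsub>C\<^esub> pure a b"
proof -
  show 1: "pure (c \<odot>\<^bsub>A\<^esub> a) b = c \<odot>\<^bsub>C\<^esub> pure a b"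
    unfolding pure_def using assms by (simp add: C_smult keys_pair)
  have "pure (c \<odot>\<^bsub>A\<^esub> a) b = pure a (c \<odot>\<^bsub>B\<^esub> b)"
    unfolding pure_def using assms by (intro cls_eqI R_balanced)
  with 1 show "pure a (c \<odot>\<^bsub>B\<^esub> b) = c \<odot>\<^bsub>C\<^esub> pure a b" by simp
qed

lemma pure_mult:
  assumes "a \<in> carrier A" "b \<in> carrier B" "a' \<in> carrier A" "b' \<in> carrier B"
  shows "pure a b \<otimes>\<^bsub>C\<^esub> pure a' b' = pure (a \<otimes>\<^bsub>A\<^esub> a') (b \<otimes>\<^bsub>B\<^esub> b')"
  unfolding pure_def using assms by (simp add: C_mult keys_pair)

lemma one_pure: "\<one>\<^bsub>C\<^esub> = pure \<one>\<^bsub>A\<^esub> \<one>\<^bsub>B\<^esub>"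
  by (simp add: pure_def C_sel)

lemma C_induct [consumes 1, case_names zero pure add]:
  assumes "U \<in> carrier C" and "P \<zero>\<^bsub>C\<^esub>"
    and "\<And>a b. a \<in> carrier A \<Longrightarrow> b \<in> carrier B \<Longrightarrow> P (pure a b)"
    and "\<And>U V. U \<in> carrier C \<Longrightarrow> V \<in> carrier C \<Longrightarrow> P U \<Longrightarrow> P V \<Longrightarrow> P (U \<oplus>\<^bsub>C\<^esub> V)"
  shows "P U"
proof -
  have eq: "carrier C = carrier T" "add C = monoid.mult T" by (simp_all add: tensor_algebra_def)
  show ?thesis
    using assms(1) unfolding eq
    by (induction rule: T_induct) (use assms(2-4) in \<open>simp_all add: C_sel(2) pure_def eq\<close>)
qed

lemma C_lift:
  assumes G: "abelian_group G"
    and "\<And>a b. a \<in> carrier A \<Longrightarrow> b \<in> carrier B \<Longrightarrow> \<beta> a b \<in> carrier G"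
    and "\<And>a a' b. a \<in> carrier A \<Longrightarrow> a' \<in> carrier A \<Longrightarrow> b \<in> carrier B \<Longrightarrow> \<beta> (a \<oplus>\<^bsub>A\<^esub> a') b = \<beta> a b \<oplus>\<^bsub>G\<^esub> \<beta> a' b"
    and "\<And>a b b'. a \<in> carrier A \<Longrightarrow> b \<in> carrier B \<Longrightarrow> b' \<in> carrier B \<Longrightarrow> \<beta> a (b \<oplus>\<^bsub>B\<^esub> b') = \<beta> a b \<oplus>\<^bsub>G\<^esub> \<beta> a b'"
    and "\<And>c a b. c \<in> carrier K \<Longrightarrow> a \<in> carrier A \<Longrightarrow> b \<in> carrier B \<Longrightarrow> \<beta> (c \<odot>\<^bsub>A\<^esub> a) b = \<beta> a (c \<odot>\<^bsub>B\<^esub> b)"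
  shows "\<exists>h. (\<forall>U\<in>carrier C. h U \<in> carrier G) \<and>
    (\<forall>U\<in>carrier C. \<forall>V\<in>carrier C. h (U \<oplus>\<^bsub>C\<^esub> V) = h U \<oplus>\<^bsub>G\<^esub> h V) \<and>
    (\<forall>a\<in>carrier A. \<forall>b\<in>carrier B. h (pure a b) = \<beta> a b)"
proof -
  interpret G: abelian_group G by fact
  obtain h where hl: "is_lift G \<beta> h" using lift[OF assms] by blast
  note h = is_liftD[OF hl]
  \<comment> \<open>Any representative serves, since \<open>h\<close> vanishes on the
    relations.\<close>
  define h' where "h' U = h (SOME u. u \<in> U)" for U
  have h': "h' (cls u) = h u" if u: "Poly_Mapping.keys u \<subseteq> S" for u
  proof -
    define v where "v = (SOME v. v \<in> cls u)"
    have "v \<in> cls u" unfolding v_def by (rule someI[of "\<lambda>v. v \<in> cls u", OF cls_self])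
    then have vu: "v - u \<in> R" by (simp add: in_cls_iff)
    have "h ((v - u) + u) = h u" unfolding h(2)[OF R_F[OF vu] u] h(5)[OF vu] using h(1)[OF u] by simp
    then show ?thesis by (simp add: h'_def v_def)
  qed
  show ?thesis
    by (rule exI[of _ h']) (auto simp: C_sel(1,4) pure_def h' h(1,2,4) keys_pair keys_add_S)
qed

lemma tensor_form_ex:
  assumes \<alpha>: "\<alpha> \<in> carrier (coreg K A)" and \<beta>: "\<beta> \<in> carrier (coreg K B)"
  shows "\<exists>\<omega>\<in>carrier (coreg K C). \<forall>a\<in>carrier A. \<forall>b\<in>carrier B. \<omega> (pure a b) = \<alpha> a \<otimes>\<^bsub>K\<^esub> \<beta> b"
proof -
  note \<alpha>D = A.coregD[OF \<alpha>] and \<beta>D = B.coregD[OF \<beta>]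
  have "\<exists>h. (\<forall>U\<in>carrier C. h U \<in> carrier K) \<and>
      (\<forall>U\<in>carrier C. \<forall>V\<in>carrier C. h (U \<oplus>\<^bsub>C\<^esub> V) = h U \<oplus>\<^bsub>K\<^esub> h V) \<and>
      (\<forall>a\<in>carrier A. \<forall>b\<in>carrier B. h (pure a b) = \<alpha> a \<otimes>\<^bsub>K\<^esub> \<beta> b)"
    by (rule C_lift[OF A.K.abelian_group_axioms])
       (use \<alpha>D \<beta>D in \<open>auto simp: A.K.l_distr A.K.r_distr A.K.m_ac\<close>)
  then obtain h where h: "\<And>U. U \<in> carrier C \<Longrightarrow> h U \<in> carrier K"
    "\<And>U V. U \<in> carrier C \<Longrightarrow> V \<in> carrier C \<Longrightarrow> h (U \<oplus>\<^bsub>C\<^esub> V) = h U \<oplus>\<^bsub>K\<^esub> h V"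
    "\<And>a b. a \<in> carrier A \<Longrightarrow> b \<in> carrier B \<Longrightarrow> h (pure a b) = \<alpha> a \<otimes>\<^bsub>K\<^esub> \<beta> b"
    by blast
  have h0: "h \<zero>\<^bsub>C\<^esub> = \<zero>\<^bsub>K\<^esub>"
    by (rule additive_zero[OF C.A.abelian_group_axioms A.K.abelian_group_axioms h(1,2)])
  have "h (c \<odot>\<^bsub>C\<^esub> U) = c \<otimes>\<^bsub>K\<^esub> h U" if c: "c \<in> carrier K" and U: "U \<in> carrier C" for c U
    using U
  proof (induction rule: C_induct)
    case zero
    then show ?case using c h0 by (simp add: C.AM.smult_r_null)
  next
    case (pure a b)
    then have "h (pure (c \<odot>\<^bsub>A\<^esub> a) b) = c \<otimes>\<^bsub>K\<^esub> h (pure a b)"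
      using c \<alpha>D \<beta>D h(3) by (simp add: A.K.m_assoc)
    then show ?case using c pure by (simp add: pure_smult)
  next
    case (add U V)
    then show ?case using c h by (simp add: C.AM.smult_r_distr A.K.r_distr)
  qed
  then have "(\<lambda>U\<in>carrier C. h U) \<in> carrier (coreg K C)" using h by (intro C.coregI) auto
  then show ?thesis using h(3) pure_closed by (intro bexI[of _ "\<lambda>U\<in>carrier C. h U"]) auto
qed

text \<open>The form \<open>\<alpha> \<otimes> \<beta>\<close>. A form is determined by its values
  on pure tensors, so the choice has a single candidate.\<close>

definition tform :: "('a \<Rightarrow> 'k) \<Rightarrow> ('b \<Rightarrow> 'k) \<Rightarrow> ('a \<times> 'b \<Rightarrow>\<^sub>0 int) set \<Rightarrow> 'k" where
  "tform \<alpha> \<beta> = (SOME \<omega>. \<omega> \<in> carrier (coreg K C) \<and>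
     (\<forall>a\<in>carrier A. \<forall>b\<in>carrier B. \<omega> (pure a b) = \<alpha> a \<otimes>\<^bsub>K\<^esub> \<beta> b))"

lemma tform:
  assumes "\<alpha> \<in> carrier (coreg K A)" "\<beta> \<in> carrier (coreg K B)"
  shows "tform \<alpha> \<beta> \<in> carrier (coreg K C)"
    and "a \<in> carrier A \<Longrightarrow> b \<in> carrier B \<Longrightarrow> tform \<alpha> \<beta> (pure a b) = \<alpha> a \<otimes>\<^bsub>K\<^esub> \<beta> b"
proof -
  have "\<exists>\<omega>. \<omega> \<in> carrier (coreg K C) \<and> (\<forall>a\<in>carrier A. \<forall>b\<in>carrier B. \<omega> (pure a b) = \<alpha> a \<otimes>\<^bsub>K\<^esub> \<beta> b)"
    using tensor_form_ex[OF assms] by (simp only: Bex_def)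
  from someI_ex[OF this] have "tform \<alpha> \<beta> \<in> carrier (coreg K C) \<and>
     (\<forall>a\<in>carrier A. \<forall>b\<in>carrier B. tform \<alpha> \<beta> (pure a b) = \<alpha> a \<otimes>\<^bsub>K\<^esub> \<beta> b)"
    unfolding tform_def .
  then show "tform \<alpha> \<beta> \<in> carrier (coreg K C)"
    and "a \<in> carrier A \<Longrightarrow> b \<in> carrier B \<Longrightarrow> tform \<alpha> \<beta> (pure a b) = \<alpha> a \<otimes>\<^bsub>K\<^esub> \<beta> b" by auto
qed

lemma pure_finsum:
  assumes "b \<in> carrier B" "f \<in> I \<rightarrow> carrier A"
  shows "pure (\<Oplus>\<^bsub>A\<^esub>i\<in>I. f i) b = (\<Oplus>\<^bsub>C\<^esub>i\<in>I. pure (f i) b)"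
  using assms pure_closed pure_add
  by (intro additive_finsum[where f = "\<lambda>a. pure a b", OF A.A.abelian_group_axioms C.A.abelian_group_axioms]) auto

lemma pure_finsum_right:
  assumes "a \<in> carrier A" "f \<in> I \<rightarrow> carrier B"
  shows "pure a (\<Oplus>\<^bsub>B\<^esub>i\<in>I. f i) = (\<Oplus>\<^bsub>C\<^esub>i\<in>I. pure a (f i))"
  using assms pure_closed pure_add
  by (intro additive_finsum[where f = "\<lambda>b. pure a b", OF B.A.abelian_group_axioms C.A.abelian_group_axioms]) auto

text \<open>The coordinate forms are themselves products. Hence the forms \<open>tform\<close>
  separate points, and the enveloping algebra receives the coordinates that
  \<open>nakayama_exact\<close> asks for.\<close>

lemma tensor_dual_basis:
  assumes dbA: "dual_basis K A I e \<xi>" and dbB: "dual_basis K B J e' \<xi>'"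
  shows "dual_basis K C (I \<times> J) (\<lambda>p. pure (e (fst p)) (e' (snd p)))
    (\<lambda>p. tform (restrict (\<xi> (fst p)) (carrier A)) (restrict (\<xi>' (snd p)) (carrier B)))"
proof -
  have a: "finite I" "\<And>i. i \<in> I \<Longrightarrow> e i \<in> carrier A" "\<And>i. i \<in> I \<Longrightarrow> form K A (\<xi> i)"
    "\<And>v. v \<in> carrier A \<Longrightarrow> (\<Oplus>\<^bsub>A\<^esub>i\<in>I. \<xi> i v \<odot>\<^bsub>A\<^esub> e i) = v"
    using dbA by (auto simp: dual_basis_def)
  have b: "finite J" "\<And>i. i \<in> J \<Longrightarrow> e' i \<in> carrier B" "\<And>i. i \<in> J \<Longrightarrow> form K B (\<xi>' i)"
    "\<And>v. v \<in> carrier B \<Longrightarrow> (\<Oplus>\<^bsub>B\<^esub>i\<in>J. \<xi>' i v \<odot>\<^bsub>B\<^esub> e' i) = v"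
    using dbB by (auto simp: dual_basis_def)
  have ra: "restrict (\<xi> i) (carrier A) \<in> carrier (coreg K A)" if "i \<in> I" for i
    using a(3)[OF that] by (intro A.coregI) (auto simp: form_closed form_add form_smult)
  have rb: "restrict (\<xi>' j) (carrier B) \<in> carrier (coreg K B)" if "j \<in> J" for j
    using b(3)[OF that] by (intro B.coregI) (auto simp: form_closed form_add form_smult)
  define \<zeta> where "\<zeta> p = tform (restrict (\<xi> (fst p)) (carrier A)) (restrict (\<xi>' (snd p)) (carrier B))" for p
  define \<epsilon> where "\<epsilon> p = pure (e (fst p)) (e' (snd p))" for p
  have \<zeta>: "\<zeta> p \<in> carrier (coreg K C)" if "p \<in> I \<times> J" for p
    unfolding \<zeta>_def using that ra rb by (intro tform(1)) auto
  have \<zeta>p: "\<zeta> (i, j) (pure x y) = \<xi> i x \<otimes>\<^bsub>K\<^esub> \<xi>' j y"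
    if "i \<in> I" "j \<in> J" "x \<in> carrier A" "y \<in> carrier B" for i j x y
    unfolding \<zeta>_def using that tform(2)[OF ra rb] by simp
  note \<zeta>D = C.coregD[OF \<zeta>]
  have \<epsilon>: "\<epsilon> \<in> I \<times> J \<rightarrow> carrier C"
    unfolding \<epsilon>_def using a(2) b(2) by (auto intro: pure_closed)
  have \<zeta>c: "(\<lambda>p. \<zeta> p U) \<in> I \<times> J \<rightarrow> carrier K" if "U \<in> carrier C" for U using \<zeta>D that by auto
  have "U = (\<Oplus>\<^bsub>C\<^esub>p\<in>I \<times> J. \<zeta> p U \<odot>\<^bsub>C\<^esub> \<epsilon> p)" if "U \<in> carrier C" for U
    using that
  proof (induction rule: C_induct)
    case zero
    have "(\<Oplus>\<^bsub>C\<^esub>p\<in>I \<times> J. \<zeta> p \<zero>\<^bsub>C\<^esub> \<odot>\<^bsub>C\<^esub> \<epsilon> p) = (\<Oplus>\<^bsub>C\<^esub>p\<in>I \<times> J. \<zero>\<^bsub>C\<^esub>)"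
    proof (rule C.A.finsum_cong'[OF refl])
      fix p assume p: "p \<in> I \<times> J"
      then show "\<zeta> p \<zero>\<^bsub>C\<^esub> \<odot>\<^bsub>C\<^esub> \<epsilon> p = \<zero>\<^bsub>C\<^esub>"
        using C.vs.form_zero[OF \<zeta>D(4)[OF p]] \<epsilon> by (auto simp: Pi_iff C.AM.smult_l_null)
    qed simp
    then show ?case by simp
  next
    case (add U V)
    have "(\<Oplus>\<^bsub>C\<^esub>p\<in>I \<times> J. \<zeta> p (U \<oplus>\<^bsub>C\<^esub> V) \<odot>\<^bsub>C\<^esub> \<epsilon> p) = (\<Oplus>\<^bsub>C\<^esub>p\<in>I \<times> J. (\<zeta> p U \<oplus>\<^bsub>K\<^esub> \<zeta> p V) \<odot>\<^bsub>C\<^esub> \<epsilon> p)"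
    proof (rule C.A.finsum_cong'[OF refl])
      fix p assume p: "p \<in> I \<times> J"
      then show "\<zeta> p (U \<oplus>\<^bsub>C\<^esub> V) \<odot>\<^bsub>C\<^esub> \<epsilon> p = (\<zeta> p U \<oplus>\<^bsub>K\<^esub> \<zeta> p V) \<odot>\<^bsub>C\<^esub> \<epsilon> p"
        using \<zeta>D(2)[OF p add.hyps] by simp
    next
      show "(\<lambda>p. (\<zeta> p U \<oplus>\<^bsub>K\<^esub> \<zeta> p V) \<odot>\<^bsub>C\<^esub> \<epsilon> p) \<in> I \<times> J \<rightarrow> carrier C"
        using \<zeta>c[OF add.hyps(1)] \<zeta>c[OF add.hyps(2)] \<epsilon> by (auto simp: Pi_iff)
    qed
    also have "\<dots> = U \<oplus>\<^bsub>C\<^esub> V"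
      using C.vs.comb_add[OF \<zeta>c[OF add.hyps(1)] \<zeta>c[OF add.hyps(2)] \<epsilon>] add.IH by simp
    finally show ?case by simp
  next
    case (pure x y)
    note xi = form_closed[OF a(3) pure(1)] and yj = form_closed[OF b(3) pure(2)]
    have t: "\<zeta> (i, j) (pure x y) \<odot>\<^bsub>C\<^esub> \<epsilon> (i, j) = pure (\<xi> i x \<odot>\<^bsub>A\<^esub> e i) (\<xi>' j y \<odot>\<^bsub>B\<^esub> e' j)"
      if i: "i \<in> I" and j: "j \<in> J" for i j
      using i j a(2) b(2) xi yj pure pure_closed
      by (simp add: \<zeta>p \<epsilon>_def pure_smult A.K.m_comm flip: C.AM.smult_assoc1)
    have cl: "\<xi> i x \<odot>\<^bsub>A\<^esub> e i \<in> carrier A" "\<xi>' j y \<odot>\<^bsub>B\<^esub> e' j \<in> carrier B" if "i \<in> I" "j \<in> J" for i j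
      using that a(2) b(2) xi yj by auto
    have "(\<Oplus>\<^bsub>C\<^esub>p\<in>I \<times> J. \<zeta> p (pure x y) \<odot>\<^bsub>C\<^esub> \<epsilon> p) =
        (\<Oplus>\<^bsub>C\<^esub>p\<in>I \<times> J. \<zeta> (fst p, snd p) (pure x y) \<odot>\<^bsub>C\<^esub> \<epsilon> (fst p, snd p))" by simp
    also have "\<dots> = (\<Oplus>\<^bsub>C\<^esub>i\<in>I. \<Oplus>\<^bsub>C\<^esub>j\<in>J. \<zeta> (i, j) (pure x y) \<odot>\<^bsub>C\<^esub> \<epsilon> (i, j))"
      by (rule C.A.finsum_Times[OF a(1) b(1)]) (use t cl pure_closed in simp)
    also have "\<dots> = (\<Oplus>\<^bsub>C\<^esub>i\<in>I. pure (\<xi> i x \<odot>\<^bsub>A\<^esub> e i) y)"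
    proof (rule C.A.finsum_cong'[OF refl])
      show "(\<lambda>i. pure (\<xi> i x \<odot>\<^bsub>A\<^esub> e i) y) \<in> I \<rightarrow> carrier C"
        using a(2) xi pure(2) by (auto intro!: pure_closed)
      fix i assume i: "i \<in> I"
      have "(\<Oplus>\<^bsub>C\<^esub>j\<in>J. \<zeta> (i, j) (pure x y) \<odot>\<^bsub>C\<^esub> \<epsilon> (i, j)) = (\<Oplus>\<^bsub>C\<^esub>j\<in>J. pure (\<xi> i x \<odot>\<^bsub>A\<^esub> e i) (\<xi>' j y \<odot>\<^bsub>B\<^esub> e' j))"
        using t[OF i] cl[OF i] pure_closed by (intro C.A.finsum_cong'[OF refl]) auto
      also have "\<dots> = pure (\<xi> i x \<odot>\<^bsub>A\<^esub> e i) (\<Oplus>\<^bsub>B\<^esub>j\<in>J. \<xi>' j y \<odot>\<^bsub>B\<^esub> e' j)"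
        using b(2) yj a(2)[OF i] xi[OF i] by (intro pure_finsum_right[symmetric]) auto
      finally show "(\<Oplus>\<^bsub>C\<^esub>j\<in>J. \<zeta> (i, j) (pure x y) \<odot>\<^bsub>C\<^esub> \<epsilon> (i, j)) = pure (\<xi> i x \<odot>\<^bsub>A\<^esub> e i) y"
        using b(4)[OF pure(2)] by simp
    qed
    also have "\<dots> = pure (\<Oplus>\<^bsub>A\<^esub>i\<in>I. \<xi> i x \<odot>\<^bsub>A\<^esub> e i) y"
      using a(2) xi pure(2) by (intro pure_finsum[symmetric]) auto
    also have "\<dots> = pure x y" using a(4)[OF pure(1)] by simp
    finally show ?case by simp
  qed
  then have "dual_basis K C (I \<times> J) \<epsilon> \<zeta>"
    unfolding dual_basis_def using a(1) b(1) \<epsilon> \<zeta>D(4) by auto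
  then show ?thesis unfolding \<epsilon>_def \<zeta>_def .
qed

end

locale fd_algebra_pair = A: fd_alg K A + B: fd_alg K B
  for K :: "'k ring" and A :: "('k, 'a) module" and B :: "('k, 'b) module"

sublocale fd_algebra_pair \<subseteq> algebra_pair
  by unfold_locales

section \<open>Tensor products of homomorphisms and of traces\<close>

context fd_algebra_pair begin

lemma tform_separates:
  assumes UV: "U \<in> carrier C" "V \<in> carrier C"
    and eq: "\<And>\<alpha> \<beta>. \<alpha> \<in> carrier (coreg K A) \<Longrightarrow> \<beta> \<in> carrier (coreg K B) \<Longrightarrow> tform \<alpha> \<beta> U = tform \<alpha> \<beta> V"
  shows "U = V"
proof -
  obtain I \<xi> where dbA: "dual_basis K A I (\<lambda>b. b) \<xi>" using A.vs.ex_dual_basis[OF A.fin_dim] by blast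
  obtain J \<xi>' where dbB: "dual_basis K B J (\<lambda>b. b) \<xi>'" using B.vs.ex_dual_basis[OF B.fin_dim] by blast
  have ra: "restrict (\<xi> i) (carrier A) \<in> carrier (coreg K A)" if "i \<in> I" for i
    using dbA that by (intro A.coregI) (auto simp: dual_basis_def mod_lin_def)
  have rb: "restrict (\<xi>' j) (carrier B) \<in> carrier (coreg K B)" if "j \<in> J" for j
    using dbB that by (intro B.coregI) (auto simp: dual_basis_def mod_lin_def)
  show ?thesis
    using eq ra rb by (intro C.vs.dual_basis_separates[OF tensor_dual_basis[OF dbA dbB] UV]) auto
qed

lemma tform_left_mult:
  assumes \<alpha>: "\<alpha> \<in> carrier (coreg K A)" and \<beta>: "\<beta> \<in> carrier (coreg K B)"
    and a: "a \<in> carrier A" and b: "b \<in> carrier B" and W: "W \<in> carrier C"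
  shows "tform \<alpha> \<beta> (pure a b \<otimes>\<^bsub>C\<^esub> W) =
    tform (\<lambda>x\<in>carrier A. \<alpha> (a \<otimes>\<^bsub>A\<^esub> x)) (\<lambda>y\<in>carrier B. \<beta> (b \<otimes>\<^bsub>B\<^esub> y)) W"
proof -
  note tr = A.coreg_translate_left[OF \<alpha> a] B.coreg_translate_left[OF \<beta> b]
  note t1 = tform[OF \<alpha> \<beta>] and t2 = tform[OF tr]
  note d1 = C.coregD[OF t1(1)] and d2 = C.coregD[OF t2(1)]
  show ?thesis
    using W
  proof (induction rule: C_induct)
    case zero
    have "pure a b \<otimes>\<^bsub>C\<^esub> \<zero>\<^bsub>C\<^esub> = \<zero>\<^bsub>C\<^esub>" using pure_closed[OF a b] by simp
    then show ?case by (simp only: C.vs.form_zero[OF d1(4)] C.vs.form_zero[OF d2(4)])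
  next
    case (pure x y)
    then have "tform \<alpha> \<beta> (pure a b \<otimes>\<^bsub>C\<^esub> pure x y) = \<alpha> (a \<otimes>\<^bsub>A\<^esub> x) \<otimes>\<^bsub>K\<^esub> \<beta> (b \<otimes>\<^bsub>B\<^esub> y)"
      using a b by (simp add: pure_mult t1)
    then show ?case unfolding t2(2)[OF pure] using pure by simp
  next
    case (add U V)
    then have "tform \<alpha> \<beta> (pure a b \<otimes>\<^bsub>C\<^esub> (U \<oplus>\<^bsub>C\<^esub> V)) =
        tform \<alpha> \<beta> (pure a b \<otimes>\<^bsub>C\<^esub> U) \<oplus>\<^bsub>K\<^esub> tform \<alpha> \<beta> (pure a b \<otimes>\<^bsub>C\<^esub> V)"
      using pure_closed[OF a b] by (simp add: C.A.r_distr d1(2))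
    then show ?case unfolding d2(2)[OF add.hyps] add.IH .
  qed
qed

text \<open>The displayed property determines \<open>g\<close>, so that additivity and linearity of \<open>\<Psi> \<mapsto> g\<close> can be
  read off from the adjoints instead of from the sum defining it.\<close>

lemma tensor_hom_ex:
  assumes GH: "adjoint_pair K A G H" and GH': "adjoint_pair K B G' H'"
    and \<Psi>: "\<Psi> \<in> carrier (coreg K C)"
  shows "\<exists>g\<in>carrier C. \<forall>\<alpha>\<in>carrier (coreg K A). \<forall>\<beta>\<in>carrier (coreg K B).
    tform \<alpha> \<beta> g = \<Psi> (pure (H \<alpha>) (H' \<beta>))"
proof -
  note \<Psi>D = C.coregD[OF \<Psi>]
  note G = A.adjoint_pairD[OF GH] and G' = B.adjoint_pairD[OF GH']
  obtain J \<xi> where db: "dual_basis K B J (\<lambda>b. b) \<xi>" using B.vs.ex_dual_basis[OF B.fin_dim] by blast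
  have J: "finite J" "\<And>j. j \<in> J \<Longrightarrow> j \<in> carrier B" "\<And>j. j \<in> J \<Longrightarrow> form K B (\<xi> j)"
    "\<And>y. y \<in> carrier B \<Longrightarrow> (\<Oplus>\<^bsub>B\<^esub>j\<in>J. \<xi> j y \<odot>\<^bsub>B\<^esub> j) = y"
    using db by (auto simp: dual_basis_def)
  \<comment> \<open>Expanding \<open>y\<close> in coordinates shows that \<open>\<Psi>\<close> is
    the sum of the products \<open>\<psi> j \<otimes> \<chi> j\<close>; accordingly \<open>g\<close>
    is the sum of the \<open>G (\<psi> j) \<otimes> G' (\<chi> j)\<close>.\<close>
  define \<psi> where "\<psi> j = (\<lambda>x\<in>carrier A. \<Psi> (pure x j))" for j
  define \<chi> where "\<chi> j = (\<lambda>y\<in>carrier B. \<xi> j y)" for j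
  have \<psi>: "\<psi> j \<in> carrier (coreg K A)" if "j \<in> J" for j
    unfolding \<psi>_def using J(2)[OF that] \<Psi>D pure_closed
    by (intro A.coregI) (auto simp: pure_add pure_smult)
  have \<chi>: "\<chi> j \<in> carrier (coreg K B)" if "j \<in> J" for j
    unfolding \<chi>_def using J(3)[OF that] by (intro B.coregI) (auto simp: form_closed form_add form_smult)
  have cl: "pure (G (\<psi> j)) (G' (\<chi> j)) \<in> carrier C" if "j \<in> J" for j
    using A.hom_closed[OF G(1) \<psi>[OF that]] B.hom_closed[OF G'(1) \<chi>[OF that]] by (rule pure_closed)
  define g where "g = (\<Oplus>\<^bsub>C\<^esub>j\<in>J. pure (G (\<psi> j)) (G' (\<chi> j)))"
  have gC: "g \<in> carrier C" unfolding g_def using cl by (intro C.A.finsum_closed) auto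
  have "tform \<alpha> \<beta> g = \<Psi> (pure (H \<alpha>) (H' \<beta>))"
    if \<alpha>: "\<alpha> \<in> carrier (coreg K A)" and \<beta>: "\<beta> \<in> carrier (coreg K B)" for \<alpha> \<beta>
  proof -
    note t = tform[OF \<alpha> \<beta>] and tD = C.coregD[OF tform(1)[OF \<alpha> \<beta>]]
    note H\<alpha> = G(2)[OF \<alpha>] and H\<beta> = G'(2)[OF \<beta>]
    note \<xi>H = form_closed[OF J(3) H\<beta>]
    have "tform \<alpha> \<beta> g = (\<Oplus>\<^bsub>K\<^esub>j\<in>J. tform \<alpha> \<beta> (pure (G (\<psi> j)) (G' (\<chi> j))))"
      unfolding g_def using tD cl
      by (intro additive_finsum[OF C.A.abelian_group_axioms A.K.abelian_group_axioms]) auto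
    also have "\<dots> = (\<Oplus>\<^bsub>K\<^esub>j\<in>J. \<Psi> (pure (H \<alpha>) (\<xi> j (H' \<beta>) \<odot>\<^bsub>B\<^esub> j)))"
    proof (rule A.K.finsum_cong'[OF refl])
      fix j assume j: "j \<in> J"
      have "tform \<alpha> \<beta> (pure (G (\<psi> j)) (G' (\<chi> j))) = \<alpha> (G (\<psi> j)) \<otimes>\<^bsub>K\<^esub> \<beta> (G' (\<chi> j))"
        using t(2) A.hom_closed[OF G(1) \<psi>[OF j]] B.hom_closed[OF G'(1) \<chi>[OF j]] by simp
      also have "\<dots> = \<Psi> (pure (H \<alpha>) j) \<otimes>\<^bsub>K\<^esub> \<xi> j (H' \<beta>)"
        using G(3)[OF \<alpha> \<psi>[OF j]] G'(3)[OF \<beta> \<chi>[OF j]] H\<alpha> H\<beta> by (simp add: \<psi>_def \<chi>_def)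
      also have "\<dots> = \<Psi> (pure (H \<alpha>) (\<xi> j (H' \<beta>) \<odot>\<^bsub>B\<^esub> j))"
        using \<xi>H[OF j] H\<alpha> J(2)[OF j] \<Psi>D pure_closed by (simp add: pure_smult A.K.m_comm)
      finally show "tform \<alpha> \<beta> (pure (G (\<psi> j)) (G' (\<chi> j))) = \<Psi> (pure (H \<alpha>) (\<xi> j (H' \<beta>) \<odot>\<^bsub>B\<^esub> j))" .
    next
      show "(\<lambda>j. \<Psi> (pure (H \<alpha>) (\<xi> j (H' \<beta>) \<odot>\<^bsub>B\<^esub> j))) \<in> J \<rightarrow> carrier K"
        using \<xi>H H\<alpha> J(2) \<Psi>D(1) pure_closed by auto
    qed
    also have "\<dots> = \<Psi> (\<Oplus>\<^bsub>C\<^esub>j\<in>J. pure (H \<alpha>) (\<xi> j (H' \<beta>) \<odot>\<^bsub>B\<^esub> j))"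
      using \<Psi>D \<xi>H H\<alpha> J(2) pure_closed
      by (intro additive_finsum[symmetric] C.A.abelian_group_axioms A.K.abelian_group_axioms) auto
    also have "(\<Oplus>\<^bsub>C\<^esub>j\<in>J. pure (H \<alpha>) (\<xi> j (H' \<beta>) \<odot>\<^bsub>B\<^esub> j)) = pure (H \<alpha>) (\<Oplus>\<^bsub>B\<^esub>j\<in>J. \<xi> j (H' \<beta>) \<odot>\<^bsub>B\<^esub> j)"
      using \<xi>H H\<alpha> J(2) by (intro pure_finsum_right[symmetric]) auto
    finally show ?thesis using J(4)[OF H\<beta>] by simp
  qed
  with gC show ?thesis by blast
qed

text \<open>\<open>L\<close> is \<open>G \<otimes> G'\<close>, with the dual of the tensor product
  identified with the tensor product of the duals. Its linearity is tested against the forms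
  \<open>tform \<alpha> \<beta>\<close>, which separate points.\<close>

lemma tensor_hom:
  assumes G: "mod_lin A (coreg K A) (regular_module A) G" and \<phi>: "\<phi> \<in> carrier (coreg K A)"
    and G': "mod_lin B (coreg K B) (regular_module B) G'" and \<phi>': "\<phi>' \<in> carrier (coreg K B)"
  shows "\<exists>L. mod_lin C (coreg K C) (regular_module C) L \<and> L (tform \<phi> \<phi>') = pure (G \<phi>) (G' \<phi>')"
proof -
  obtain H where GH: "adjoint_pair K A G H" using A.ex_adjoint[OF G] by blast
  obtain H' where GH': "adjoint_pair K B G' H'" using B.ex_adjoint[OF G'] by blast
  note H = A.adjoint_pairD(2,3)[OF GH] and H' = B.adjoint_pairD(2,3)[OF GH']
  have "\<exists>L. \<forall>\<Psi>\<in>carrier (coreg K C). L \<Psi> \<in> carrier C \<and> (\<forall>\<alpha>\<in>carrier (coreg K A). \<forall>\<beta>\<in>carrier (coreg K B).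
      tform \<alpha> \<beta> (L \<Psi>) = \<Psi> (pure (H \<alpha>) (H' \<beta>)))"
    using tensor_hom_ex[OF GH GH'] by (intro bchoice) blast
  then obtain L where L: "\<And>\<Psi>. \<Psi> \<in> carrier (coreg K C) \<Longrightarrow> L \<Psi> \<in> carrier C"
    "\<And>\<Psi> \<alpha> \<beta>. \<Psi> \<in> carrier (coreg K C) \<Longrightarrow> \<alpha> \<in> carrier (coreg K A) \<Longrightarrow> \<beta> \<in> carrier (coreg K B) \<Longrightarrow>
      tform \<alpha> \<beta> (L \<Psi>) = \<Psi> (pure (H \<alpha>) (H' \<beta>))" by blast
  have pH: "pure (H \<alpha>) (H' \<beta>) \<in> carrier C"
    if "\<alpha> \<in> carrier (coreg K A)" "\<beta> \<in> carrier (coreg K B)" for \<alpha> \<beta>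
    using H(1) H'(1) that by (intro pure_closed)
  have "mod_lin C (coreg K C) (regular_module C) L"
  proof (rule mod_linI)
    fix \<Psi> assume \<Psi>: "\<Psi> \<in> carrier (coreg K C)"
    show "L \<Psi> \<in> carrier (regular_module C)" using L(1)[OF \<Psi>] by simp
    { fix \<Psi>' assume \<Psi>': "\<Psi>' \<in> carrier (coreg K C)"
      have s: "\<Psi> \<oplus>\<^bsub>coreg K C\<^esub> \<Psi>' \<in> carrier (coreg K C)" using \<Psi> \<Psi>' by (rule C.D.M.a_closed)
      have "L (\<Psi> \<oplus>\<^bsub>coreg K C\<^esub> \<Psi>') = L \<Psi> \<oplus>\<^bsub>C\<^esub> L \<Psi>'"
      proof (rule tform_separates)
        fix \<alpha> \<beta> assume \<alpha>\<beta>: "\<alpha> \<in> carrier (coreg K A)" "\<beta> \<in> carrier (coreg K B)"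
        show "tform \<alpha> \<beta> (L (\<Psi> \<oplus>\<^bsub>coreg K C\<^esub> \<Psi>')) = tform \<alpha> \<beta> (L \<Psi> \<oplus>\<^bsub>C\<^esub> L \<Psi>')"
          using C.coregD(2)[OF tform(1)[OF \<alpha>\<beta>] L(1)[OF \<Psi>] L(1)[OF \<Psi>']] pH[OF \<alpha>\<beta>]
          unfolding L(2)[OF s \<alpha>\<beta>] L(2)[OF \<Psi> \<alpha>\<beta>] L(2)[OF \<Psi>' \<alpha>\<beta>] by (simp add: coreg_sel)
      qed (use L(1) \<Psi> \<Psi>' s in auto)
      then show "L (\<Psi> \<oplus>\<^bsub>coreg K C\<^esub> \<Psi>') = L \<Psi> \<oplus>\<^bsub>regular_module C\<^esub> L \<Psi>'" by simp }
    { fix U assume U: "U \<in> carrier C"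
      have s: "U \<odot>\<^bsub>coreg K C\<^esub> \<Psi> \<in> carrier (coreg K C)" using C.D.smult_closed[OF U \<Psi>] .
      \<comment> \<open>For a pure \<open>U\<close> the right linearity of \<open>H\<close> and
        \<open>H'\<close> carries the factor from one side to the other; general \<open>U\<close>
        follows by additivity.\<close>
      have "tform \<alpha> \<beta> (U \<otimes>\<^bsub>C\<^esub> L \<Psi>) = \<Psi> (pure (H \<alpha>) (H' \<beta>) \<otimes>\<^bsub>C\<^esub> U)"
        if \<alpha>: "\<alpha> \<in> carrier (coreg K A)" and \<beta>: "\<beta> \<in> carrier (coreg K B)" for \<alpha> \<beta>
        using U
      proof (induction rule: C_induct)
        case zero
        then show ?case
          using C.vs.form_zero[OF C.coregD(4)[OF tform(1)[OF \<alpha> \<beta>]]] C.vs.form_zero[OF C.coregD(4)[OF \<Psi>]]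
            L(1)[OF \<Psi>] pH[OF \<alpha> \<beta>] by simp
      next
        case (pure a b)
        have "tform \<alpha> \<beta> (pure a b \<otimes>\<^bsub>C\<^esub> L \<Psi>) =
            \<Psi> (pure (H (\<lambda>x\<in>carrier A. \<alpha> (a \<otimes>\<^bsub>A\<^esub> x))) (H' (\<lambda>y\<in>carrier B. \<beta> (b \<otimes>\<^bsub>B\<^esub> y))))"
          using tform_left_mult[OF \<alpha> \<beta> pure L(1)[OF \<Psi>]]
            L(2)[OF \<Psi> A.coreg_translate_left[OF \<alpha> pure(1)] B.coreg_translate_left[OF \<beta> pure(2)]] by simp
        also have "\<dots> = \<Psi> (pure (H \<alpha> \<otimes>\<^bsub>A\<^esub> a) (H' \<beta> \<otimes>\<^bsub>B\<^esub> b))"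
          by (simp add: A.adjoint_right_mult[OF GH \<alpha> pure(1)] B.adjoint_right_mult[OF GH' \<beta> pure(2)])
        finally show ?case using H(1)[OF \<alpha>] H'(1)[OF \<beta>] pure by (simp add: pure_mult)
      next
        case (add U V)
        then show ?case
          using L(1)[OF \<Psi>] pH[OF \<alpha> \<beta>] C.coregD(2)[OF tform(1)[OF \<alpha> \<beta>]] C.coregD(2)[OF \<Psi>]
          by (simp add: C.A.l_distr C.A.r_distr)
      qed
      then have "L (U \<odot>\<^bsub>coreg K C\<^esub> \<Psi>) = U \<otimes>\<^bsub>C\<^esub> L \<Psi>"
        using s L U \<Psi> pH by (intro tform_separates) (simp_all add: C.coreg_smult_apply)
      then show "L (U \<odot>\<^bsub>coreg K C\<^esub> \<Psi>) = U \<odot>\<^bsub>regular_module C\<^esub> L \<Psi>" by simp }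
  qed
  moreover have "L (tform \<phi> \<phi>') = pure (G \<phi>) (G' \<phi>')"
  proof (rule tform_separates)
    note t = tform[OF \<phi> \<phi>'] and cl = A.hom_closed[OF G \<phi>] B.hom_closed[OF G' \<phi>']
    show "L (tform \<phi> \<phi>') \<in> carrier C" "pure (G \<phi>) (G' \<phi>') \<in> carrier C"
      using L(1)[OF t(1)] cl pure_closed by auto
    fix \<alpha> \<beta> assume \<alpha>\<beta>: "\<alpha> \<in> carrier (coreg K A)" "\<beta> \<in> carrier (coreg K B)"
    show "tform \<alpha> \<beta> (L (tform \<phi> \<phi>')) = tform \<alpha> \<beta> (pure (G \<phi>) (G' \<phi>'))"
      using L(2)[OF t(1) \<alpha>\<beta>] t(2)[OF H(1)[OF \<alpha>\<beta>(1)] H'(1)[OF \<alpha>\<beta>(2)]] tform(2)[OF \<alpha>\<beta> cl]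
        H(2)[OF \<alpha>\<beta>(1) \<phi>] H'(2)[OF \<alpha>\<beta>(2) \<phi>'] by simp
  qed
  ultimately show ?thesis by blast
qed

text \<open>A product of two values is a value of the map from \<open>tensor_hom\<close>. With both
  elements equal to \<open>1\<close> this transfers the trace condition to the tensor
  product.\<close>

theorem tensor_trace:
  assumes a: "a \<in> coreg_trace K A" and b: "b \<in> coreg_trace K B"
  shows "pure a b \<in> coreg_trace K C"
  using a
proof (induction rule: coreg_trace.induct)
  case zero
  have bB: "b \<in> carrier B" by (rule B.coreg_trace_closed[OF b])
  have "pure \<zero>\<^bsub>A\<^esub> b = \<zero>\<^bsub>C\<^esub>"
    by (rule additive_zero[OF A.A.abelian_group_axioms C.A.abelian_group_axioms, of "\<lambda>a. pure a b"])
       (use bB pure_closed pure_add in auto)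
  then show ?case using coreg_trace.zero[of C K] by simp
next
  case (add a G \<phi>)
  note G = add.hyps(2) and \<phi> = add.hyps(3)
  have aA: "a \<in> carrier A" by (rule A.coreg_trace_closed[OF add.hyps(1)])
  have gA: "G \<phi> \<in> carrier A" by (rule A.hom_closed[OF G \<phi>])
  have "pure (G \<phi>) b \<in> coreg_trace K C"
    using b
  proof (induction rule: coreg_trace.induct)
    case zero
    have "pure (G \<phi>) \<zero>\<^bsub>B\<^esub> = \<zero>\<^bsub>C\<^esub>"
      by (rule additive_zero[OF B.A.abelian_group_axioms C.A.abelian_group_axioms, of "\<lambda>b. pure (G \<phi>) b"])
         (use gA pure_closed pure_add in auto)
    then show ?case using coreg_trace.zero[of C K] by simp
  next
    case (add b G' \<phi>')
    obtain L where L: "mod_lin C (coreg K C) (regular_module C) L" "L (tform \<phi> \<phi>') = pure (G \<phi>) (G' \<phi>')"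
      using tensor_hom[OF G \<phi> add.hyps(2,3)] by blast
    have "pure (G \<phi>) b \<oplus>\<^bsub>C\<^esub> pure (G \<phi>) (G' \<phi>') \<in> coreg_trace K C"
      using coreg_trace.add[OF add.IH L(1) tform(1)[OF \<phi> add.hyps(3)]] L(2) by simp
    then show ?case
      using gA B.coreg_trace_closed[OF add.hyps(1)] B.hom_closed[OF add.hyps(2,3)] by (simp add: pure_add)
  qed
  then have "pure a b \<oplus>\<^bsub>C\<^esub> pure (G \<phi>) b \<in> coreg_trace K C" by (rule C.coreg_trace_add[OF add.IH])
  then show ?case using aA gA B.coreg_trace_closed[OF b] by (simp add: pure_add)
qed

end

section \<open>Ext and Tor\<close>

lemma trivial_factor_group:
  assumes G: "comm_group G" and Z: "subgroup Z G"
  shows "trivial_group (G\<lparr>carrier := Z\<rparr> Mod Z)"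
proof -
  have Zg: "comm_group (G\<lparr>carrier := Z\<rparr>)"
  proof -
    interpret G: comm_group G by fact
    have "group (G\<lparr>carrier := Z\<rparr>)" by (rule G.subgroup_imp_group[OF Z])
    then show ?thesis
      using subgroup.mem_carrier[OF Z] by (intro group.group_comm_groupI) (auto intro: G.m_comm)
  qed
  have sub: "subgroup Z (G\<lparr>carrier := Z\<rparr>)"
    using group.subgroup_self[OF comm_group.axioms(2)[OF Zg]] by simp
  have N: "Z \<lhd> G\<lparr>carrier := Z\<rparr>" by (rule comm_group.subgroup_imp_normal[OF Zg sub])
  have "carrier (G\<lparr>carrier := Z\<rparr> Mod Z) = {Z}"
    using group.coset_join2[OF comm_group.axioms(2)[OF Zg] _ sub] subgroup.one_closed[OF Z]
    by (auto simp: FactGroup_def RCOSETS_def)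
  then show ?thesis
    using normal.factorgroup_is_group[OF N] by (simp add: trivial_group_def FactGroup_def)
qed

text \<open>The cocycles are the maps that vanish on the image of \<open>d2\<close>, and
  \<open>hom_exact\<close> makes them coboundaries. Equations match the family \<open>Q\<close> to
  the triple, since the locale fixes three separate modules.\<close>

lemma (in exact_triple) Ext_trivial:
  fixes Q :: "nat \<Rightarrow> ('a, 'p) module"
  assumes n: "n \<ge> 1" and Q: "Q (Suc n) = P2" "Q n = P1" "Q (n - 1) = P0"
    and \<delta>: "\<delta> (Suc n) = d2" "\<delta> n = d1"
  shows "trivial_group (Ext A Q \<delta> (regular_module A) n)"
proof -
  let ?R = "regular_module A"
  \<comment> \<open>Maps into the regular module form the additive group of \<open>star A P\<close>,
    so the facts about stars apply.\<close>
  have sel: "carrier (hom_group A P ?R) = carrier (star A P)" "monoid.mult (hom_group A P ?R) = add (star A P)"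
    "\<one>\<^bsub>hom_group A P ?R\<^esub> = \<zero>\<^bsub>star A P\<^esub>" for P :: "('a, 'p) module"
    by (simp_all add: hom_group_def star_def)
  have grp: "comm_group (hom_group A P ?R)" if "left_module A P" for P :: "('a, 'p) module"
  proof -
    interpret S: abelian_group "star A P" by (rule star_abelian_group[OF A.ring_axioms that])
    show ?thesis
      by (rule comm_groupI) (auto simp: sel S.a_ac intro: S.add.l_inv_ex)
  qed
  note grp1 = grp[OF P1.left_module_axioms] and grp2 = grp[OF P2.left_module_axioms]
  have star_hom: "carrier (star A P) = mod_hom A P ?R" for P :: "('a, 'p) module" by (simp add: star_def)
  have s2: "star_map A P2 P1 d2 g \<in> carrier (star A P2)" "star_map A P2 P1 d2 g = compose (carrier P2) g d2"
    if "g \<in> carrier (star A P1)" for g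
    using star_map_closed[OF A.ring_axioms P2.left_module_axioms P1.left_module_axioms d2 that] that
    by (simp_all add: star_map_def)
  have hom: "star_map A P2 P1 d2 \<in> hom (hom_group A P1 ?R) (hom_group A P2 ?R)"
    using s2(1) star_map_add[OF P2.left_module_axioms P1.left_module_axioms d2 _ _ A.ring_axioms]
    by (intro homI) (auto simp: sel)
  interpret h: group_hom "hom_group A P1 ?R" "hom_group A P2 ?R" "star_map A P2 P1 d2"
    using hom comm_group.axioms(2)[OF grp1] comm_group.axioms(2)[OF grp2]
    by (simp add: group_hom_def group_hom_axioms_def)
  let ?Z = "kernel (hom_group A P1 ?R) (hom_group A P2 ?R) (star_map A P2 P1 d2)"
  have Z: "hom_cocycles A Q \<delta> ?R n = ?Z"
    unfolding hom_cocycles_def Q \<delta> kernel_def sel using s2(2) by auto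
  have Z_iff: "f \<in> ?Z \<longleftrightarrow> f \<in> mod_hom A P1 ?R \<and> (\<forall>x\<in>carrier P2. f (d2 x) = \<zero>)" for f
  proof -
    have "star_map A P2 P1 d2 f = \<zero>\<^bsub>star A P2\<^esub> \<longleftrightarrow> (\<forall>x\<in>carrier P2. f (d2 x) = \<zero>)"
      if "f \<in> carrier (star A P1)"
      unfolding s2(2)[OF that] by (auto simp: star_sel compose_def fun_eq_iff restrict_def)
    then show ?thesis by (auto simp: kernel_def sel star_hom)
  qed
  have "hom_coboundaries A Q \<delta> ?R n = ?Z"
  proof (intro equalityI subsetI)
    fix f assume "f \<in> ?Z"
    then show "f \<in> hom_coboundaries A Q \<delta> ?R n"
      using hom_exact[of f] n unfolding Z_iff hom_coboundaries_def Q \<delta> by auto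
  next
    fix f assume "f \<in> hom_coboundaries A Q \<delta> ?R n"
    then obtain h where h: "h \<in> mod_hom A P0 ?R" "f = compose (carrier P1) h d1"
      using n unfolding hom_coboundaries_def Q \<delta> by auto
    have hl: "mod_lin A P0 ?R h" using h by (simp add: mod_hom_iff)
    have "f = star_map A P1 P0 d1 h" using h by (simp add: star_map_def star_hom)
    then have "f \<in> carrier (star A P1)"
      using star_map_closed[OF A.ring_axioms P1.left_module_axioms P0.left_module_axioms d1] h by (simp add: star_hom)
    then show "f \<in> ?Z"
      unfolding Z_iff star_hom using hom_complex[OF hl] mod_lin_closed[OF d2_lin] h(2) by (simp add: compose_def)
  qed
  then show ?thesis
    unfolding Ext_def Z Q using trivial_factor_group[OF grp1 h.subgroup_kernel] by simp
qed

section \<open>Tor with the coregular module\<close>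

context fd_alg begin

lemma opposite_fd_alg: "fd_alg K (opposite A)"
proof -
  interpret op: kalg K "opposite A" by (rule opposite_kalg)
  have "add_monoid (opposite A) = add_monoid A" by (simp add: opposite_def)
  then have "finsum (opposite A) = (finsum A :: ('a \<Rightarrow> 'a) \<Rightarrow> 'a set \<Rightarrow> 'a)"
    by (simp only: finsum_def)
  then have "fin_dim K (opposite A)" using fin_dim by (simp add: fin_dim_def)
  then show ?thesis by unfold_locales
qed

lemma tensor_pair_coreg:
  assumes "left_module (opposite A) X"
  shows "tensor_pair A X (coreg K A)"
proof -
  interpret X: left_module "opposite A" X by fact
  show ?thesis
    by (intro tensor_pair.intro X.M.abelian_group_axioms D.M.abelian_group_axioms tensor_pair_axioms.intro)
       (use X.smult_closed D.smult_closed in auto)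
qed

text \<open>\<open>G\<close> induces \<open>X \<otimes> D A \<rightarrow> X \<otimes> A = X\<close>,
  sending \<open>t \<otimes> \<psi>\<close> to \<open>t G(\<psi>)\<close>; the right action is
  written as an action of the opposite algebra.\<close>

lemma contraction_lift:
  assumes X: "left_module (opposite A) X" and G: "mod_lin A (coreg K A) (regular_module A) G"
  shows "\<exists>h. tensor_pair.is_lift A X (coreg K A) X (\<lambda>t \<psi>. G \<psi> \<odot>\<^bsub>X\<^esub> t) h"
proof -
  interpret X: left_module "opposite A" X by fact
  interpret TX: tensor_pair A X "coreg K A" by (rule tensor_pair_coreg[OF X])
  note Gc = hom_closed[OF G]
  show ?thesis
  proof (rule TX.lift[OF X.M.abelian_group_axioms])
    fix t t' \<psi> assume "t \<in> carrier X" "t' \<in> carrier X" and \<psi>: "\<psi> \<in> carrier (coreg K A)"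
    then show "G \<psi> \<odot>\<^bsub>X\<^esub> (t \<oplus>\<^bsub>X\<^esub> t') = G \<psi> \<odot>\<^bsub>X\<^esub> t \<oplus>\<^bsub>X\<^esub> G \<psi> \<odot>\<^bsub>X\<^esub> t'"
      using X.smult_r_distr[of "G \<psi>"] Gc[OF \<psi>] by simp
  next
    fix t \<psi> \<psi>' assume t: "t \<in> carrier X" and \<psi>: "\<psi> \<in> carrier (coreg K A)" and \<psi>': "\<psi>' \<in> carrier (coreg K A)"
    show "G (\<psi> \<oplus>\<^bsub>coreg K A\<^esub> \<psi>') \<odot>\<^bsub>X\<^esub> t = G \<psi> \<odot>\<^bsub>X\<^esub> t \<oplus>\<^bsub>X\<^esub> G \<psi>' \<odot>\<^bsub>X\<^esub> t"
      using X.smult_l_distr[of "G \<psi>" "G \<psi>'" t] Gc[OF \<psi>] Gc[OF \<psi>'] t mod_lin_add[OF G \<psi> \<psi>'] by simp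
  next
    fix a t \<psi> assume a: "a \<in> carrier A" and t: "t \<in> carrier X" and \<psi>: "\<psi> \<in> carrier (coreg K A)"
    show "G \<psi> \<odot>\<^bsub>X\<^esub> (a \<odot>\<^bsub>X\<^esub> t) = G (a \<odot>\<^bsub>coreg K A\<^esub> \<psi>) \<odot>\<^bsub>X\<^esub> t"
      using X.smult_assoc1[of "G \<psi>" a t] Gc[OF \<psi>] a t mod_lin_smult[OF G a \<psi>] by simp
  qed (use X.smult_closed Gc in auto)
qed

lemma tensor_map_cls:
  assumes X: "left_module (opposite A) X" and X': "left_module (opposite A) X'"
    and d: "mod_lin (opposite A) X X' d" and u: "Poly_Mapping.keys u \<subseteq> carrier X \<times> carrier (coreg K A)"
  shows "tensor_map A X X' (coreg K A) d (tensor_class A X (coreg K A) u) =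
    tensor_class A X' (coreg K A) (frag_extend (\<lambda>(t, \<psi>). frag_of (d t, \<psi>)) u)"
    and "Poly_Mapping.keys (frag_extend (\<lambda>(t, \<psi>). frag_of (d t, \<psi>)) u) \<subseteq> carrier X' \<times> carrier (coreg K A)"
proof -
  let ?Y = "coreg K A"
  interpret X: left_module "opposite A" X by fact
  interpret T: tensor_pair A X ?Y by (rule tensor_pair_coreg[OF X])
  interpret T': tensor_pair A X' ?Y by (rule tensor_pair_coreg[OF X'])
  let ?D = "frag_extend (\<lambda>(t, \<psi>). frag_of (d t, \<psi>))"
  note dc = mod_lin_closed[OF d]
  have DR: "?D r \<in> T'.R" if r: "r \<in> T.R" for r
  proof (rule frag_extend_relations[OF T.tensor_pair_axioms r T'.tensor_pair_axioms])
    fix a t \<psi> assume a: "a \<in> carrier A" and t: "t \<in> carrier X" and \<psi>: "\<psi> \<in> carrier ?Y"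
    show "(case (a \<odot>\<^bsub>X\<^esub> t, \<psi>) of (t, \<psi>) \<Rightarrow> frag_of (d t, \<psi>)) -
        (case (t, a \<odot>\<^bsub>?Y\<^esub> \<psi>) of (t, \<psi>) \<Rightarrow> frag_of (d t, \<psi>)) \<in> T'.R"
      using T'.R_balanced[OF a dc[OF t] \<psi>] mod_lin_smult[OF d, of a t] a t by simp
  qed (use dc mod_lin_add[OF d] in \<open>auto intro!: T'.R_add_left T'.R_add_right\<close>)
  have "tensor_map A X X' ?Y d (T.cls u) = (\<Union>u'\<in>T.cls u. T'.cls (?D u'))"
    unfolding tensor_map_def using T.cls_closed[OF u] by simp
  also have "\<dots> = T'.cls (?D u)"
  proof (rule T.Un_cls, rule T'.cls_eqI)
    fix u' assume "u' \<in> T.cls u"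
    then show "?D u' - ?D u \<in> T'.R" using DR[of "u' - u"] by (simp add: T.in_cls_iff frag_extend_diff)
  qed
  finally show "tensor_map A X X' ?Y d (T.cls u) = T'.cls (?D u)" .
  show "Poly_Mapping.keys (?D u) \<subseteq> carrier X' \<times> carrier ?Y"
    using u
  proof (induction u rule: T.F_induct)
    case (diff u v)
    then show ?case using keys_diff[of "?D u" "?D v"] by (auto simp: frag_extend_diff)
  qed (use dc in \<open>simp_all add: keys_frag_of\<close>)
qed

text \<open>Multiplication by an element of the trace of the opposite algebra factors, as an endomorphism of
  the coregular module, through a free module, and tensoring with a free module preserves exactness.\<close>

lemma trace_annihilates_cycle:
  assumes X2: "left_module (opposite A) X2" and X1: "left_module (opposite A) X1" and X0: "left_module (opposite A) X0"
    and d2: "mod_lin (opposite A) X2 X1 d2" and d1: "mod_lin (opposite A) X1 X0 d1"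
    and exact: "\<And>t. t \<in> carrier X1 \<Longrightarrow> d1 t = \<zero>\<^bsub>X0\<^esub> \<Longrightarrow> t \<in> d2 ` carrier X2"
    and u: "Poly_Mapping.keys u \<subseteq> carrier X1 \<times> carrier (coreg K A)"
    and cycle: "frag_extend (\<lambda>(t, \<psi>). frag_of (d1 t, \<psi>)) u \<in> tensor_relations A X0 (coreg K A)"
    and c: "c \<in> coreg_trace K (opposite A)"
  shows "\<exists>w. Poly_Mapping.keys w \<subseteq> carrier X2 \<times> carrier (coreg K A) \<and>
    frag_extend (\<lambda>(t, \<psi>). frag_of (t, \<lambda>x\<in>carrier A. \<psi> (c \<otimes> x))) u -
      frag_extend (\<lambda>(t, \<psi>). frag_of (d2 t, \<psi>)) w \<in> tensor_relations A X1 (coreg K A)"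
  using c
proof (induction rule: coreg_trace.induct)
  let ?Y = "coreg K A"
  interpret X1: left_module "opposite A" X1 by fact
  interpret X0: left_module "opposite A" X0 by fact
  interpret T1: tensor_pair A X1 ?Y by (rule tensor_pair_coreg[OF X1])
  interpret T0: tensor_pair A X0 ?Y by (rule tensor_pair_coreg[OF X0])
  interpret op: fd_alg K "opposite A" by (rule opposite_fd_alg)
  let ?D2 = "frag_extend (\<lambda>(t, \<psi>). frag_of (d2 t, \<psi>))" and ?D1 = "frag_extend (\<lambda>(t, \<psi>). frag_of (d1 t, \<psi>))"
  let ?r = "\<lambda>c. frag_extend (\<lambda>(t, \<psi>). frag_of (t, \<lambda>x\<in>carrier A. \<psi> (c \<otimes> x)))"
  have r_pure: "?r c (frag_of (t, \<psi>)) = frag_of (t, \<lambda>x\<in>carrier A. \<psi> (c \<otimes> x))" for c t \<psi>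
    by (simp only: frag_extend_of prod.case)
  note d1c = mod_lin_closed[OF d1] and d2c = mod_lin_closed[OF d2]
  {
    case zero
    have "?r \<zero> u \<in> T1.R"
      using u
    proof (induction u rule: T1.F_induct)
      case (diff u v)
      then show ?case by (simp add: frag_extend_diff T1.R_diff)
    next
      case (pure t \<psi>)
      have "(\<lambda>x\<in>carrier A. \<psi> (\<zero> \<otimes> x)) = \<zero>\<^bsub>?Y\<^esub>"
        using vs.form_zero[OF coregD(4)[OF pure(2)]] by (auto simp: coreg_sel fun_eq_iff)
      moreover have "frag_of (t, \<zero>\<^bsub>?Y\<^esub>) \<in> T1.R"
        using T1.R_minus[OF T1.R_add_right[OF pure(1) D.M.zero_closed D.M.zero_closed]] by simp
      ultimately show ?case unfolding r_pure by simp
    qed (simp add: T1.R_zero)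
    then show ?case by (intro exI[of _ 0] conjI) (simp_all only: opposite_sel frag_extend_0 diff_zero keys_zero empty_subsetI)
  next
    case (add c H \<phi>)
    \<comment> \<open>Sides are exchanged here: \<open>H\<close> is linear over the opposite
      algebra, and its adjoint \<open>G\<close> is a left linear map from \<open>D A\<close> to
      \<open>A\<close>.\<close>
    obtain G where HG: "adjoint_pair K (opposite A) H G" using op.ex_adjoint[OF add.hyps(2)] by blast
    have G: "mod_lin A ?Y (regular_module A) G" using op.adjoint_opposite[OF HG] by simp
    have \<phi>: "\<phi> \<in> carrier ?Y" using add.hyps(3) by (simp add: coreg_opposite_carrier)
    have Hc: "H \<psi> \<in> carrier A" if "\<psi> \<in> carrier ?Y" for \<psi>
      using op.hom_closed[OF add.hyps(2), of \<psi>] that by (simp add: coreg_opposite_carrier)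
    note Gc = hom_closed[OF G]
    define h where "h = H \<phi>"
    have hA: "h \<in> carrier A" and cA: "c \<in> carrier A"
      using Hc[OF \<phi>] op.coreg_trace_closed[OF add.hyps(1)] by (simp_all add: h_def)
    \<comment> \<open>The factorisation through \<open>A\<close>:
      \<open>\<psi> \<mapsto> \<psi>(h -)\<close> first applies \<open>G\<close> and then lets the
      result act on \<open>\<phi>\<close>.\<close>
    have key: "(\<lambda>x\<in>carrier A. \<psi> (h \<otimes> x)) = G \<psi> \<odot>\<^bsub>?Y\<^esub> \<phi>" if \<psi>: "\<psi> \<in> carrier ?Y" for \<psi>
    proof -
      have "\<psi> (h \<otimes> x) = \<phi> (x \<otimes> G \<psi>)" if x: "x \<in> carrier A" for x
      proof -
        have \<phi>x: "(\<lambda>y\<in>carrier A. \<phi> (x \<otimes> y)) \<in> carrier ?Y" by (rule coreg_translate_left[OF \<phi> x])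
        have "h \<otimes> x = H (\<lambda>y\<in>carrier A. \<phi> (x \<otimes> y))"
          using mod_lin_smult[OF add.hyps(2), of x \<phi>] x \<phi> by (simp add: h_def coreg_opposite_carrier dual_sel)
        then show ?thesis
          using op.adjoint_pairD(3)[OF HG, of \<psi> "\<lambda>y\<in>carrier A. \<phi> (x \<otimes> y)"] \<phi>x \<psi> Gc[OF \<psi>]
          by (simp add: coreg_opposite_carrier)
      qed
      then show ?thesis by (auto simp: coreg_sel fun_eq_iff)
    qed
    obtain w where w: "Poly_Mapping.keys w \<subseteq> carrier X2 \<times> carrier ?Y" "?r c u - ?D2 w \<in> T1.R"
      using add.IH by blast
    \<comment> \<open>Contractions by \<open>G\<close> on \<open>X1\<close> and on
      \<open>X0\<close>; by \<open>nat\<close> below they are compatible with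
      \<open>d1\<close>.\<close>
    obtain l where l: "T1.is_lift X1 (\<lambda>t \<psi>. G \<psi> \<odot>\<^bsub>X1\<^esub> t) l" using contraction_lift[OF X1 G] by blast
    obtain l' where l': "T0.is_lift X0 (\<lambda>t \<psi>. G \<psi> \<odot>\<^bsub>X0\<^esub> t) l'" using contraction_lift[OF X0 G] by blast
    have keysD1: "Poly_Mapping.keys (?D1 v) \<subseteq> carrier X0 \<times> carrier ?Y"
      if "Poly_Mapping.keys v \<subseteq> carrier X1 \<times> carrier ?Y" for v
      by (rule tensor_map_cls(2)[OF X1 X0 d1 that])
    have d1_zero: "d1 \<zero>\<^bsub>X1\<^esub> = \<zero>\<^bsub>X0\<^esub>"
      by (rule additive_zero[OF X1.M.abelian_group_axioms X0.M.abelian_group_axioms d1c mod_lin_add[OF d1]])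
    have d1_minus: "d1 (t \<ominus>\<^bsub>X1\<^esub> t') = d1 t \<ominus>\<^bsub>X0\<^esub> d1 t'" if t: "t \<in> carrier X1" "t' \<in> carrier X1" for t t'
    proof -
      have "d1 (t \<ominus>\<^bsub>X1\<^esub> t') \<oplus>\<^bsub>X0\<^esub> d1 t' = d1 t"
        using mod_lin_add[OF d1, of "t \<ominus>\<^bsub>X1\<^esub> t'" t'] t
        by (simp add: X1.M.minus_eq X1.M.a_assoc X1.M.l_neg)
      then have "d1 t \<ominus>\<^bsub>X0\<^esub> d1 t' = (d1 (t \<ominus>\<^bsub>X1\<^esub> t') \<oplus>\<^bsub>X0\<^esub> d1 t') \<ominus>\<^bsub>X0\<^esub> d1 t'" by simp
      also have "\<dots> = d1 (t \<ominus>\<^bsub>X1\<^esub> t')"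
        using d1c[of "t \<ominus>\<^bsub>X1\<^esub> t'"] d1c[OF t(2)] t by (simp add: X0.M.minus_eq X0.M.a_assoc X0.M.r_neg)
      finally show ?thesis by simp
    qed
    have nat: "l' (?D1 v) = d1 (l v)" if "Poly_Mapping.keys v \<subseteq> carrier X1 \<times> carrier ?Y" for v
      using that
    proof (induction v rule: T1.F_induct)
      case zero
      have "l 0 = \<zero>\<^bsub>X1\<^esub>" "l' 0 = \<zero>\<^bsub>X0\<^esub>"
        using T1.is_liftD(5)[OF l T1.R_zero] T0.is_liftD(5)[OF l' T0.R_zero] by auto
      then show ?case using d1_zero by simp
    next
      case (diff v v')
      then show ?case
        using T0.is_liftD(3)[OF l' keysD1 keysD1] T1.is_liftD(3)[OF l diff(1,2)]
          d1_minus[OF T1.is_liftD(1)[OF l] T1.is_liftD(1)[OF l]] by (simp add: frag_extend_diff)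
    next
      case (pure t \<psi>)
      then show ?case
        using T0.is_liftD(4)[OF l' d1c[OF pure(1)] pure(2)] T1.is_liftD(4)[OF l pure]
          mod_lin_smult[OF d1, of "G \<psi>" t] Gc by simp
    qed
    \<comment> \<open>A cycle contracts to an element of the kernel of \<open>d1\<close>, where
      exactness of the given sequence applies.\<close>
    have "d1 (l u) = \<zero>\<^bsub>X0\<^esub>" using nat[OF u] T0.is_liftD(5)[OF l' cycle] by simp
    then obtain s where s: "s \<in> carrier X2" "l u = d2 s"
      using exact[OF T1.is_liftD(1)[OF l u]] by blast
    \<comment> \<open>Modulo relations, \<open>t \<otimes> \<psi>(h -) = t \<otimes> G(\<psi>)
      \<phi> = t G(\<psi>) \<otimes> \<phi>\<close>, so the contribution of \<open>h\<close> is
      \<open>l v \<otimes> \<phi>\<close>.\<close>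
    have contract: "?r h v - frag_of (l v, \<phi>) \<in> T1.R"
      if "Poly_Mapping.keys v \<subseteq> carrier X1 \<times> carrier ?Y" for v
      using that
    proof (induction v rule: T1.F_induct)
      case zero
      have "l 0 = \<zero>\<^bsub>X1\<^esub>" using T1.is_liftD(5)[OF l T1.R_zero] .
      moreover have "- frag_of (\<zero>\<^bsub>X1\<^esub>, \<phi>) \<in> T1.R"
        using T1.R_add_left[OF X1.M.zero_closed X1.M.zero_closed \<phi>] by simp
      ultimately show ?case by simp
    next
      case (diff v v')
      have 1: "frag_of (l v \<ominus>\<^bsub>X1\<^esub> l v', \<phi>) - (frag_of (l v, \<phi>) - frag_of (l v', \<phi>)) \<in> T1.R"
        by (rule T1.R_diff_left[OF T1.is_liftD(1)[OF l diff(1)] T1.is_liftD(1)[OF l diff(2)] \<phi>])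
      have eq: "?r h (v - v') - frag_of (l (v - v'), \<phi>) = (?r h v - frag_of (l v, \<phi>)) -
          (?r h v' - frag_of (l v', \<phi>)) - (frag_of (l v \<ominus>\<^bsub>X1\<^esub> l v', \<phi>) - (frag_of (l v, \<phi>) - frag_of (l v', \<phi>)))"
        unfolding T1.is_liftD(3)[OF l diff(1,2)] by (simp add: frag_extend_diff)
      show ?case unfolding eq by (rule T1.R_diff[OF T1.R_diff[OF diff(3,4)] 1])
    next
      case (pure t \<psi>)
      have "frag_of (G \<psi> \<odot>\<^bsub>X1\<^esub> t, \<phi>) - frag_of (t, G \<psi> \<odot>\<^bsub>?Y\<^esub> \<phi>) \<in> T1.R"
        by (rule T1.R_balanced[OF Gc[OF pure(2)] pure(1) \<phi>])
      from T1.R_minus[OF this] show ?case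
        unfolding r_pure key[OF pure(2)] T1.is_liftD(4)[OF l pure] by simp
    qed
    have split: "?r (c \<oplus> h) v - (?r c v + ?r h v) \<in> T1.R"
      if "Poly_Mapping.keys v \<subseteq> carrier X1 \<times> carrier ?Y" for v
      using that
    proof (induction v rule: T1.F_induct)
      case (diff v v')
      have eq: "?r (c \<oplus> h) (v - v') - (?r c (v - v') + ?r h (v - v')) =
          (?r (c \<oplus> h) v - (?r c v + ?r h v)) - (?r (c \<oplus> h) v' - (?r c v' + ?r h v'))"
        by (simp add: frag_extend_diff)
      show ?case unfolding eq by (rule T1.R_diff[OF diff(3,4)])
    next
      case (pure t \<psi>)
      have "(\<lambda>x\<in>carrier A. \<psi> ((c \<oplus> h) \<otimes> x)) =
          (\<lambda>x\<in>carrier A. \<psi> (c \<otimes> x)) \<oplus>\<^bsub>?Y\<^esub> (\<lambda>x\<in>carrier A. \<psi> (h \<otimes> x))"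
        using cA hA coregD(2)[OF pure(2)] by (auto simp: coreg_sel fun_eq_iff A.l_distr)
      then show ?case
        using T1.R_add_right[OF pure(1) coreg_translate_left[OF pure(2) cA] coreg_translate_left[OF pure(2) hA]]
        unfolding r_pure by (simp only: diff_diff_eq)
    qed (simp add: T1.R_zero)
    \<comment> \<open>The new preimage consists of \<open>w\<close> for \<open>c\<close> and
      \<open>s \<otimes> \<phi>\<close> for \<open>h\<close>, where
      \<open>l u = d2 s\<close>.\<close>
    have "Poly_Mapping.keys (w + frag_of (s, \<phi>)) \<subseteq> carrier X2 \<times> carrier ?Y"
      using keys_add[of w "frag_of (s, \<phi>)"] w(1) s(1) \<phi> by (auto simp: keys_frag_of)
    moreover have "?r (c \<oplus> h) u - ?D2 (w + frag_of (s, \<phi>)) \<in> T1.R"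
    proof -
      have eq: "?r (c \<oplus> h) u - ?D2 (w + frag_of (s, \<phi>)) =
          (?r (c \<oplus> h) u - (?r c u + ?r h u)) + (?r c u - ?D2 w) + (?r h u - frag_of (l u, \<phi>))"
        by (simp add: frag_extend_add s(2))
      show ?thesis unfolding eq by (rule T1.R_add[OF T1.R_add[OF split[OF u] w(2)] contract[OF u]])
    qed
    ultimately show ?case unfolding h_def opposite_sel by blast
  }
qed

text \<open>The case \<open>c = 1\<close> of \<open>trace_annihilates_cycle\<close>: the unit acts
  as the identity on the coregular module, so every cycle is itself a boundary.\<close>

theorem Tor_trivial:
  fixes T :: "nat \<Rightarrow> ('a, 't) module"
  assumes one: "\<one> \<in> coreg_trace K (opposite A)" and n: "n \<ge> 1"
    and lm: "\<And>m. left_module (opposite A) (T m)"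
    and d2: "\<delta> (Suc n) \<in> mod_hom (opposite A) (T (Suc n)) (T n)"
    and d1: "\<delta> n \<in> mod_hom (opposite A) (T n) (T (n - 1))"
    and exact: "\<delta> (Suc n) ` carrier (T (Suc n)) = a_kernel (T n) (T (n - 1)) (\<delta> n)"
  shows "trivial_group (Tor A T \<delta> (coreg K A) n)"
proof -
  let ?Y = "coreg K A"
  define Z0 where "Z0 = T (n - 1)"
  note d1 = d1[folded Z0_def] and exact = exact[folded Z0_def]
  interpret X0: left_module "opposite A" Z0 unfolding Z0_def by (rule lm)
  note T0zero = X0.M.zero_closed and T0add = X0.M.l_zero[OF X0.M.zero_closed]
  interpret T2: tensor_pair A "T (Suc n)" ?Y by (rule tensor_pair_coreg[OF lm])
  interpret T1: tensor_pair A "T n" ?Y by (rule tensor_pair_coreg[OF lm])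
  interpret T0: tensor_pair A Z0 ?Y by (rule tensor_pair_coreg[OF X0.left_module_axioms])
  have l2: "mod_lin (opposite A) (T (Suc n)) (T n) (\<delta> (Suc n))"
    and l1: "mod_lin (opposite A) (T n) (Z0) (\<delta> n)" using d1 d2 by (auto simp: mod_hom_iff)
  let ?D2 = "frag_extend (\<lambda>(t, \<psi>). frag_of (\<delta> (Suc n) t, \<psi>))" and ?D1 = "frag_extend (\<lambda>(t, \<psi>). frag_of (\<delta> n t, \<psi>))"
  let ?m1 = "tensor_map A (T n) (Z0) ?Y (\<delta> n)"
  note m2 = tensor_map_cls[OF lm lm l2] and m1 = tensor_map_cls[OF lm X0.left_module_axioms l1]
  have ex: "t \<in> carrier (T n) \<and> \<delta> n t = \<zero>\<^bsub>Z0\<^esub> \<longleftrightarrow> t \<in> \<delta> (Suc n) ` carrier (T (Suc n))" for t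
    unfolding exact by (simp add: a_kernel_def')
  have hom: "?m1 \<in> hom T1.T T0.T"
  proof (rule homI)
    fix U assume "U \<in> carrier T1.T"
    then obtain u where u: "Poly_Mapping.keys u \<subseteq> carrier (T n) \<times> carrier ?Y" "U = T1.cls u"
      by (auto simp: T1.carrier_T)
    show "?m1 U \<in> carrier T0.T"
      unfolding u(2) m1(1)[OF u(1)] by (rule T0.cls_closed[OF m1(2)[OF u(1)]])
  next
    fix U V assume "U \<in> carrier T1.T" "V \<in> carrier T1.T"
    then obtain u v where uv: "Poly_Mapping.keys u \<subseteq> carrier (T n) \<times> carrier ?Y" "U = T1.cls u"
      "Poly_Mapping.keys v \<subseteq> carrier (T n) \<times> carrier ?Y" "V = T1.cls v"
      by (auto simp: T1.carrier_T)
    have "Poly_Mapping.keys (u + v) \<subseteq> carrier (T n) \<times> carrier ?Y"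
      using keys_add[of u v] uv by blast
    then show "?m1 (U \<otimes>\<^bsub>T1.T\<^esub> V) = ?m1 U \<otimes>\<^bsub>T0.T\<^esub> ?m1 V"
      using uv m1 by (simp add: T1.mult_T T0.mult_T frag_extend_add)
  qed
  interpret h: group_hom T1.T T0.T ?m1
    using hom T1.comm_group_T T0.comm_group_T by (simp add: group_hom_def group_hom_axioms_def comm_group_def)
  have Z: "tensor_cycles A T \<delta> ?Y n = kernel T1.T T0.T ?m1" using n by (simp add: tensor_cycles_def Z0_def)
  have "tensor_boundaries A T \<delta> ?Y n = kernel T1.T T0.T ?m1"
  proof (intro equalityI subsetI)
    fix U assume "U \<in> tensor_boundaries A T \<delta> ?Y n"
    then obtain w where w: "Poly_Mapping.keys w \<subseteq> carrier (T (Suc n)) \<times> carrier ?Y" "U = T1.cls (?D2 w)"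
      using m2(1) by (auto simp: tensor_boundaries_def T2.carrier_T)
    have "?D1 (?D2 w) \<in> T0.R"
      using w(1)
    proof (induction w rule: T2.F_induct)
      case (diff u v)
      then show ?case by (simp add: frag_extend_diff T0.R_diff)
    next
      case (pure t \<psi>)
      have "\<delta> n (\<delta> (Suc n) t) = \<zero>\<^bsub>Z0\<^esub>" using ex pure(1) by blast
      moreover have "- frag_of (\<zero>\<^bsub>Z0\<^esub>, \<psi>) \<in> T0.R"
        using T0.R_add_left[OF T0zero T0zero pure(2)] T0add by simp
      ultimately show ?case using T0.R_minus by fastforce
    qed (simp add: T0.R_zero)
    then have "?m1 (T1.cls (?D2 w)) = T0.cls 0"
      unfolding m1(1)[OF m2(2)[OF w(1)]] by (intro T0.cls_eqI) simp
    then show "U \<in> kernel T1.T T0.T ?m1"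
      using T1.cls_closed[OF m2(2)[OF w(1)]] w(2) by (simp add: kernel_def T0.one_T)
  next
    fix U assume "U \<in> kernel T1.T T0.T ?m1"
    then obtain u where u: "Poly_Mapping.keys u \<subseteq> carrier (T n) \<times> carrier ?Y" "U = T1.cls u"
      "?m1 (T1.cls u) = T0.cls 0"
      by (auto simp: kernel_def T1.carrier_T T0.one_T)
    have cyc: "?D1 u \<in> T0.R" using u(3) unfolding m1(1)[OF u(1)] T0.cls_eq_iff by simp
    obtain w where w: "Poly_Mapping.keys w \<subseteq> carrier (T (Suc n)) \<times> carrier ?Y"
      "frag_extend (\<lambda>(t, \<psi>). frag_of (t, \<lambda>x\<in>carrier A. \<psi> (\<one> \<otimes> x))) u - ?D2 w \<in> T1.R"
      using trace_annihilates_cycle[OF lm lm X0.left_module_axioms l2 l1 _ u(1) cyc one] ex by blast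
    have "frag_extend (\<lambda>(t, \<psi>). frag_of (t, \<lambda>x\<in>carrier A. \<psi> (\<one> \<otimes> x))) u = u"
      using u(1)
    proof (induction u rule: T1.F_induct)
      case (pure t \<psi>)
      have "(\<lambda>x\<in>carrier A. \<psi> (\<one> \<otimes> x)) = \<psi>"
        using coregD(5)[OF pure(2)] by (intro extensionalityI[of _ "carrier A"]) auto
      then show ?case by (simp only: frag_extend_of prod.case)
    qed (simp_all add: frag_extend_diff)
    then have "T1.cls u = T1.cls (?D2 w)" using w(2) by (intro T1.cls_eqI) simp
    also have "\<dots> = tensor_map A (T (Suc n)) (T n) ?Y (\<delta> (Suc n)) (T2.cls w)" using m2(1)[OF w(1)] by simp
    finally show "U \<in> tensor_boundaries A T \<delta> ?Y n"
      using u(2) T2.cls_closed[OF w(1)] by (auto simp: tensor_boundaries_def)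
  qed
  then show ?thesis
    unfolding Tor_def Z using trivial_factor_group[OF T1.comm_group_T h.subgroup_kernel] by simp
qed

end

section \<open>Minimal resolutions and assembly of the results\<close>

lemma mod_hom_restricted_codomain:
  assumes "g \<in> mod_hom A M (N\<lparr>carrier := S\<rparr>)" "S \<subseteq> carrier N"
  shows "g \<in> mod_hom A M N"
  using assms by (auto simp: mod_hom_def PiE_iff)

text \<open>Each differential covers a syzygy: its codomain is the previous term with the carrier
  cut down to a kernel. Forgetting the restriction gives the differential, and surjectivity of the
  cover is exactness.\<close>

lemma minimal_projective_resolutionD:
  assumes "minimal_projective_resolution K A M P d e"
  shows "fd_module K A (P n)"
    and "n \<ge> 1 \<Longrightarrow> d n \<in> mod_hom A (P n) (P (n - 1))"
    and "n \<ge> 1 \<Longrightarrow> d (Suc n) ` carrier (P (Suc n)) = a_kernel (P n) (P (n - 1)) (d n)"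
proof -
  have c0: "projective_cover K A (P 0) M e"
    and c1: "projective_cover K A (P 1) ((P 0)\<lparr>carrier := a_kernel (P 0) M e\<rparr>) (d 1)"
    and c: "projective_cover K A (P (Suc m))
        ((P m)\<lparr>carrier := a_kernel (P m) (P (m - 1)) (d m)\<rparr>) (d (Suc m))" if "m \<ge> 1" for m
    using assms that unfolding minimal_projective_resolution_def by auto
  have ker: "a_kernel X Y f \<subseteq> carrier X" for X Y and f :: "'p \<Rightarrow> 'r"
    by (auto simp: a_kernel_def')
  consider "n = 0" | "n = 1" | m where "m \<ge> 1" "n = Suc m"
    by (metis One_nat_def Suc_le_eq not0_implies_Suc zero_less_iff_neq_zero)
  then show "fd_module K A (P n)"
    using c0 c1 c by cases (auto simp: projective_cover_def)
  show "d n \<in> mod_hom A (P n) (P (n - 1))" if n: "n \<ge> 1"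
  proof (cases "n = 1")
    case True
    have "d 1 \<in> mod_hom A (P 1) ((P 0)\<lparr>carrier := a_kernel (P 0) M e\<rparr>)"
      using c1 unfolding projective_cover_def by blast
    from mod_hom_restricted_codomain[OF this ker] show ?thesis by (simp add: True)
  next
    case False
    then obtain m where m: "m \<ge> 1" "n = Suc m" using n by (cases n) auto
    have "d (Suc m) \<in> mod_hom A (P (Suc m)) ((P m)\<lparr>carrier := a_kernel (P m) (P (m - 1)) (d m)\<rparr>)"
      using c[OF m(1)] unfolding projective_cover_def by blast
    from mod_hom_restricted_codomain[OF this ker] show ?thesis by (simp add: m)
  qed
  show "d (Suc n) ` carrier (P (Suc n)) = a_kernel (P n) (P (n - 1)) (d n)" if "n \<ge> 1"
    using c[OF that] by (simp add: projective_cover_def)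
qed

theorem corollary3p5:
  fixes K :: "'k ring" and \<Lambda> :: "('k, 'a) module"
  assumes "fd_algebra K \<Lambda>"
    and "separable K (quotient_module \<Lambda> (radical \<Lambda>))"
    and "selfinjective K \<Lambda>"
    and "\<not> semisimple_ring \<Lambda>"
  shows "selfinjective K (enveloping K \<Lambda>)
    \<and> (\<forall>(Q :: nat \<Rightarrow> (('a \<times> 'a \<Rightarrow>\<^sub>0 int) set, 'q) module) \<delta> \<epsilon>.
         projective_resolution K (enveloping K \<Lambda>) (regular_bimodule \<Lambda>) Q \<delta> \<epsilon> \<longrightarrow>
         (\<forall>n\<ge>1. trivial_group
            (Ext (enveloping K \<Lambda>) Q \<delta> (regular_module (enveloping K \<Lambda>)) n)))
    \<and> (\<forall>(P :: nat \<Rightarrow> (('a \<times> 'a \<Rightarrow>\<^sub>0 int) set, 'p) module) d \<epsilon>.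
         minimal_projective_resolution K (enveloping K \<Lambda>) (regular_bimodule \<Lambda>) P d \<epsilon> \<longrightarrow>
         (\<forall>n\<ge>1. tau K (enveloping K \<Lambda>) P d n = boundaries K (enveloping K \<Lambda>) P d n))
    \<and> (\<forall>(T :: nat \<Rightarrow> ('a, 't) module) \<delta> \<epsilon>.
         projective_resolution K (opposite \<Lambda>) (dual K \<Lambda> (regular_module \<Lambda>)) T \<delta> \<epsilon> \<longrightarrow>
         (\<forall>n\<ge>1. trivial_group
            (Tor \<Lambda> T \<delta> (dual K (opposite \<Lambda>) (regular_module (opposite \<Lambda>))) n)))"
proof -
  interpret L: fd_alg K \<Lambda>
    using assms(1) by (simp add: fd_algebra_def fd_alg_def fd_alg_axioms_def kalg_def)
  interpret op: fd_alg K "opposite \<Lambda>" by (rule L.opposite_fd_alg)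
  interpret E: fd_algebra_pair K \<Lambda> "opposite \<Lambda>" ..
  have enveloping: "enveloping K \<Lambda> = E.C" by (simp add: enveloping_def)
  have one: "\<one>\<^bsub>\<Lambda>\<^esub> \<in> coreg_trace K \<Lambda>" by (rule L.selfinjective_imp_trace[OF assms(3)])
  have one_op: "\<one>\<^bsub>\<Lambda>\<^esub> \<in> coreg_trace K (opposite \<Lambda>)" by (rule L.coreg_trace_opposite[OF one])
  \<comment> \<open>Both sides enter here: the unit of the enveloping algebra is
    \<open>1 \<otimes> 1\<close>, with its second factor in the opposite algebra.\<close>
  have one_E: "\<one>\<^bsub>E.C\<^esub> \<in> coreg_trace K E.C"
    using E.tensor_trace[OF one one_op] by (simp add: E.one_pure)
  show ?thesis
    unfolding enveloping
  proof (intro conjI allI impI)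
    show "selfinjective K E.C" by (rule E.C.trace_imp_selfinjective[OF one_E])
  next
    fix Q :: "nat \<Rightarrow> (('a \<times> 'a \<Rightarrow>\<^sub>0 int) set, 'q) module" and \<delta> \<epsilon> and n :: nat
    assume Q: "projective_resolution K E.C (regular_bimodule \<Lambda>) Q \<delta> \<epsilon>" and n: "1 \<le> n"
    \<comment> \<open>The resolution specifies its differentials as \<open>\<delta> (Suc k)\<close>;
      for \<open>n \<ge> 1\<close> this covers \<open>\<delta> n\<close>.\<close>
    obtain m where m: "n = Suc m" using n by (cases n) auto
    have hom: "\<delta> (Suc k) \<in> mod_hom E.C (Q (Suc k)) (Q k)" and fd: "fd_module K E.C (Q k)" for k
      using Q unfolding projective_resolution_def by auto
    have "exact_triple K E.C (Q (Suc n)) (Q n) (Q (n - 1)) (\<delta> (Suc n)) (\<delta> n)"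
    proof (intro exact_triple.intro E.tensor_kalg exact_triple_axioms.intro one_E fd hom)
      show "\<delta> n \<in> mod_hom E.C (Q n) (Q (n - 1))" using hom[of m] by (simp add: m)
      show "\<delta> (Suc n) ` carrier (Q (Suc n)) = a_kernel (Q n) (Q (n - 1)) (\<delta> n)"
        using Q n unfolding projective_resolution_def by blast
    qed
    then show "trivial_group (Ext E.C Q \<delta> (regular_module E.C) n)"
      by (rule exact_triple.Ext_trivial) (rule n refl)+
  next
    fix P :: "nat \<Rightarrow> (('a \<times> 'a \<Rightarrow>\<^sub>0 int) set, 'p) module" and d \<epsilon> and n :: nat
    assume P: "minimal_projective_resolution K E.C (regular_bimodule \<Lambda>) P d \<epsilon>" and n: "1 \<le> n"
    note PD = minimal_projective_resolutionD[OF P]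
    have d: "d (Suc n) \<in> mod_hom E.C (P (Suc n)) (P n)" using PD(2)[of "Suc n"] by simp
    interpret X: exact_triple K E.C "P (Suc n)" "P n" "P (n - 1)" "d (Suc n)" "d n"
      by (intro exact_triple.intro E.tensor_kalg exact_triple_axioms.intro one_E PD(1) d PD(2,3) n)
    obtain I \<xi> where I: "dual_basis K \<Lambda> I (\<lambda>b. b) \<xi>" using L.vs.ex_dual_basis[OF L.fin_dim] by blast
    obtain J \<eta> where J: "dual_basis K (opposite \<Lambda>) J (\<lambda>b. b) \<eta>" using op.vs.ex_dual_basis[OF op.fin_dim] by blast
    \<comment> \<open>By \<open>AR_translate_realised\<close> the translate is the kernel of the
      Nakayama image of \<open>d n\<close>, so the claim is exactness at the Nakayama image of
      \<open>P n\<close>.\<close>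
    show "tau K E.C P d n = boundaries K E.C P d n"
      unfolding tau_def boundaries_def
        AR_translate_realised[OF E.C.k_algebra X.P1.left_module_axioms X.P0.left_module_axioms PD(2)[OF n]]
      by (rule X.nakayama_exact[OF E.tensor_dual_basis[OF I J]])
  next
    fix T :: "nat \<Rightarrow> ('a, 't) module" and \<delta> \<epsilon> and n :: nat
    assume T: "projective_resolution K (opposite \<Lambda>) (dual K \<Lambda> (regular_module \<Lambda>)) T \<delta> \<epsilon>" and n: "1 \<le> n"
    obtain m where m: "n = Suc m" using n by (cases n) auto
    have hom: "\<delta> (Suc k) \<in> mod_hom (opposite \<Lambda>) (T (Suc k)) (T k)"
      and lm: "left_module (opposite \<Lambda>) (T k)" for k
      using T unfolding projective_resolution_def fd_module_def by auto
    \<comment> \<open>\<open>T\<close> resolves \<open>D \<Lambda>\<close> as a right module, so its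
      terms live over the opposite algebra, and the trace condition enters for that side.\<close>
    show "trivial_group (Tor \<Lambda> T \<delta> (coreg K \<Lambda>) n)"
    proof (rule L.Tor_trivial[where T = T and \<delta> = \<delta>, OF one_op n lm hom])
      show "\<delta> n \<in> mod_hom (opposite \<Lambda>) (T n) (T (n - 1))" using hom[of m] by (simp add: m)
      show "\<delta> (Suc n) ` carrier (T (Suc n)) = a_kernel (T n) (T (n - 1)) (\<delta> n)"
        using T n unfolding projective_resolution_def by blast
    qed
  qed
qed

end
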